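(* Assume $p\ne2$ and let $\phi:\mathsf{A}\to A[\tau]$ be given by $\phi_t=\theta+\kappa_1\tau+\kappa_2\tau^2$ with $\kappa_1\in A$, $\kappa_2\in\mathbb{F}_q^\times$. (a) If $\deg_\theta\kappa_1\le(q+1)/2$, then \[\mathrm{Reg}_{\mathrm{Alt}^2\phi}=\mathrm{Log}_{\mathrm{Alt}^2\phi}(1)=1+\frac{\kappa_2}{\theta-\theta^{(1)}}\sum_{m\ge1}(\beta_m\tilde\beta_{m-2}-\beta_{m-1}\tilde\beta_{m-1}).\] (b) If $\deg_\theta\kappa_1\le1$, then (i) $\mathrm{Reg}_{\mathrm{Sym}^2\phi}=\gamma\det(M)$, where $\gamma\in\mathbb{F}_q^\times$ is such that $\gamma\det M$ has leading coefficient $1$ in $K_\infty$, and \[M=\begin{pmatrix}1+\hat L_1(\theta)&-\hat L_1(\kappa_1)-2\kappa_2\hat L_2(1)-\partial_\theta(\kappa_1)&-\kappa_2\hat L_1(1)\\-\kappa_2^{-1}\widetilde L_1(\theta)&\mathrm{Log}_{\mathrm{Alt}^2\phi}(1)+\kappa_2^{-1}\widetilde L_1(\kappa_1)+2\widetilde L_2(1)&\widetilde L_1(1)\\-\kappa_2^{-1}\mathrm{Log}_{\phi,2}(\theta)&\kappa_2^{-1}\mathrm{Log}_{\phi,2}(\kappa_1)+2L_2(1)&\mathrm{Log}_{\phi,2}(1)\end{pmatrix};\] (ii) $\mathrm{Reg}_{\phi^{\otimes2}}=\mathrm{Reg}_{\mathrm{Sym}^2\phi}\cdot\mathrm{Re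g}_{\mathrm{Alt}^2\phi}$.
   Context: $q=p^m$, $A=\mathbb{F}_q[\theta]$, $K=\mathbb{F}_q(\theta)$, $K_\infty=\mathbb{F}_q((\theta^{-1}))$, $\mathsf{A}=\mathbb{F}_q[t]$; $R[\tau]$ twisted polynomials ($\tau c=c^q\tau$), matrices $\sum B_i\tau^i$ acting by $\mathbf{x}\mapsto\sum B_i\mathbf{x}^{(i)}$. The $t$-modules: $\phi^{\otimes2}_t=B_0+B_1\tau+B_2\tau^2$ with $B_0=\begin{pmatrix}\theta&0&\kappa_1&\kappa_2\\0&\theta&0&0\\0&0&\theta&0\\0&0&0&\theta\end{pmatrix}$, $B_1=\begin{pmatrix}0&0&0&0\\\kappa_1&0&\kappa_2&0\\\kappa_1&\kappa_2&0&0\\0&0&\kappa_1&0\end{pmatrix}$, $B_2$ with only nonzero entry $\kappa_2$ at $(4,1)$; $(\mathrm{Sym}^2\phi)_t=\begin{pmatrix}\theta&\kappa_1&\kappa_2\\\kappa_1\tau&\theta+\kappa_2\tau&0\\\kappa_2\tau^2&\kappa_1\tau&\theta\end{pmatrix}$; $(\mathrm{Alt}^2\phi)_t=\theta-\kappa_2\tau$. $\mathrm{Log}_E$ is the inverse of $\mathrm{Exp}_E$ ($\mathrm{Exp}_E=\sum C_i\tau^i$, $C_0=I$, $\mathrm{Exp}_E\partial E_t=E_t\mathrm{Exp}_E$) as twisted power series. Regulator: make $K_\infty^d$ a $K_\infty$-vector space via $\sum c_jt^{-j}\mapsto\sum c_j(\partial E_t)^{-j}$, $t\mapsto\theta$,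 where $\partial E_t$ is the constant term; $\mathrm{Reg}_E=\gamma'\det V$ with $V$ the coordinates of an $A$-basis of $\mathrm{Exp}_E^{-1}(A^d)\cap K_\infty^d$ with respect to an $A$-basis of $A^d$, $\gamma'\in\mathbb{F}_q^\times$ making the leading $\theta^{-1}$-coefficient $1$. Series: for $g\in K(t)$, $g^{(n)}$ raises coefficients to the $q^n$-th power, $t$ fixed. $\mathcal{B}_m(t)\in K(t)$: $\mathcal{B}_m=0$ ($m<0$), $\mathcal{B}_0=1$, $\mathcal{B}_m=\frac{\kappa_1^{(m-1)}\mathcal{B}_{m-1}+\kappa_2\mathcal{B}_{m-2}}{t-\theta^{(m)}}$. $\beta_m=\mathcal{B}_m(\theta)$ (so $\mathrm{Log}_\phi(z)=\sum_{m\ge0}\beta_mz^{q^m}$), $\tilde\beta_m=\mathcal{B}_m^{(1)}(t)|_{t=\theta}$, $\hat\beta_m=\partial_\theta(\mathcal{B}_m(t))|_{t=\theta}$ where $\partial_\theta$ is the first (hyper)derivative in $\theta$ with $t$ held fixed; all are $0$ for $m<0$. Define $\mathbb{F}_q$-linear series: $\mathrm{Log}_{\phi,2}(z)=\sum_{m\ge0}\beta_m^2z^{q^m}$, $L_2(z)=\sum_{m\ge1}\beta_m\beta_{m-1}z^{q^m}$, $\hat L_1(z)=\sum_{m\ge1}2\beta_m\hat\beta_mz^{q^m}$, $\hat L_2(z)=\sum_{m\ge1}(\hat\beta_m\beta_{m-1}+\beta_m\hat\beta_{m-1})z^{q^m}$, $\widetilde L_1(z)=\frac{\kappa_2}{\theta-\theta^{(1)}}\sum_{m\ge1}\beta_m\tilde\beta_{m-1}z^{q^m}$,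 $\widetilde L_2(z)=\frac{\kappa_2}{\theta-\theta^{(1)}}\sum_{m\ge1}\beta_{m-1}\tilde\beta_{m-1}z^{q^m}$, and $\mathrm{Log}_{\mathrm{Alt}^2\phi}(z)=z+\frac{\kappa_2}{\theta-\theta^{(1)}}\sum_{m\ge1}(\beta_m\tilde\beta_{m-2}-\beta_{m-1}\tilde\beta_{m-1})z^{q^m}$. $\theta^{(1)}=\theta^q$; $\partial_\theta(\kappa_1)$ is the derivative of the polynomial $\kappa_1$. Values such as $\hat L_1(\theta)$ are the series evaluated at the given element of $A$. *)

theory Defs
  imports "HOL-Analysis.Analysis" "HOL-Computational_Algebra.Computational_Algebra"
begin

text \<open>
  The finite field with \<open>q\<close> elements is a type \<open>'a :: finite_field\<close> with \<open>q = CARD('a)\<close>;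
  \<open>A\<close>, \<open>K\<close>, \<open>K(t)\<close> and \<open>K\<^sub>\<infinity>\<close> are the types \<open>'a poly\<close>, \<open>'a poly fract\<close>,
  \<open>'a poly fract poly fract\<close> and \<open>'a fls\<close>. The generator \<open>fls_X\<close> of \<open>'a fls\<close> plays the role
  of \<open>\<theta>\<^sup>-\<^sup>1\<close>, so that \<open>\<theta>\<close> is \<open>fls_X_inv\<close>, the coefficient \<open>c $$ j\<close> is that of \<open>\<theta>\<^sup>-\<^sup>j\<close>, and the
  library metric on \<open>'a fls\<close> is the \<open>\<theta>\<^sup>-\<^sup>1\<close>-adic one.
\<close>

type_synonym 'a K = "'a poly fract"
type_synonym 'a Kt = "'a poly fract poly fract"

notation fls_nth (infixl \<open>$$\<close> 75)


section \<open>Fraction fields\<close>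

text \<open>
  Extensions to the fraction field of a multiplicative map, of a derivation (quotient rule), and
  evaluation of a rational function at a point where it is regular. The lemmas below show that
  the descriptions are independent of the chosen representative.
\<close>

definition fract_map :: "('b::idom \<Rightarrow> 'c::field) \<Rightarrow> 'b fract \<Rightarrow> 'c" where
  "fract_map f x = (THE y. \<exists>a b. b \<noteq> 0 \<and> x = Fract a b \<and> y = f a / f b)"

definition fract_deriv :: "('b::idom \<Rightarrow> 'b) \<Rightarrow> 'b fract \<Rightarrow> 'b fract" where
  "fract_deriv D x = (THE y. \<exists>a b. b \<noteq> 0 \<and> x = Fract a b \<and> y = Fract (D a * b - a * D b) (b\<^sup>2))"

definition fract_eval :: "'b::field poly fract \<Rightarrow> 'b \<Rightarrow> 'b" where
  "fract_eval g c = (THE y. \<exists>P Q. poly Q c \<noteq> 0 \<and> g = Fract P Q \<and> y = poly P c / poly Q c)"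

lemma fract_map_Fract:
  assumes "b \<noteq> 0" and mult: "\<And>x y. f (x * y) = f x * f y" and "\<And>x. x \<noteq> 0 \<Longrightarrow> f x \<noteq> 0"
  shows "fract_map f (Fract a b) = f a / f b"
  unfolding fract_map_def
proof (rule the_equality)
  show "\<exists>a' b'. b' \<noteq> 0 \<and> Fract a b = Fract a' b' \<and> f a / f b = f a' / f b'"
    using assms(1) by blast
next
  fix y assume "\<exists>a' b'. b' \<noteq> 0 \<and> Fract a b = Fract a' b' \<and> y = f a' / f b'"
  then obtain a' b' where *: "b' \<noteq> 0" "Fract a b = Fract a' b'" "y = f a' / f b'" by blast
  then have "a * b' = a' * b" using assms(1) by (simp add: eq_fract)
  then have "f a * f b' = f a' * f b" by (metis mult)
  then show "y = f a / f b" using * assms(1,3) by (simp add: frac_eq_eq)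
qed

lemma fract_deriv_Fract:
  assumes "b \<noteq> 0" and mult: "\<And>x y. D (x * y) = D x * y + x * D y"
  shows "fract_deriv D (Fract a b) = Fract (D a * b - a * D b) (b\<^sup>2)"
  unfolding fract_deriv_def
proof (rule the_equality)
  show "\<exists>a' b'. b' \<noteq> 0 \<and> Fract a b = Fract a' b' \<and>
      Fract (D a * b - a * D b) (b\<^sup>2) = Fract (D a' * b' - a' * D b') (b'\<^sup>2)"
    using assms(1) by blast
next
  fix y assume "\<exists>a' b'. b' \<noteq> 0 \<and> Fract a b = Fract a' b' \<and>
      y = Fract (D a' * b' - a' * D b') (b'\<^sup>2)"
  then obtain a' b' where *: "b' \<noteq> 0" "Fract a b = Fract a' b'"
      "y = Fract (D a' * b' - a' * D b') (b'\<^sup>2)" by blast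
  then have e: "a * b' = a' * b" using assms(1) by (simp add: eq_fract)
  then have d: "D a * b' + a * D b' = D a' * b + a' * D b" by (metis mult)
  have "(D a' * b' - a' * D b') * b\<^sup>2 = (D a * b - a * D b) * b'\<^sup>2"
    using d e by algebra
  then show "y = Fract (D a * b - a * D b) (b\<^sup>2)"
    using * assms(1) by (simp add: eq_fract)
qed

lemma fract_eval_Fract:
  assumes "poly Q c \<noteq> 0"
  shows "fract_eval (Fract P Q) c = poly P c / poly Q c"
  unfolding fract_eval_def
proof (rule the_equality)
  show "\<exists>P' Q'. poly Q' c \<noteq> 0 \<and> Fract P Q = Fract P' Q' \<and>
      poly P c / poly Q c = poly P' c / poly Q' c"
    using assms by blast
next
  fix y assume "\<exists>P' Q'. poly Q' c \<noteq> 0 \<and> Fract P Q = Fract P' Q' \<and> y = poly P' c / poly Q' c"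
  then obtain P' Q' where *: "poly Q' c \<noteq> 0" "Fract P Q = Fract P' Q'"
      "y = poly P' c / poly Q' c" by blast
  then have "P * Q' = P' * Q" using assms by (subst (asm) eq_fract) auto
  then have "poly P c * poly Q' c = poly P' c * poly Q c" by (metis poly_mult)
  then show "y = poly P c / poly Q c" using * assms by (simp add: frac_eq_eq)
qed


section \<open>Embeddings\<close>

definition theta_A :: "'a::finite_field poly" where "theta_A = [:0, 1:]"

definition theta_K :: "'a::finite_field K" where "theta_K = to_fract theta_A"

definition A_inf :: "'a::finite_field poly \<Rightarrow> 'a fls" where
  "A_inf a = poly (map_poly fls_const a) fls_X_inv"

definition K_inf :: "'a::finite_field K \<Rightarrow> 'a fls" where
  "K_inf = fract_map A_inf"

definition const_K :: "'a::finite_field \<Rightarrow> 'a K" where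
  "const_K c = to_fract [:c:]"

definition K_to_Kt :: "'a::finite_field K \<Rightarrow> 'a Kt" where
  "K_to_Kt c = to_fract [:c:]"

definition t_Kt :: "'a::finite_field Kt" where
  "t_Kt = to_fract [:0, 1:]"


section \<open>Operations on \<open>K(t)\<close>\<close>

text \<open>Raising the coefficients in \<open>K\<close> to the \<open>q\<^sup>n\<close>-th power, with \<open>t\<close> fixed.\<close>

definition twist_Kt :: "nat \<Rightarrow> 'a::finite_field Kt \<Rightarrow> 'a Kt" where
  "twist_Kt n = fract_map (\<lambda>P. to_fract (map_poly (\<lambda>c. c ^ (CARD('a) ^ n)) P))"

text \<open>The first hyperderivative is the ordinary derivative; it acts on \<open>K[t]\<close> coefficientwise.\<close>

definition d_theta :: "'a::finite_field Kt \<Rightarrow> 'a Kt" where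
  "d_theta = fract_deriv (map_poly (fract_deriv pderiv))"


section \<open>Twisted power series and their exponentials and logarithms\<close>

text \<open>
  The function \<open>P\<close> stands for the series \<open>\<Sum>\<^sub>n P n \<tau>\<^sup>n\<close>. A \<open>t\<close>-module \<open>E\<close> is given by the twisted
  polynomial \<open>E\<^sub>t\<close>, and \<open>E 0\<close> is \<open>\<partial>E\<^sub>t\<close>.
\<close>

type_synonym ('a, 'd) tws = "nat \<Rightarrow> 'a fls ^ 'd ^ 'd"

definition frob :: "nat \<Rightarrow> 'a::finite_field fls \<Rightarrow> 'a fls" where
  "frob n x = x ^ (CARD('a) ^ n)"

definition frob_vec :: "nat \<Rightarrow> 'a::finite_field fls ^ 'd \<Rightarrow> 'a fls ^ 'd" where
  "frob_vec n v = (\<chi> i. frob n (v $ i))"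

definition frob_mat :: "nat \<Rightarrow> 'a::finite_field fls ^ 'd ^ 'd \<Rightarrow> 'a fls ^ 'd ^ 'd" where
  "frob_mat n M = (\<chi> i j. frob n (M $ i $ j))"

definition tws_mult :: "('a::finite_field, 'd::finite) tws \<Rightarrow> ('a, 'd) tws \<Rightarrow> ('a, 'd) tws" where
  "tws_mult P Q = (\<lambda>n. \<Sum>i\<le>n. P i ** frob_mat i (Q (n - i)))"

definition tws_const :: "'a::finite_field fls ^ 'd ^ 'd \<Rightarrow> ('a, 'd) tws" where
  "tws_const M = (\<lambda>n. if n = 0 then M else 0)"

definition tws_eval :: "('a::finite_field, 'd::finite) tws \<Rightarrow> 'a fls ^ 'd \<Rightarrow> 'a fls ^ 'd" where
  "tws_eval P x = (\<Sum>n. P n *v frob_vec n x)"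

text \<open>The conditions are \<open>C\<^sub>0 = I\<close> and \<open>Exp\<^sub>E \<partial>E\<^sub>t = E\<^sub>t Exp\<^sub>E\<close>; they determine all the \<open>C\<^sub>i\<close>.\<close>

definition Exp_tws :: "('a::finite_field, 'd::finite) tws \<Rightarrow> ('a, 'd) tws" where
  "Exp_tws E = (THE C. C 0 = mat 1 \<and> tws_mult C (tws_const (E 0)) = tws_mult E C)"

definition Log_tws :: "('a::finite_field, 'd::finite) tws \<Rightarrow> ('a, 'd) tws" where
  "Log_tws E = (THE P. tws_mult P (Exp_tws E) = tws_const (mat 1) \<and>
                       tws_mult (Exp_tws E) P = tws_const (mat 1))"


section \<open>Regulators\<close>

text \<open>Matrix powers are iterated maps, since \<open>^\<close> on matrices is entrywise in the library.\<close>

definition matrix_powi_vec ::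
    "'a::finite_field fls ^ 'd ^ 'd \<Rightarrow> int \<Rightarrow> 'a fls ^ 'd \<Rightarrow> 'a fls ^ 'd::finite" where
  "matrix_powi_vec M j v =
     (if j \<ge> 0 then ((*v) M ^^ nat j) v else ((*v) (matrix_inv M) ^^ nat (- j)) v)"

text \<open>
  The action of \<open>K\<^sub>\<infinity>\<close> on \<open>K\<^sub>\<infinity>\<^sup>d\<close> by \<open>\<Sum> c\<^sub>j t\<^sup>-\<^sup>j \<mapsto> \<Sum> c\<^sub>j (\<partial>E\<^sub>t)\<^sup>-\<^sup>j\<close>, where \<open>t\<close> is identified with \<open>\<theta>\<close>.
  Its restriction to \<open>A\<close> is the module structure used for both lattices.
\<close>

definition K_inf_scale ::
    "('a::finite_field, 'd::finite) tws \<Rightarrow> 'a fls \<Rightarrow> 'a fls ^ 'd \<Rightarrow> 'a fls ^ 'd" where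
  "K_inf_scale E c v =
     (\<Sum>n::nat. let j = fls_subdegree c + int n
                in fls_const (c $$ j) *s matrix_powi_vec (E 0) (- j) v)"

definition A_scale ::
    "('a::finite_field, 'd::finite) tws \<Rightarrow> 'a poly \<Rightarrow> 'a fls ^ 'd \<Rightarrow> 'a fls ^ 'd" where
  "A_scale E a = K_inf_scale E (A_inf a)"

definition is_A_basis ::
    "('a::finite_field, 'd::finite) tws \<Rightarrow> ('a fls ^ 'd) set \<Rightarrow> ('d \<Rightarrow> 'a fls ^ 'd) \<Rightarrow> bool" where
  "is_A_basis E L b \<longleftrightarrow>
     inj b \<and> \<not> module.dependent (A_scale E) (range b) \<and> module.span (A_scale E) (range b) = L"

definition integral_lattice :: "('a::finite_field fls ^ 'd) set" where
  "integral_lattice = {v. \<forall>i. v $ i \<in> range A_inf}"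

definition unit_lattice :: "('a::finite_field, 'd::finite) tws \<Rightarrow> ('a fls ^ 'd) set" where
  "unit_lattice E = {x. tws_eval (Exp_tws E) x \<in> integral_lattice}"

text \<open>The leading coefficient with respect to \<open>\<theta>\<^sup>-\<^sup>1\<close> is 1; this fails for 0.\<close>

definition monic_inf :: "'a::finite_field fls \<Rightarrow> bool" where
  "monic_inf r \<longleftrightarrow> r $$ fls_subdegree r = 1"

text \<open>
  \<open>u\<close> and \<open>w\<close> are \<open>A\<close>-bases of the two lattices. Other bases change \<open>det V\<close> by a factor in
  \<open>GF(q)\<^sup>\<times>\<close>, so the normalised determinant is unique.
\<close>

definition Reg :: "('a::finite_field, 'd::finite) tws \<Rightarrow> 'a fls" where
  "Reg E = (THE r. \<exists>u w V \<gamma>.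
      is_A_basis E (unit_lattice E) u \<and> is_A_basis E integral_lattice w \<and>
      (\<forall>i. u i = (\<Sum>j\<in>UNIV. K_inf_scale E (V $ i $ j) (w j))) \<and>
      \<gamma> \<noteq> 0 \<and> r = fls_const \<gamma> * det (V :: 'a fls ^ 'd ^ 'd) \<and> monic_inf r)"


section \<open>The t-modules attached to \<open>\<phi>\<^sub>t = \<theta> + \<kappa>\<^sub>1\<tau> + \<kappa>\<^sub>2\<tau>\<^sup>2\<close>\<close>

lemma vector_4:
  "(vector [w, x, y, z] :: ('b::zero) ^ 4) $ 1 = w"
  "(vector [w, x, y, z] :: ('b::zero) ^ 4) $ 2 = x"
  "(vector [w, x, y, z] :: ('b::zero) ^ 4) $ 3 = y"
  "(vector [w, x, y, z] :: ('b::zero) ^ 4) $ 4 = z"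
  unfolding vector_def by simp_all

definition phi_tensor2 :: "'a::finite_field poly \<Rightarrow> 'a \<Rightarrow> ('a, 4) tws" where
  "phi_tensor2 \<kappa>1 \<kappa>2 = (let \<theta> = fls_X_inv; k1 = A_inf \<kappa>1; k2 = fls_const \<kappa>2 in
     (\<lambda>n. if n = 0 then
            vector [vector [\<theta>, 0, k1, k2],
                    vector [0, \<theta>, 0, 0],
                    vector [0, 0, \<theta>, 0],
                    vector [0, 0, 0, \<theta>]]
          else if n = 1 then
            vector [vector [0, 0, 0, 0],
                    vector [k1, 0, k2, 0],
                    vector [k1, k2, 0, 0],
                    vector [0, 0, k1, 0]]
          else if n = 2 then
            vector [vector [0, 0, 0, 0],
                    vector [0, 0, 0, 0],
                    vector [0, 0, 0, 0],
                    vector [k2, 0, 0, 0]]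
          else 0))"

definition Sym2 :: "'a::finite_field poly \<Rightarrow> 'a \<Rightarrow> ('a, 3) tws" where
  "Sym2 \<kappa>1 \<kappa>2 = (let \<theta> = fls_X_inv; k1 = A_inf \<kappa>1; k2 = fls_const \<kappa>2 in
     (\<lambda>n. if n = 0 then
            vector [vector [\<theta>, k1, k2],
                    vector [0, \<theta>, 0],
                    vector [0, 0, \<theta>]]
          else if n = 1 then
            vector [vector [0, 0, 0],
                    vector [k1, k2, 0],
                    vector [0, k1, 0]]
          else if n = 2 then
            vector [vector [0, 0, 0],
                    vector [0, 0, 0],
                    vector [k2, 0, 0]]
          else 0))"

text \<open>\<open>Alt\<^sup>2\<phi>\<close> does not involve \<open>\<kappa>\<^sub>1\<close>.\<close>

definition Alt2 :: "'a::finite_field \<Rightarrow> ('a, 1) tws" where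
  "Alt2 \<kappa>2 = (\<lambda>n. if n = 0 then vector [vector [fls_X_inv]]
                   else if n = 1 then vector [vector [- fls_const \<kappa>2]]
                   else 0)"

text \<open>
  This is the logarithm of the \<open>t\<close>-module, i.e. the inverse of its exponential; its expansion
  in terms of the \<open>\<beta>\<close>-series is not built into the definition.
\<close>

definition Log_Alt2 :: "'a::finite_field \<Rightarrow> 'a fls \<Rightarrow> 'a fls" where
  "Log_Alt2 \<kappa>2 z = tws_eval (Log_tws (Alt2 \<kappa>2)) (vector [z]) $ 1"


section \<open>The series\<close>

function B_ser :: "'a::finite_field poly \<Rightarrow> 'a \<Rightarrow> int \<Rightarrow> 'a Kt" where
  "B_ser \<kappa>1 \<kappa>2 m =
     (if m < 0 then 0
      else if m = 0 then 1
      else (K_to_Kt (to_fract \<kappa>1 ^ (CARD('a) ^ nat (m - 1))) * B_ser \<kappa>1 \<kappa>2 (m - 1)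
              + K_to_Kt (const_K \<kappa>2) * B_ser \<kappa>1 \<kappa>2 (m - 2))
           / (t_Kt - K_to_Kt (theta_K ^ (CARD('a) ^ nat m))))"
  by pat_completeness auto
termination
  by (relation "Wellfounded.measure (\<lambda>(_, _, m). nat (m + 1))") auto

declare B_ser.simps [simp del]

definition beta :: "'a::finite_field poly \<Rightarrow> 'a \<Rightarrow> int \<Rightarrow> 'a K" where
  "beta \<kappa>1 \<kappa>2 m = fract_eval (B_ser \<kappa>1 \<kappa>2 m) theta_K"

definition beta_tilde :: "'a::finite_field poly \<Rightarrow> 'a \<Rightarrow> int \<Rightarrow> 'a K" where
  "beta_tilde \<kappa>1 \<kappa>2 m = fract_eval (twist_Kt 1 (B_ser \<kappa>1 \<kappa>2 m)) theta_K"

definition beta_hat :: "'a::finite_field poly \<Rightarrow> 'a \<Rightarrow> int \<Rightarrow> 'a K" where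
  "beta_hat \<kappa>1 \<kappa>2 m = fract_eval (d_theta (B_ser \<kappa>1 \<kappa>2 m)) theta_K"

text \<open>\<open>q_series_from k c z\<close> is \<open>\<Sum>\<^sub>m c m * z\<close> to the power \<open>q\<^sup>m\<close>, summed over \<open>m \<ge> k\<close>.\<close>

definition q_series_from :: "nat \<Rightarrow> (int \<Rightarrow> 'a::finite_field K) \<Rightarrow> 'a fls \<Rightarrow> 'a fls" where
  "q_series_from k c z = (\<Sum>n. let m = n + k in K_inf (c (int m)) * z ^ (CARD('a) ^ m))"

definition prefactor :: "'a::finite_field \<Rightarrow> 'a K" where
  "prefactor \<kappa>2 = const_K \<kappa>2 / (theta_K - theta_K ^ CARD('a))"

definition Log_phi2 :: "'a::finite_field poly \<Rightarrow> 'a \<Rightarrow> 'a fls \<Rightarrow> 'a fls" where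
  "Log_phi2 \<kappa>1 \<kappa>2 = q_series_from 0 (\<lambda>m. (beta \<kappa>1 \<kappa>2 m)\<^sup>2)"

definition L2 :: "'a::finite_field poly \<Rightarrow> 'a \<Rightarrow> 'a fls \<Rightarrow> 'a fls" where
  "L2 \<kappa>1 \<kappa>2 = q_series_from 1 (\<lambda>m. beta \<kappa>1 \<kappa>2 m * beta \<kappa>1 \<kappa>2 (m - 1))"

definition L1_hat :: "'a::finite_field poly \<Rightarrow> 'a \<Rightarrow> 'a fls \<Rightarrow> 'a fls" where
  "L1_hat \<kappa>1 \<kappa>2 = q_series_from 1 (\<lambda>m. 2 * beta \<kappa>1 \<kappa>2 m * beta_hat \<kappa>1 \<kappa>2 m)"

definition L2_hat :: "'a::finite_field poly \<Rightarrow> 'a \<Rightarrow> 'a fls \<Rightarrow> 'a fls" where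
  "L2_hat \<kappa>1 \<kappa>2 = q_series_from 1
     (\<lambda>m. beta_hat \<kappa>1 \<kappa>2 m * beta \<kappa>1 \<kappa>2 (m - 1) + beta \<kappa>1 \<kappa>2 m * beta_hat \<kappa>1 \<kappa>2 (m - 1))"

definition L1_tilde :: "'a::finite_field poly \<Rightarrow> 'a \<Rightarrow> 'a fls \<Rightarrow> 'a fls" where
  "L1_tilde \<kappa>1 \<kappa>2 z = K_inf (prefactor \<kappa>2) *
     q_series_from 1 (\<lambda>m. beta \<kappa>1 \<kappa>2 m * beta_tilde \<kappa>1 \<kappa>2 (m - 1)) z"

definition L2_tilde :: "'a::finite_field poly \<Rightarrow> 'a \<Rightarrow> 'a fls \<Rightarrow> 'a fls" where
  "L2_tilde \<kappa>1 \<kappa>2 z = K_inf (prefactor \<kappa>2) *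
     q_series_from 1 (\<lambda>m. beta \<kappa>1 \<kappa>2 (m - 1) * beta_tilde \<kappa>1 \<kappa>2 (m - 1)) z"

definition M_mat :: "'a::finite_field poly \<Rightarrow> 'a \<Rightarrow> 'a fls ^ 3 ^ 3" where
  "M_mat \<kappa>1 \<kappa>2 =
    (let \<theta> = fls_X_inv; k1 = A_inf \<kappa>1; k2 = fls_const \<kappa>2 in
     vector [
       vector [1 + L1_hat \<kappa>1 \<kappa>2 \<theta>,
               - L1_hat \<kappa>1 \<kappa>2 k1 - 2 * k2 * L2_hat \<kappa>1 \<kappa>2 1 - A_inf (pderiv \<kappa>1),
               - k2 * L1_hat \<kappa>1 \<kappa>2 1],
       vector [- inverse k2 * L1_tilde \<kappa>1 \<kappa>2 \<theta>,
               Log_Alt2 \<kappa>2 1 + inverse k2 * L1_tilde \<kappa>1 \<kappa>2 k1 + 2 * L2_tilde \<kappa>1 \<kappa>2 1,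
               L1_tilde \<kappa>1 \<kappa>2 1],
       vector [- inverse k2 * Log_phi2 \<kappa>1 \<kappa>2 \<theta>,
               inverse k2 * Log_phi2 \<kappa>1 \<kappa>2 k1 + 2 * L2 \<kappa>1 \<kappa>2 1,
               Log_phi2 \<kappa>1 \<kappa>2 1]])"

end

(*
  If t acts on the tangent space through theta + N with N nilpotent, then a in K_inf acts by
  a.v = a v + a' N v (the prime is d/dtheta), and v - N v' are the coordinates of v with respect to
  the unit vectors e_i. Suppose that the n-th coefficient of Log has degree at most -n. Then the
  coordinate matrix V of the vectors Log(e_i) is 1 modulo negative degree, so every vector is the sum
  of an element of the A-lattice spanned by the Log(e_i) and of a vector of negative degree. On the
  latter Exp preserves the degree and cannot take nonzero integral values. Hence the Log(e_i) are a
  basis of the preimage of A^d under Exp, and the regulator is det V, which is already monic.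

  For Sym^2 the coefficients of Log are bilinear in beta_m and beta-tilde_(m-1), two solutions of one
  recursion of order two, whose degrees are explicit when deg kappa_1 <= 1; row and column operations
  carry V to the matrix M. For Alt^2 the coefficients are the Wronskians of these two solutions. The
  tensor square is isomorphic to the sum of Sym^2 and Alt^2 over A because 2 is invertible.
*)

theory Submission
  imports Defs
begin

text \<open>Closed formulas exist for Log only. So Exp is taken as the formal inverse of Log, and
  the bound of degree at most -n is chosen because inversion preserves it: valuations add in a
  product, and the Frobenius does not lower a nonnegative one. This gives convergence of Exp only on
  vectors of degree at most 0. Convergence at larger arguments comes out of the decomposition into a
  lattice vector and a small vector; until then, lying in the preimage means that the series
  converges to an integral value.

  For Sym^2 the rows of Log obey one system of recursions, but the nilpotent part couples the first
  row to the other two. Differentiating the coupling row with respect to theta produces just this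
  coupling, since theta - theta^(n) has derivative 1. As q-th powers are constants for this
  derivation, beta-hat is a multiple of beta-tilde, so the first row of M becomes a constant vector
  plus a multiple of the second.

  The worst degree bound that occurs is 2 - q^n, which is at most -n for all n > 0 only if q >= 3.
  Thus p = 2 is excluded here as well as in the splitting of the tensor square.\<close>

no_notation fps_nth (infixl \<open>$\<close> 75)

section \<open>Frobenius powers\<close>

text \<open>The polynomial (1 + X)^q - 1 - X^q has degree below q and, because x^q = x, vanishes at
  all q elements of the field; so it is 0.\<close>

lemma finite_field_card_choose_eq_0:
  assumes "0 < k" "k < CARD('a::finite_field)"
  shows "of_nat (CARD('a) choose k) = (0::'a)"
proof -
  let ?q = "CARD('a)"
  have q: "?q > 0" by simp
  define P :: "'a poly" where "P = [:1, 1:] ^ ?q - 1 - monom 1 ?q"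
  have co: "coeff ([:1, 1::'a:] ^ ?q) i = of_nat (?q choose i)" if "i \<le> ?q" for i
    using that by (subst coeff_linear_poly_power) auto
  have "degree P < ?q"
  proof (rule degree_lessI)
    show "P \<noteq> 0 \<or> ?q > 0" using q by simp
    show "\<forall>j\<ge>?q. coeff P j = 0"
    proof (intro allI impI)
      fix j assume "j \<ge> ?q"
      moreover have "degree ([:1, 1::'a:] ^ ?q) = ?q" by (simp add: degree_linear_power)
      ultimately show "coeff P j = 0"
        using co[of j] q unfolding P_def
        by (cases "j = ?q") (auto simp: coeff_eq_0)
    qed
  qed
  moreover have "card {x. poly P x = 0} \<le> degree P" if "P \<noteq> 0"
    using card_poly_roots_bound that by blast
  moreover have "{x. poly P x = 0} = UNIV"
    by (auto simp: P_def poly_monom finite_field_power_card_eq_same)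
  ultimately have "P = 0" by force
  then have "coeff P k = 0" by simp
  then show ?thesis using assms co[of k] by (simp add: P_def)
qed

lemma finite_field_of_nat_card: "of_nat CARD('a::finite_field) = (0::'a)"
proof -
  have "card {0, 1::'a} \<le> CARD('a)" by (rule card_mono) auto
  then show ?thesis using finite_field_card_choose_eq_0[of 1, where 'a='a] by simp
qed

lemma card_gt_1: "CARD('a::finite_field) > 1"
proof -
  have "card {0, 1::'a} \<le> CARD('a)" by (rule card_mono) auto
  then show ?thesis by simp
qed

text \<open>That p divides the inner binomial coefficients depends on the characteristic alone, so
  the identity passes from the finite field to \<open>'a fls\<close> and to the fraction
  field.\<close>

lemma power_card_add:
  fixes x y :: "'b::comm_ring_1"
  assumes "CHAR('b) = CHAR('a::finite_field)"
  shows "(x + y) ^ CARD('a) = x ^ CARD('a) + y ^ CARD('a)"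
proof -
  let ?q = "CARD('a)"
  have "(x + y) ^ ?q = (\<Sum>k\<le>?q. of_nat (?q choose k) * x ^ k * y ^ (?q - k))"
    by (rule binomial_ring)
  also have "\<dots> = (\<Sum>k\<in>{0,?q}. of_nat (?q choose k) * x ^ k * y ^ (?q - k))"
  proof (intro sum.mono_neutral_right ballI)
    fix k assume "k \<in> {..?q} - {0, ?q}"
    then have "of_nat (?q choose k) = (0::'a)"
      by (intro finite_field_card_choose_eq_0) auto
    then have "of_nat (?q choose k) = (0::'b)"
      by (simp add: of_nat_eq_0_iff_char_dvd assms)
    then show "of_nat (?q choose k) * x ^ k * y ^ (?q - k) = 0" by simp
  qed auto
  finally show ?thesis by (simp add: add.commute)
qed

lemma power_card_power_add:
  fixes x y :: "'b::comm_ring_1"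
  assumes "CHAR('b) = CHAR('a::finite_field)"
  shows "(x + y) ^ (CARD('a) ^ n) = x ^ (CARD('a) ^ n) + y ^ (CARD('a) ^ n)"
proof (induction n)
  case (Suc n)
  then show ?case
    by (simp add: power_mult mult.commute[of "CARD('a)"] power_card_add[OF assms])
qed simp

lemma frob_add: "frob n (x + y) = frob n x + frob n y"
  by (simp add: frob_def power_card_power_add)

lemma frob_0 [simp]: "frob n 0 = 0"
  by (simp add: frob_def)

lemma frob_1 [simp]: "frob n 1 = 1"
  by (simp add: frob_def)

lemma frob_zero_left [simp]: "frob 0 x = x"
  by (simp add: frob_def)

lemma frob_mult: "frob n (x * y) = frob n x * frob n y"
  by (simp add: frob_def power_mult_distrib)

lemma frob_minus: "frob n (- x) = - frob n x"
  using frob_add[of n x "- x"] by (simp add: eq_neg_iff_add_eq_0 add.commute)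

lemma frob_diff: "frob n (x - y) = frob n x - frob n y"
  using frob_add[of n x "- y"] by (simp add: frob_minus)

lemma frob_sum: "frob n (sum f S) = (\<Sum>i\<in>S. frob n (f i))"
  by (induction S rule: infinite_finite_induct) (auto simp: frob_add)

lemma frob_frob: "frob m (frob n x) = frob (m + n) x"
  by (simp add: frob_def power_add power_mult mult.commute flip: power_mult)

lemma frob_fls_const [simp]: "frob n (fls_const c) = fls_const c"
  by (simp add: frob_def finite_field_power_card_power_eq_same flip: fls_const_power)

section \<open>Valuation and convergence\<close>

text \<open>Stated through coefficients so that 0 satisfies every bound, although
  \<open>fls_subdegree 0\<close> is 0. In terms of theta it bounds the degree by -k.\<close>

definition val_ge :: "int \<Rightarrow> 'a::zero fls \<Rightarrow> bool" where
  "val_ge k x \<longleftrightarrow> (\<forall>j<k. x $$ j = 0)"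

lemma val_ge_iff: "val_ge k x \<longleftrightarrow> x = 0 \<or> k \<le> fls_subdegree x"
  unfolding val_ge_def
  by (metis fls_eq0_below_subdegree fls_subdegree_geI fls_zero_nth less_le_trans)

lemma val_ge_0 [simp]: "val_ge k 0"
  by (simp add: val_ge_def)

lemma val_ge_mono: "val_ge k x \<Longrightarrow> l \<le> k \<Longrightarrow> val_ge l x"
  by (simp add: val_ge_def)

lemma val_ge_add: "val_ge k x \<Longrightarrow> val_ge k y \<Longrightarrow> val_ge k (x + y)" for x :: "'a::monoid_add fls"
  by (simp add: val_ge_def)

lemma val_ge_uminus [simp]: "val_ge k (- x) \<longleftrightarrow> val_ge k x" for x :: "'a::group_add fls"
  by (simp add: val_ge_def)

lemma val_ge_diff: "val_ge k x \<Longrightarrow> val_ge k y \<Longrightarrow> val_ge k (x - y)" for x :: "'a::group_add fls"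
  by (simp add: val_ge_def)

lemma val_ge_sum: "(\<And>i. i \<in> S \<Longrightarrow> val_ge k (f i)) \<Longrightarrow> val_ge k (sum f S)"
  for f :: "'b \<Rightarrow> 'a::comm_monoid_add fls"
  by (simp add: val_ge_def fls_nth_sum)

lemma val_ge_mult: "val_ge k x \<Longrightarrow> val_ge l y \<Longrightarrow> val_ge (k + l) (x * y)" for x :: "'a::field fls"
  by (cases "x = 0 \<or> y = 0") (auto simp: val_ge_iff)

lemma val_ge_const [simp]: "val_ge 0 (fls_const c)"
  by (simp add: val_ge_iff)

lemma val_ge_numeral [simp]: "val_ge 0 (numeral c :: 'a::semiring_1 fls)"
  by (simp add: val_ge_def)

lemma val_ge_1 [simp]: "val_ge 0 (1 :: 'a::zero_neq_one fls)"
  by (simp add: val_ge_def)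

lemma val_ge_of_int [simp]: "val_ge 0 (of_int c :: 'a::ring_1 fls)"
  by (simp add: val_ge_def fls_of_int_nth)

lemma val_ge_X_inv [simp]: "val_ge (-1) (fls_X_inv :: 'a::zero_neq_one fls)"
  by (auto simp: val_ge_def)

lemma val_ge_power: "val_ge k x \<Longrightarrow> val_ge (int n * k) (x ^ n)" for x :: "'a::field fls"
proof (induction n)
  case (Suc n)
  then show ?case using val_ge_mult[of k x "int n * k" "x ^ n"] by (simp add: algebra_simps)
qed simp

lemma val_ge_frob: "val_ge k x \<Longrightarrow> val_ge (int CARD('a) ^ n * k) (frob n (x :: 'a::finite_field fls))"
  using val_ge_power[of k x "CARD('a) ^ n"] by (simp add: frob_def)

lemma card_power_ge_1: "(1::int) \<le> int CARD('a::finite_field) ^ n"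
  using card_gt_1[where 'a='a] by (simp add: one_le_power)

lemma val_ge_frob': "val_ge k x \<Longrightarrow> 0 \<le> k \<Longrightarrow> val_ge k (frob n (x :: 'a::finite_field fls))"
  using mult_right_mono[OF card_power_ge_1[where 'a='a, of n], of k]
  by (intro val_ge_mono[OF val_ge_frob]) auto

lemma val_ge_all_imp_0: "(\<And>k. val_ge k x) \<Longrightarrow> x = 0"
  by (intro fls_eqI) (auto simp: val_ge_def intro: zless_add1_eq[THEN iffD2])

lemma dist_fls_less_iff: "dist x y < 2 powi (- k) \<longleftrightarrow> val_ge (k + 1) (x - y)"
proof (cases "x = y")
  case False
  then have "dist x y = 2 powi (- fls_subdegree (x - y))"
    by (auto simp: dist_fls_def power_int_def power_one_over inverse_eq_divide)
  moreover have "(2::real) powi a < 2 powi b \<longleftrightarrow> a < b" for a b :: int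
    using power_int_strict_increasing[of a b "2::real"] power_int_increasing[of b a "2::real"]
    by force
  ultimately show ?thesis using False by (auto simp: val_ge_iff)
qed auto

lemma tendsto_fls_iff:
  fixes f :: "'b \<Rightarrow> 'a::group_add fls"
  shows "(f \<longlongrightarrow> L) F \<longleftrightarrow> (\<forall>k. eventually (\<lambda>n. val_ge k (f n - L)) F)"
proof
  assume L: "(f \<longlongrightarrow> L) F"
  show "\<forall>k. eventually (\<lambda>n. val_ge k (f n - L)) F"
  proof
    fix k :: int
    have "eventually (\<lambda>n. dist (f n) L < 2 powi (- (k - 1))) F"
      using L by (intro tendstoD) auto
    then show "eventually (\<lambda>n. val_ge k (f n - L)) F"
      unfolding dist_fls_less_iff by simp
  qed
next
  assume R: "\<forall>k. eventually (\<lambda>n. val_ge k (f n - L)) F"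
  show "(f \<longlongrightarrow> L) F"
  proof (rule tendstoI)
    fix e :: real assume "e > 0"
    then obtain n where n: "(1 / 2) ^ n < e" using real_arch_pow_inv[of e "1/2"] by auto
    have "eventually (\<lambda>i. dist (f i) L < 2 powi (- int n)) F"
      unfolding dist_fls_less_iff using R by blast
    then show "eventually (\<lambda>i. dist (f i) L < e) F"
      by eventually_elim
        (use n in \<open>simp add: power_int_minus power_one_over inverse_eq_divide\<close>)
  qed
qed

definition vval_ge :: "int \<Rightarrow> 'a::zero fls ^ 'd \<Rightarrow> bool" where
  "vval_ge k v \<longleftrightarrow> (\<forall>i. val_ge k (v $ i))"

lemma tendsto_vec_fls_iff:
  fixes f :: "'b \<Rightarrow> 'a::group_add fls ^ 'd::finite"
  shows "(f \<longlongrightarrow> L) F \<longleftrightarrow> (\<forall>k. eventually (\<lambda>n. vval_ge k (f n - L)) F)"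
proof -
  have *: "(f \<longlongrightarrow> L) F \<longleftrightarrow> (\<forall>i. ((\<lambda>n. f n $ i) \<longlongrightarrow> L $ i) F)"
    by (auto intro: vec_tendstoI tendsto_vec_nth)
  have "(\<forall>i k. eventually (P i k) F) \<longleftrightarrow> (\<forall>k. eventually (\<lambda>n. \<forall>i. P i k n) F)"
    for P :: "'d \<Rightarrow> int \<Rightarrow> 'b \<Rightarrow> bool"
  proof (intro iffI allI)
    fix i k assume "\<forall>k. eventually (\<lambda>n. \<forall>i. P i k n) F"
    then have "eventually (\<lambda>n. \<forall>i. P i k n) F" by blast
    then show "eventually (P i k) F" by (rule eventually_mono) blast
  qed (simp add: eventually_all_finite)
  from this[of "\<lambda>i k n. val_ge k (f n $ i - L $ i)"] * show ?thesis
    by (simp add: tendsto_fls_iff vval_ge_def)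
qed

lemma vval_ge_0 [simp]: "vval_ge k 0"
  by (simp add: vval_ge_def)

lemma vval_ge_mono: "vval_ge k x \<Longrightarrow> l \<le> k \<Longrightarrow> vval_ge l x"
  by (auto simp: vval_ge_def intro: val_ge_mono)

lemma vval_ge_add: "vval_ge k x \<Longrightarrow> vval_ge k y \<Longrightarrow> vval_ge k (x + y)"
  for x :: "'a::monoid_add fls ^ 'd"
  by (simp add: vval_ge_def val_ge_add)

lemma vval_ge_diff: "vval_ge k x \<Longrightarrow> vval_ge k y \<Longrightarrow> vval_ge k (x - y)"
  for x :: "'a::group_add fls ^ 'd"
  by (simp add: vval_ge_def val_ge_diff)

lemma vval_ge_uminus [simp]: "vval_ge k (- x) \<longleftrightarrow> vval_ge k x"
  for x :: "'a::group_add fls ^ 'd"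
  by (simp add: vval_ge_def)

lemma vval_ge_sum: "(\<And>i. i \<in> S \<Longrightarrow> vval_ge k (f i)) \<Longrightarrow> vval_ge k (sum f S)"
  for f :: "'b \<Rightarrow> 'a::comm_monoid_add fls ^ 'd"
  by (simp add: vval_ge_def val_ge_sum)

lemma vval_ge_all_imp_0: "(\<And>k. vval_ge k x) \<Longrightarrow> x = 0"
  by (auto simp: vval_ge_def vec_eq_iff intro: val_ge_all_imp_0)

definition mval_ge :: "int \<Rightarrow> 'a::zero fls ^ 'd ^ 'e \<Rightarrow> bool" where
  "mval_ge k M \<longleftrightarrow> (\<forall>i j. val_ge k (M $ i $ j))"

lemma vval_ge_matrix_vector_mult:
  fixes M :: "'a::field fls ^ 'd ^ 'e"
  shows "mval_ge k M \<Longrightarrow> vval_ge l v \<Longrightarrow> vval_ge (k + l) (M *v v)"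
  by (auto simp: vval_ge_def mval_ge_def matrix_vector_mult_def intro!: val_ge_sum val_ge_mult)

lemma mval_ge_mult:
  fixes M :: "'a::field fls ^ 'd ^ 'e"
  shows "mval_ge k M \<Longrightarrow> mval_ge l N \<Longrightarrow> mval_ge (k + l) (M ** N)"
  by (auto simp: mval_ge_def matrix_matrix_mult_def intro!: val_ge_sum val_ge_mult)

lemma vval_ge_frob_vec:
  "vval_ge k x \<Longrightarrow> vval_ge (int CARD('a) ^ n * k) (frob_vec n (x :: 'a::finite_field fls ^ 'd))"
  by (auto simp: vval_ge_def frob_vec_def intro: val_ge_frob)

lemma vval_ge_frob_vec':
  "vval_ge k x \<Longrightarrow> 0 \<le> k \<Longrightarrow> vval_ge k (frob_vec n (x :: 'a::finite_field fls ^ 'd))"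
  by (auto simp: vval_ge_def frob_vec_def intro: val_ge_frob')

lemma mval_ge_frob_mat':
  "mval_ge k x \<Longrightarrow> 0 \<le> k \<Longrightarrow> mval_ge k (frob_mat n (x :: 'a::finite_field fls ^ 'd ^ 'd))"
  by (auto simp: mval_ge_def frob_mat_def intro: val_ge_frob')

lemma mval_ge_sum: "(\<And>i. i \<in> S \<Longrightarrow> mval_ge k (f i)) \<Longrightarrow> mval_ge k (sum f S)"
  for f :: "'b \<Rightarrow> 'a::comm_monoid_add fls ^ 'd ^ 'e"
  by (auto simp: mval_ge_def intro!: val_ge_sum)

lemma vval_ge_exists: "\<exists>k. vval_ge k (x :: 'a::zero fls ^ 'd::finite)"
proof
  show "vval_ge (Min (range (\<lambda>i. fls_subdegree (x $ i)))) x"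
    by (auto simp: vval_ge_def val_ge_iff)
qed

lemma mval_ge_exists: "\<exists>k. mval_ge k (x :: 'a::zero fls ^ 'd::finite ^ 'e::finite)"
proof -
  have "\<forall>i. \<exists>k. vval_ge k (x $ i)" by (simp add: vval_ge_exists)
  then obtain k where k: "\<And>i. vval_ge (k i) (x $ i)" by metis
  have "mval_ge (Min (range k)) x"
    unfolding mval_ge_def
  proof (intro allI)
    fix i j
    have "vval_ge (Min (range k)) (x $ i)" using vval_ge_mono[OF k[of i]] by simp
    then show "val_ge (Min (range k)) (x $ i $ j)" by (simp add: vval_ge_def)
  qed
  then show ?thesis ..
qed

subsection \<open>Series\<close>

text \<open>Completeness in its nonarchimedean form: terms tending to 0 suffice. The coefficient of
  the sum at index j is a finite sum over n < N (j + 1).\<close>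

lemma fls_summable:
  fixes f :: "nat \<Rightarrow> 'a::ab_group_add fls"
  assumes "\<And>k. \<exists>N. \<forall>n\<ge>N. val_ge k (f n)"
  shows "summable f"
proof -
  obtain N where N: "\<And>k n. n \<ge> N k \<Longrightarrow> val_ge k (f n)" using assms by metis
  define b where "b = Min (insert 0 ((\<lambda>n. fls_subdegree (f n)) ` {..<N 0}))"
  have b: "val_ge b (f n)" for n
  proof (cases "n < N 0")
    case True
    then have "b \<le> fls_subdegree (f n)" by (auto simp: b_def)
    then show ?thesis by (simp add: val_ge_iff)
  next
    case False
    have "b \<le> 0" by (simp add: b_def)
    then show ?thesis using N[of 0 n] False by (auto intro: val_ge_mono)
  qed
  define s where "s = Abs_fls (\<lambda>j. \<Sum>n<N (j + 1). f n $$ j)"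
  have s: "s $$ j = (\<Sum>n<N (j + 1). f n $$ j)" for j
    unfolding s_def using b
    by (subst nth_Abs_fls_lower_bound[of b]) (auto simp: val_ge_def)
  have eq: "(\<Sum>i<n. f i) $$ j = s $$ j" if "n \<ge> N (j + 1)" for n j
  proof -
    have "(\<Sum>i<n. f i $$ j) = (\<Sum>i<N (j + 1). f i $$ j)"
    proof (rule sum.mono_neutral_right)
      show "\<forall>i\<in>{..<n} - {..<N (j + 1)}. f i $$ j = 0"
        using N[of "j + 1"] by (auto simp: val_ge_def)
    qed (use that in auto)
    then show ?thesis by (simp add: s fls_nth_sum)
  qed
  have "f sums s"
    unfolding sums_def tendsto_fls_iff
  proof
    fix k :: int
    define m where "m = Max (N ` (\<lambda>j. j + 1) ` {min b 0..k} \<union> {0})"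
    show "eventually (\<lambda>n. val_ge k ((\<Sum>i<n. f i) - s)) sequentially"
      unfolding val_ge_def
    proof (rule eventually_sequentiallyI[of m], intro allI impI)
      fix n j assume n: "m \<le> n" and j: "j < k"
      show "((\<Sum>i<n. f i) - s) $$ j = 0"
      proof (cases "j < b")
        case True
        then show ?thesis using b by (simp add: fls_nth_sum s val_ge_def)
      next
        case False
        then have "N (j + 1) \<le> m" using j by (auto simp: m_def intro!: Max_ge)
        then show ?thesis using eq[of j n] n by simp
      qed
    qed
  qed
  then show ?thesis by (simp add: sums_iff)
qed

lemma sums_vec_iff: "f sums s \<longleftrightarrow> (\<forall>i. (\<lambda>n. f n $ i) sums (s $ i))"
  for f :: "nat \<Rightarrow> 'a::{comm_monoid_add,topological_space} ^ 'd"
  unfolding sums_def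
  by (auto intro!: vec_tendstoI dest: tendsto_vec_nth)

lemma sums_fls_iff:
  "f sums s \<longleftrightarrow> (\<forall>k. eventually (\<lambda>n. val_ge k ((\<Sum>i<n. f i) - s)) sequentially)"
  for s :: "'a::ab_group_add fls"
  by (simp add: sums_def tendsto_fls_iff)

lemma sums_vec_fls_iff:
  "f sums s \<longleftrightarrow> (\<forall>k. eventually (\<lambda>n. vval_ge k ((\<Sum>i<n. f i) - s)) sequentially)"
  for s :: "'a::ab_group_add fls ^ 'd"
  by (simp add: sums_def tendsto_vec_fls_iff)

lemma vec_fls_summable:
  fixes f :: "nat \<Rightarrow> 'a::ab_group_add fls ^ 'd"
  assumes "\<And>k. \<exists>N. \<forall>n\<ge>N. vval_ge k (f n)"
  shows "summable f"
proof -
  have "summable (\<lambda>n. f n $ i)" for i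
    using assms unfolding vval_ge_def by (intro fls_summable) meson
  then have "f sums (\<chi> i. \<Sum>n. f n $ i)"
    by (subst sums_vec_iff) (auto intro: summable_sums)
  then show ?thesis by (simp add: sums_iff)
qed

lemma vec_fls_summable_nat:
  fixes f :: "nat \<Rightarrow> 'a::ab_group_add fls ^ 'd"
  assumes "\<And>n. vval_ge (int n + c) (f n)"
  shows "summable f"
proof (rule vec_fls_summable)
  fix k
  show "\<exists>N. \<forall>n\<ge>N. vval_ge k (f n)"
    by (rule exI[of _ "nat (k - c)"]) (auto intro!: vval_ge_mono[OF assms])
qed

lemma fls_summable_nat:
  fixes f :: "nat \<Rightarrow> 'a::ab_group_add fls"
  assumes "\<And>n. val_ge (int n + c) (f n)"
  shows "summable f"
proof (rule fls_summable)
  fix k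
  show "\<exists>N. \<forall>n\<ge>N. val_ge k (f n)"
    by (rule exI[of _ "nat (k - c)"]) (auto intro!: val_ge_mono[OF assms])
qed

lemma fls_sums_nat:
  fixes f :: "nat \<Rightarrow> 'a::ab_group_add fls"
  shows "(\<And>n. val_ge (int n + c) (f n)) \<Longrightarrow> f sums suminf f"
  by (intro summable_sums fls_summable_nat)

lemma val_ge_sums:
  fixes f :: "nat \<Rightarrow> 'a::ab_group_add fls"
  assumes "f sums s" "\<And>n. val_ge k (f n)"
  shows "val_ge k s"
proof -
  have "\<forall>\<^sub>F n in sequentially. val_ge k ((\<Sum>i<n. f i) - s)"
    using assms(1) unfolding sums_fls_iff by blast
  then obtain n where n: "val_ge k ((\<Sum>i<n. f i) - s)"
    using eventually_happens sequentially_bot by blast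
  have "val_ge k (\<Sum>i<n. f i)" by (simp add: assms(2) val_ge_sum)
  from val_ge_diff[OF this n] show ?thesis by simp
qed

lemma vval_ge_sums:
  fixes f :: "nat \<Rightarrow> 'a::ab_group_add fls ^ 'd"
  assumes "f sums s" "\<And>n. vval_ge k (f n)"
  shows "vval_ge k s"
  using assms unfolding sums_vec_iff vval_ge_def by (auto intro: val_ge_sums)

lemma fls_sums_add: "f sums a \<Longrightarrow> g sums b \<Longrightarrow> (\<lambda>n. f n + g n) sums (a + b)"
  for a b :: "'a::ab_group_add fls"
  unfolding sums_fls_iff
proof
  fix k assume "\<forall>k. \<forall>\<^sub>F n in sequentially. val_ge k (sum f {..<n} - a)"
    "\<forall>k. \<forall>\<^sub>F n in sequentially. val_ge k (sum g {..<n} - b)"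
  then have "\<forall>\<^sub>F n in sequentially. val_ge k (sum f {..<n} - a)"
    "\<forall>\<^sub>F n in sequentially. val_ge k (sum g {..<n} - b)" by auto
  then show "\<forall>\<^sub>F n in sequentially. val_ge k ((\<Sum>n<n. f n + g n) - (a + b))"
  proof eventually_elim
    case (elim n)
    from val_ge_add[OF this] show ?case by (simp add: sum.distrib algebra_simps)
  qed
qed

lemma fls_sums_mult: "f sums a \<Longrightarrow> (\<lambda>n. c * f n) sums (c * a)" for a c :: "'a::field fls"
  unfolding sums_fls_iff
proof
  fix k assume *: "\<forall>k. \<forall>\<^sub>F n in sequentially. val_ge k (sum f {..<n} - a)"
  have "\<forall>\<^sub>F n in sequentially. val_ge (k - fls_subdegree c) (sum f {..<n} - a)"
    using * by auto
  then show "\<forall>\<^sub>F n in sequentially. val_ge k ((\<Sum>n<n. c * f n) - c * a)"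
  proof eventually_elim
    case (elim n)
    have "val_ge (fls_subdegree c) c" by (simp add: val_ge_iff)
    from val_ge_mult[OF this elim] show ?case by (simp add: sum_distrib_left algebra_simps)
  qed
qed

lemma fls_sums_diff: "f sums a \<Longrightarrow> g sums b \<Longrightarrow> (\<lambda>n. f n - g n) sums (a - b)"
  for a b :: "'a::field fls"
  using fls_sums_add[of f a "\<lambda>n. (-1) * g n" "(-1) * b"] fls_sums_mult[of g b "-1"] by simp

lemma tendsto_matrix_vector_mult:
  fixes M :: "'a::field fls ^ 'd ^ 'e"
  assumes "(f \<longlongrightarrow> L) F"
  shows "((\<lambda>n. M *v f n) \<longlongrightarrow> M *v L) F"
  unfolding tendsto_vec_fls_iff
proof
  fix k
  obtain l where l: "mval_ge l M" using mval_ge_exists by blast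
  have "eventually (\<lambda>n. vval_ge (k - l) (f n - L)) F" using assms by (simp add: tendsto_vec_fls_iff)
  then show "eventually (\<lambda>n. vval_ge k (M *v f n - M *v L)) F"
    by eventually_elim
      (use l vval_ge_matrix_vector_mult[OF l] in \<open>fastforce simp flip: matrix_vector_mult_diff_distrib\<close>)
qed

lemma vec_fls_tendsto_add:
  fixes f :: "'b \<Rightarrow> 'a::ab_group_add fls ^ 'd::finite"
  assumes "(f \<longlongrightarrow> a) F" "(g \<longlongrightarrow> b) F"
  shows "((\<lambda>n. f n + g n) \<longlongrightarrow> a + b) F"
  unfolding tendsto_vec_fls_iff
proof
  fix k
  have "eventually (\<lambda>n. vval_ge k (f n - a)) F" "eventually (\<lambda>n. vval_ge k (g n - b)) F"
    using assms by (simp_all add: tendsto_vec_fls_iff)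
  then show "eventually (\<lambda>n. vval_ge k (f n + g n - (a + b))) F"
    by eventually_elim (drule (1) vval_ge_add, simp add: algebra_simps)
qed

lemma vec_fls_tendsto_sum:
  fixes f :: "'c \<Rightarrow> 'b \<Rightarrow> 'a::ab_group_add fls ^ 'd::finite"
  assumes "\<And>i. i \<in> S \<Longrightarrow> (f i \<longlongrightarrow> a i) F"
  shows "((\<lambda>n. \<Sum>i\<in>S. f i n) \<longlongrightarrow> (\<Sum>i\<in>S. a i)) F"
  using assms by (induction S rule: infinite_finite_induct) (auto intro: vec_fls_tendsto_add)

lemma frob_vec_diff: "frob_vec n (x - y) = frob_vec n x - frob_vec n y"
  by (simp add: frob_vec_def vec_eq_iff frob_diff)

lemma tendsto_frob_vec:
  fixes f :: "'b \<Rightarrow> 'a::finite_field fls ^ 'd::finite"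
  assumes "(f \<longlongrightarrow> a) F"
  shows "((\<lambda>n. frob_vec m (f n)) \<longlongrightarrow> frob_vec m a) F"
  unfolding tendsto_vec_fls_iff
proof
  fix k :: int
  \<comment> \<open>The Frobenius preserves a bound only if the bound is nonnegative, hence the
    absolute value.\<close>
  have "eventually (\<lambda>n. vval_ge \<bar>k\<bar> (f n - a)) F" using assms by (simp add: tendsto_vec_fls_iff)
  then show "eventually (\<lambda>n. vval_ge k (frob_vec m (f n) - frob_vec m a)) F"
    by eventually_elim
      (metis abs_ge_self abs_ge_zero frob_vec_diff vval_ge_frob_vec' vval_ge_mono)
qed

subsection \<open>Differentiation with respect to \<open>\<theta>\<close>\<close>

text \<open>The derivation d/dtheta: with X = 1/theta the chain rule gives d/dtheta = - X^2
  d/dX.\<close>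

definition theta_deriv :: "'a::comm_ring_1 fls \<Rightarrow> 'a fls" where
  "theta_deriv x = - (fls_X\<^sup>2 * fls_deriv x)"

lemma theta_deriv_nth: "theta_deriv x $$ j = - of_int (j - 1) * x $$ (j - 1)"
  by (simp add: theta_deriv_def fls_X_power_times_conv_shift algebra_simps)

lemma theta_deriv_0 [simp]: "theta_deriv 0 = 0"
  by (simp add: theta_deriv_def)

lemma theta_deriv_const [simp]: "theta_deriv (fls_const c) = 0"
  by (simp add: theta_deriv_def)

lemma theta_deriv_1 [simp]: "theta_deriv 1 = 0"
  by (simp add: theta_deriv_def)

lemma theta_deriv_X_inv [simp]: "theta_deriv (fls_X_inv :: 'a::field fls) = 1"
  by (intro fls_eqI) (simp add: theta_deriv_nth)

lemma theta_deriv_add: "theta_deriv (x + y) = theta_deriv x + theta_deriv y"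
  by (simp add: theta_deriv_def algebra_simps)

lemma theta_deriv_diff: "theta_deriv (x - y) = theta_deriv x - theta_deriv y"
  by (simp add: theta_deriv_def algebra_simps)

lemma theta_deriv_sum: "theta_deriv (sum f S) = (\<Sum>i\<in>S. theta_deriv (f i))"
  by (induction S rule: infinite_finite_induct) (auto simp: theta_deriv_add)

lemma theta_deriv_mult: "theta_deriv (x * y) = theta_deriv x * y + x * theta_deriv y"
  by (simp add: theta_deriv_def algebra_simps)

lemma theta_deriv_frob: "n > 0 \<Longrightarrow> theta_deriv (frob n x) = 0" for x :: "'a::finite_field fls"
proof -
  assume "n > 0"
  then have "of_nat (CARD('a) ^ n) = (0::'a fls)"
    using finite_field_of_nat_card[where 'a='a] by (simp add: of_nat_eq_0_iff_char_dvd fls_of_nat)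
  then show ?thesis
    by (simp add: theta_deriv_def frob_def fls_deriv_power del: of_nat_power)
qed

text \<open>Differentiation lowers the degree by one. This gain pays for the factor of degree at
  most one that the nilpotent part contributes whenever it is applied to a derivative.\<close>

lemma val_ge_theta_deriv: "val_ge k x \<Longrightarrow> val_ge (k + 1) (theta_deriv x)"
  by (simp add: val_ge_def theta_deriv_nth)

lemma fls_sums_theta_deriv:
  "f sums a \<Longrightarrow> (\<lambda>n. theta_deriv (f n)) sums theta_deriv a"
  unfolding sums_fls_iff
proof
  fix k assume *: "\<forall>k. \<forall>\<^sub>F n in sequentially. val_ge k (sum f {..<n} - a)"
  then have "\<forall>\<^sub>F n in sequentially. val_ge (k - 1) (sum f {..<n} - a)" by auto
  then show "\<forall>\<^sub>F n in sequentially. val_ge k ((\<Sum>n<n. theta_deriv (f n)) - theta_deriv a)"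
    by eventually_elim
      (drule val_ge_theta_deriv, simp add: theta_deriv_diff theta_deriv_sum)
qed

section \<open>Twisted power series\<close>

lemma frob_mat_add: "frob_mat n (A + B) = frob_mat n A + frob_mat n B"
  by (simp add: frob_mat_def vec_eq_iff frob_add)

lemma frob_mat_0 [simp]: "frob_mat n 0 = 0"
  by (simp add: frob_mat_def vec_eq_iff)

lemma frob_mat_mat [simp]: "frob_mat n (mat 1) = mat 1"
  by (simp add: frob_mat_def mat_def vec_eq_iff)

lemma frob_mat_zero_left [simp]: "frob_mat 0 A = A"
  by (simp add: frob_mat_def vec_eq_iff)

lemma frob_mat_sum: "frob_mat n (sum f S) = (\<Sum>i\<in>S. frob_mat n (f i))"
  by (induction S rule: infinite_finite_induct) (auto simp: frob_mat_add)

lemma frob_mat_mult: "frob_mat n (A ** B) = frob_mat n A ** frob_mat n B"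
  by (simp add: frob_mat_def matrix_matrix_mult_def vec_eq_iff frob_mult frob_sum)

lemma frob_mat_frob_mat: "frob_mat m (frob_mat n A) = frob_mat (m + n) A"
  by (simp add: frob_mat_def vec_eq_iff frob_frob)

lemma frob_vec_matrix_vector_mult: "frob_vec n (A *v x) = frob_mat n A *v frob_vec n x"
  by (simp add: frob_mat_def frob_vec_def matrix_vector_mult_def vec_eq_iff frob_mult frob_sum)

lemma frob_vec_add: "frob_vec n (x + y) = frob_vec n x + frob_vec n y"
  by (simp add: frob_vec_def vec_eq_iff frob_add)

lemma frob_vec_0 [simp]: "frob_vec n 0 = 0"
  by (simp add: frob_vec_def vec_eq_iff)

lemma frob_vec_zero_left [simp]: "frob_vec 0 x = x"
  by (simp add: frob_vec_def vec_eq_iff)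

lemma frob_vec_sum: "frob_vec n (sum f S) = (\<Sum>i\<in>S. frob_vec n (f i))"
  by (induction S rule: infinite_finite_induct) (auto simp: frob_vec_add)

lemma frob_vec_frob_vec: "frob_vec m (frob_vec n x) = frob_vec (m + n) x"
  by (simp add: frob_vec_def vec_eq_iff frob_frob)

lemma frob_vec_axis [simp]: "frob_vec n (axis i 1) = axis i 1"
  by (simp add: frob_vec_def axis_def vec_eq_iff)

lemma matrix_add_rdistrib: "(A + B) ** C = A ** C + B ** C"
  by (simp add: matrix_matrix_mult_def vec_eq_iff distrib_right sum.distrib)

lemma matrix_mul_sum_left: "(\<Sum>i\<in>S. f i) ** B = (\<Sum>i\<in>S. f i ** B)"
  by (induction S rule: infinite_finite_induct) (auto simp: matrix_add_rdistrib)

lemma matrix_mul_sum_right: "A ** (\<Sum>i\<in>S. f i) = (\<Sum>i\<in>S. A ** f i)"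
  by (induction S rule: infinite_finite_induct) (auto simp: matrix_add_ldistrib)

lemma matrix_vector_mult_sum_left: "(\<Sum>i\<in>S. f i) *v x = (\<Sum>i\<in>S. f i *v x)"
  for f :: "'c \<Rightarrow> 'b::semiring_1 ^ 'd ^ 'e"
  by (induction S rule: infinite_finite_induct) (auto simp: matrix_vector_mult_add_rdistrib)

lemma matrix_vector_mult_sum_right: "A *v (\<Sum>i\<in>S. f i) = (\<Sum>i\<in>S. A *v f i)"
  for f :: "'c \<Rightarrow> 'b::semiring_1 ^ 'd"
  by (induction S rule: infinite_finite_induct) (auto simp: matrix_vector_right_distrib)

lemma tws_mult_assoc: "tws_mult (tws_mult P Q) R = tws_mult P (tws_mult Q R)"
proof
  fix n
  define g where "g i j = P i ** (frob_mat i (Q j) ** frob_mat (i + j) (R (n - (i + j))))" for i j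
  have "tws_mult (tws_mult P Q) R n = (\<Sum>k\<le>n. \<Sum>i\<le>k. g i (k - i))"
    by (auto simp: tws_mult_def matrix_mul_sum_left g_def matrix_mul_assoc intro!: sum.cong)
  also have "\<dots> = (\<Sum>(i,j)\<in>{(i,j). i + j \<le> n}. g i j)"
    by (rule sum.triangle_reindex_eq[symmetric])
  also have "{(i,j). i + j \<le> n} = Sigma {..n} (\<lambda>i. {..n - i})" by auto
  also have "(\<Sum>(i,j)\<in>Sigma {..n} (\<lambda>i. {..n - i}). g i j) = (\<Sum>i\<le>n. \<Sum>j\<le>n - i. g i j)"
    by (subst sum.Sigma) auto
  also have "\<dots> = tws_mult P (tws_mult Q R) n"
    by (auto simp: tws_mult_def matrix_mul_sum_right g_def frob_mat_sum frob_mat_mult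
        frob_mat_frob_mat intro!: sum.cong)
  finally show "tws_mult (tws_mult P Q) R n = tws_mult P (tws_mult Q R) n" .
qed

lemma tws_mult_const_left: "tws_mult (tws_const M) Q n = M ** Q n"
proof -
  have "tws_mult (tws_const M) Q n = (\<Sum>i\<in>{0}. tws_const M i ** frob_mat i (Q (n - i)))"
    unfolding tws_mult_def by (rule sum.mono_neutral_right) (auto simp: tws_const_def)
  then show ?thesis by (simp add: tws_const_def)
qed

lemma tws_mult_const_right: "tws_mult Q (tws_const M) n = Q n ** frob_mat n M"
proof -
  have "tws_mult Q (tws_const M) n = (\<Sum>i\<in>{n}. Q i ** frob_mat i (tws_const M (n - i)))"
    unfolding tws_mult_def by (rule sum.mono_neutral_right) (auto simp: tws_const_def)
  then show ?thesis by (simp add: tws_const_def)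
qed

lemma tws_mult_1_left [simp]: "tws_mult (tws_const (mat 1)) Q = Q"
  by (rule ext) (simp add: tws_mult_const_left)

lemma tws_mult_1_right [simp]: "tws_mult Q (tws_const (mat 1)) = Q"
  by (rule ext) (simp add: tws_mult_const_right)

section \<open>Inverses of twisted power series, and uniqueness of Exp\<close>

fun tws_inv :: "('a::finite_field, 'd::finite) tws \<Rightarrow> ('a, 'd) tws" where
  "tws_inv P n =
     (if n = 0 then mat 1 else - (\<Sum>i<n. tws_inv P i ** frob_mat i (P (n - i))))"

declare tws_inv.simps [simp del]

lemma tws_inv_0 [simp]: "tws_inv P 0 = mat 1"
  by (simp add: tws_inv.simps)

lemma tws_inv_mult_left: 
  assumes "P 0 = mat 1"
  shows "tws_mult (tws_inv P) P = tws_const (mat 1)"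
proof
  fix n
  show "tws_mult (tws_inv P) P n = tws_const (mat 1) n"
  proof (cases "n = 0")
    case False
    then have "{..n} = insert n {..<n}" by auto
    then show ?thesis using False assms
      by (simp add: tws_mult_def tws_inv.simps[of P n] tws_const_def)
  qed (simp add: tws_mult_def tws_const_def assms)
qed

text \<open>A left inverse D of the left inverse C of P satisfies D = D (C P) = P, so C is a
  two-sided inverse.\<close>

lemma tws_inv_mult_right: 
  assumes "P 0 = mat 1"
  shows "tws_mult P (tws_inv P) = tws_const (mat 1)"
proof -
  define C D where "C = tws_inv P" and "D = tws_inv C"
  have CP: "tws_mult C P = tws_const (mat 1)" and DC: "tws_mult D C = tws_const (mat 1)"
    by (simp_all add: C_def D_def tws_inv_mult_left assms)
  have "D = P" using arg_cong[OF CP, of "tws_mult D"]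
    by (simp add: DC flip: tws_mult_assoc)
  then show ?thesis using DC by (simp add: C_def)
qed

text \<open>In the recursion the indices i and n - i add up to n, valuations add in products, and
  twisting does not lower them. So Exp inherits the bound known for Log.\<close>

lemma mval_ge_tws_inv:
  assumes "\<And>n. mval_ge (int n) (P n)"
  shows "mval_ge (int n) (tws_inv P n)"
proof (induction n rule: less_induct)
  case (less n)
  have "mval_ge (int n) (\<Sum>i<n. tws_inv P i ** frob_mat i (P (n - i)))"
  proof (rule mval_ge_sum)
    fix i assume i: "i \<in> {..<n}"
    have "mval_ge (int i + int (n - i)) (tws_inv P i ** frob_mat i (P (n - i)))"
      using i by (intro mval_ge_mult less mval_ge_frob_mat' assms) auto
    then show "mval_ge (int n) (tws_inv P i ** frob_mat i (P (n - i)))" using i by simp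
  qed
  moreover have "mval_ge 0 (mat 1 :: 'a fls ^ 'b ^ 'b)" by (simp add: mval_ge_def mat_def)
  ultimately show ?case by (subst tws_inv.simps) (auto simp: mval_ge_def)
qed

lemma Log_tws_eqI:
  assumes "tws_mult P (Exp_tws E) = tws_const (mat 1)" "tws_mult (Exp_tws E) P = tws_const (mat 1)"
  shows "Log_tws E = P"
  unfolding Log_tws_def
proof (rule the_equality)
  fix Q assume Q: "tws_mult Q (Exp_tws E) = tws_const (mat 1) \<and>
    tws_mult (Exp_tws E) Q = tws_const (mat 1)"
  have "tws_mult (tws_mult P (Exp_tws E)) Q = P"
    by (subst tws_mult_assoc) (simp add: Q)
  then show "Q = P" by (simp add: assms)
qed (use assms in simp)

lemma mat_mult_eq: "mat c ** A = (\<chi> i j. c * A $ i $ j)"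
  by (simp add: mat_def matrix_matrix_mult_def vec_eq_iff if_distrib[of "\<lambda>x. x * _"] cong: if_cong)

lemma mult_mat_eq: "A ** mat c = (\<chi> i j. A $ i $ j * c)"
  by (simp add: mat_def matrix_matrix_mult_def vec_eq_iff if_distrib[of "\<lambda>x. _ * x"] cong: if_cong)

lemma mat_mult_commute: "mat c ** A = A ** mat (c :: 'b::comm_semiring_1)"
  by (simp add: mat_mult_eq mult_mat_eq mult.commute)

lemma mat_mult_eq_0: "mat (c :: 'b::idom) ** A = 0 \<Longrightarrow> c \<noteq> 0 \<Longrightarrow> A = 0"
  by (simp add: mat_mult_eq vec_eq_iff)

lemma mat_mat_mult: "mat c ** mat d = (mat (c * d) :: 'b::semiring_1 ^ 'd ^ 'd)"
  by (simp add: mat_mult_eq) (simp add: mat_def vec_eq_iff)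

lemma mat_add: "mat c + mat d = (mat (c + d) :: 'b::semiring_1 ^ 'd ^ 'd)"
  by (simp add: mat_def vec_eq_iff)

lemma matrix_mul_minus_right: "A ** (- B) = - (A ** B)" for A :: "'b::ring_1 ^ 'd ^ 'e"
  by (simp add: matrix_matrix_mult_def vec_eq_iff sum_negf)

lemma matrix_mul_minus_left: "(- A) ** B = - (A ** B)" for A :: "'b::ring_1 ^ 'd ^ 'e"
  by (simp add: matrix_matrix_mult_def vec_eq_iff sum_negf)

lemma theta_power_diff_neq_0:
  assumes "n > 0"
  shows "frob n fls_X_inv \<noteq> (fls_X_inv :: 'a::finite_field fls)"
proof
  assume "frob n fls_X_inv = (fls_X_inv :: 'a fls)"
  then have "fls_subdegree (frob n (fls_X_inv :: 'a fls)) = -1" by simp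
  moreover have "int CARD('a) ^ n > 1" by (rule one_less_power) (use assms card_gt_1[where 'a='a] in auto)
  ultimately show False by (simp add: frob_def)
qed

text \<open>If \<open>D\<^sub>n\<close> is the first coefficient in which two solutions differ, then
  \<open>(\<theta>\<^sup>(\<^sup>n\<^sup>) - \<theta>) D\<^sub>n = N D\<^sub>n - D\<^sub>n N\<^sup>(\<^sup>n\<^sup>)\<close>; multiplying by the nilpotent matrices kills the right-hand
  side step by step.\<close>

lemma Exp_equation_unique:
  fixes E :: "('a::finite_field, 'd::finite) tws"
  assumes E0: "E 0 = mat fls_X_inv + N" and N: "N ** N = 0"
    and C: "C 0 = mat 1" "tws_mult C (tws_const (E 0)) = tws_mult E C"
    and C': "C' 0 = mat 1" "tws_mult C' (tws_const (E 0)) = tws_mult E C'"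
  shows "C = C'"
proof
  fix n
  show "C n = C' n"
  proof (induction n rule: less_induct)
    case (less n)
    show ?case
    proof (cases "n = 0")
      case False
      define D where "D = C n - C' n"
      define c :: "'a fls" where "c = frob n fls_X_inv - fls_X_inv"
      define N' where "N' = frob_mat n N"
      have c: "c \<noteq> 0" using False theta_power_diff_neq_0[of n, where 'a='a] by (simp add: c_def)
      have N': "N' ** N' = 0" using N by (simp add: N'_def flip: frob_mat_mult)
      have expand: "X n ** frob_mat n (E 0) = E 0 ** X n + (\<Sum>i\<in>{1..n}. E i ** frob_mat i (X (n - i)))"
        if "tws_mult X (tws_const (E 0)) = tws_mult E X" for X
      proof -
        have "{..n} = insert 0 {1..n}" by auto
        then show ?thesis using fun_cong[OF that, of n]
          by (simp add: tws_mult_const_right) (simp add: tws_mult_def)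
      qed
      have "(\<Sum>i\<in>{1..n}. E i ** frob_mat i (C (n - i))) = (\<Sum>i\<in>{1..n}. E i ** frob_mat i (C' (n - i)))"
        by (intro sum.cong refl arg_cong2[of _ _ _ _ "(**)"] arg_cong[of _ _ "frob_mat _"] less) auto
      then have "C n ** frob_mat n (E 0) - C' n ** frob_mat n (E 0) = E 0 ** C n - E 0 ** C' n"
        using expand[OF C(2)] expand[OF C'(2)] by (simp add: algebra_simps)
      then have "D ** frob_mat n (E 0) = E 0 ** D"
        using matrix_add_rdistrib[of "C n" "- C' n" "frob_mat n (E 0)"] matrix_add_ldistrib[of "E 0" "C n" "- C' n"]
        by (simp add: D_def matrix_mul_minus_left matrix_mul_minus_right)
      moreover have "frob_mat n (E 0) = mat (frob n fls_X_inv) + N'"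
        by (simp add: E0 frob_mat_add N'_def) (simp add: frob_mat_def mat_def vec_eq_iff)
      ultimately have eq: "mat c ** D = N ** D - D ** N'"
        by (simp add: E0 matrix_add_ldistrib matrix_add_rdistrib c_def flip: mat_mult_commute)
          (simp add: mat_mult_eq vec_eq_iff algebra_simps)
      have NDN: "N ** D ** N' = 0"
      proof -
        have "mat c ** (N ** D ** N') = N ** (mat c ** D) ** N'"
          by (metis mat_mult_commute matrix_mul_assoc)
        also have "\<dots> = (N ** N) ** D ** N' - N ** D ** (N' ** N')"
          unfolding eq using matrix_add_ldistrib[of N "N ** D" "- (D ** N')"]
            matrix_add_rdistrib[of "N ** N ** D" "- (N ** D ** N')" N']
          by (simp add: matrix_mul_minus_right matrix_mul_minus_left matrix_mul_assoc)
        finally show ?thesis using c by (simp add: N N') (metis mat_mult_eq_0)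
      qed
      have ND: "N ** D = 0"
      proof -
        have "mat c ** (N ** D) = N ** (mat c ** D)"
          by (metis mat_mult_commute matrix_mul_assoc)
        also have "\<dots> = (N ** N) ** D - N ** D ** N'"
          unfolding eq using matrix_add_ldistrib[of N "N ** D" "- (D ** N')"]
          by (simp add: matrix_mul_minus_right matrix_mul_assoc)
        finally show ?thesis using c by (simp add: N NDN) (metis mat_mult_eq_0)
      qed
      have DN: "D ** N' = 0"
      proof -
        have "mat c ** (D ** N') = (mat c ** D) ** N'" by (simp add: matrix_mul_assoc)
        also have "\<dots> = - (D ** (N' ** N'))"
          unfolding eq by (simp add: ND matrix_mul_minus_left matrix_mul_assoc)
        finally show ?thesis using c by (simp add: N') (metis mat_mult_eq_0)
      qed
      have "D = 0" using eq c by (simp add: ND DN) (metis mat_mult_eq_0)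
      then show ?thesis by (simp add: D_def)
    qed (simp add: C C')
  qed
qed

lemma Exp_tws_eqI:
  assumes "E 0 = mat fls_X_inv + N" "N ** N = 0"
    and "C 0 = mat 1" "tws_mult C (tws_const (E 0)) = tws_mult E C"
  shows "Exp_tws E = C"
  unfolding Exp_tws_def
  using Exp_equation_unique[of E N] assms by (intro the_equality) auto

section \<open>The embedding of \<open>A\<close>\<close>

lemma map_poly_fls_const_add:
  "map_poly fls_const (p + q) = map_poly fls_const p + map_poly fls_const (q :: 'a::field poly)"
  by (intro poly_eqI) (simp add: coeff_map_poly fls_plus_const)

lemma A_inf_0 [simp]: "A_inf 0 = 0"
  by (simp add: A_inf_def)

lemma A_inf_add: "A_inf (p + q) = A_inf p + A_inf q"
  by (simp add: A_inf_def map_poly_fls_const_add)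

lemma A_inf_pCons: "A_inf (pCons c p) = fls_const c + fls_X_inv * A_inf p"
  by (simp add: A_inf_def map_poly_pCons)

lemma A_inf_const [simp]: "A_inf [:c:] = fls_const c"
  by (simp add: A_inf_pCons)

lemma A_inf_1 [simp]: "A_inf 1 = 1"
  by (simp add: one_pCons)

lemma A_inf_theta [simp]: "A_inf [:0, 1:] = fls_X_inv"
  by (simp add: A_inf_pCons)

lemma A_inf_smult: "A_inf (smult c p) = fls_const c * A_inf p"
  by (induction p) (simp_all add: A_inf_pCons algebra_simps)

lemma A_inf_mult: "A_inf (p * q) = A_inf p * A_inf q"
  by (induction p) (simp_all add: A_inf_pCons A_inf_add A_inf_smult algebra_simps)

lemma A_inf_minus: "A_inf (- p) = - A_inf p"
  using A_inf_add[of p "- p"] by (simp add: eq_neg_iff_add_eq_0 add.commute)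

lemma A_inf_diff: "A_inf (p - q) = A_inf p - A_inf q"
  using A_inf_add[of p "- q"] by (simp add: A_inf_minus)

lemma A_inf_power: "A_inf (p ^ n) = A_inf p ^ n"
  by (induction n) (simp_all add: A_inf_mult)

lemma A_inf_nth: "A_inf p $$ j = (if j \<le> 0 then coeff p (nat (- j)) else 0)"
proof (induction p arbitrary: j)
  case (pCons c p)
  have "A_inf (pCons c p) $$ j = (if j = 0 then c else 0) + A_inf p $$ (j + 1)"
    by (simp add: A_inf_pCons fls_X_inv_times_conv_shift)
  moreover have "nat (- j) = Suc (nat (- (j + 1)))" if "j < 0" using that by simp
  ultimately show ?case using pCons by auto
qed simp

lemma A_inf_eq_iff [simp]: "A_inf p = A_inf q \<longleftrightarrow> p = q"
proof
  assume *: "A_inf p = A_inf q"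
  show "p = q"
  proof (rule poly_eqI)
    fix n
    show "coeff p n = coeff q n"
      using arg_cong[OF *, of "\<lambda>x. x $$ (- int n)"] by (simp add: A_inf_nth)
  qed
qed simp

lemma A_inf_eq_0_iff [simp]: "A_inf p = 0 \<longleftrightarrow> p = 0"
  using A_inf_eq_iff[of p 0] by (simp del: A_inf_eq_iff)

lemma A_inf_pderiv: "A_inf (pderiv p) = theta_deriv (A_inf p)"
  by (induction p) (simp_all add: A_inf_pCons A_inf_add pderiv_pCons theta_deriv_add
      theta_deriv_mult)

lemma val_ge_A_inf: "degree p \<le> n \<Longrightarrow> val_ge (- int n) (A_inf p)"
  by (auto simp: val_ge_def A_inf_nth coeff_eq_0)

text \<open>Discreteness of A in K_inf: polynomials in theta have coefficients at nonpositive
  indices only.\<close>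

lemma A_inf_val_ge_1: "val_ge 1 (A_inf p) \<Longrightarrow> p = 0"
proof (rule poly_eqI)
  fix n assume "val_ge 1 (A_inf p)"
  then have "A_inf p $$ (- int n) = 0" by (simp add: val_ge_def)
  then show "coeff p n = coeff 0 n" by (simp add: A_inf_nth)
qed

text \<open>The counterpart of discreteness: K_inf is A plus the maximal ideal.
  \<open>fls_prpart\<close> collects the negative indices only, so the coefficient at 0 is added
  separately.\<close>

lemma A_inf_approx: "\<exists>p. val_ge 1 (x - A_inf p)"
proof
  have "coeff [:c:] n = (if n = 0 then c else 0)" for c :: 'a and n
    by (simp add: coeff_pCons split: nat.split)
  then show "val_ge 1 (x - A_inf (fls_prpart x + [:x $$ 0:]))"
    by (auto simp: val_ge_def A_inf_nth order.antisym intro!: arg_cong[of _ 0 "fls_nth x"])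
qed

lemma A_inf_unit:
  assumes "A_inf p * A_inf q = 1"
  obtains c where "c \<noteq> 0" "p = [:c:]"
proof -
  have "A_inf (p * q) = A_inf 1" using assms by (simp only: A_inf_mult A_inf_1)
  then have "p * q = 1" by (simp only: A_inf_eq_iff)
  then have "p dvd 1" by (metis dvd_triv_left)
  then show ?thesis using that by (auto simp: is_unit_poly_iff dvd_field_iff)
qed

lemma frob_A_inf: "frob n (A_inf p) = A_inf (p ^ (CARD('a) ^ n))" for p :: "'a::finite_field poly"
  by (simp add: frob_def A_inf_power)

lemma A_inf_range_closed:
  "x \<in> range A_inf \<Longrightarrow> y \<in> range A_inf \<Longrightarrow> x + y \<in> range A_inf"
  "x \<in> range A_inf \<Longrightarrow> y \<in> range A_inf \<Longrightarrow> x * y \<in> range A_inf"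
  "x \<in> range A_inf \<Longrightarrow> - x \<in> range A_inf"
  "x \<in> range A_inf \<Longrightarrow> y \<in> range A_inf \<Longrightarrow> x - y \<in> range A_inf"
  "0 \<in> range A_inf" "1 \<in> range A_inf" "fls_X_inv \<in> range A_inf" "fls_const c \<in> range A_inf"
  "x \<in> range A_inf \<Longrightarrow> frob n x \<in> range A_inf"
  "x \<in> range A_inf \<Longrightarrow> theta_deriv x \<in> range A_inf"
  by (auto simp: frob_A_inf simp flip: A_inf_add A_inf_mult A_inf_minus A_inf_diff A_inf_pderiv)
    (metis rangeI A_inf_0 A_inf_1 A_inf_theta A_inf_const)+

lemma A_inf_range_sum: "(\<And>i. i \<in> S \<Longrightarrow> f i \<in> range A_inf) \<Longrightarrow> sum f S \<in> range A_inf"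
  by (induction S rule: infinite_finite_induct) (simp_all add: A_inf_range_closed del: image_iff)

lemma A_inf_range_prod: "(\<And>i. i \<in> S \<Longrightarrow> f i \<in> range A_inf) \<Longrightarrow> prod f S \<in> range A_inf"
  by (induction S rule: infinite_finite_induct) (simp_all add: A_inf_range_closed del: image_iff)

lemma A_inf_range_sign: "of_int (sign p) \<in> range A_inf"
  unfolding sign_def using A_inf_range_closed(6) A_inf_range_closed(3)[OF A_inf_range_closed(6)]
  by auto

lemma A_inf_range_det:
  assumes "\<And>i j. M $ i $ j \<in> range A_inf"
  shows "det M \<in> range A_inf"
  unfolding det_def
  by (intro A_inf_range_sum A_inf_range_closed A_inf_range_prod A_inf_range_sign assms)

section \<open>The action of \<open>K\<^sub>\<infinity>\<close>\<close>

lemma powi_X_inv_nth: "(fls_X_inv powi k) $$ j = (if j = - k then 1 else (0::'a::field))"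
proof (cases "k \<ge> 0")
  case True
  then show ?thesis by (auto simp: power_int_def)
next
  case False
  then have "fls_X_inv powi k = (fls_X ^ nat (- k) :: 'a fls)"
    by (simp add: power_int_def fls_inverse_X_inv)
  then show ?thesis using False by auto
qed

lemma matrix_inv_eqI: "A ** B = mat 1 \<Longrightarrow> B ** A = mat 1 \<Longrightarrow> matrix_inv A = B"
  unfolding matrix_inv_def
  by (rule some_equality) (auto, metis matrix_mul_assoc matrix_mul_lid matrix_mul_rid)

lemma mat_vector_mult: "mat c *v x = c *s x"
  by (simp add: mat_def matrix_vector_mult_def vec_eq_iff if_distrib[of "\<lambda>x. x * _"] cong: if_cong)

lemma matrix_vector_mult_smult: "A *v (c *s x) = c *s (A *v x)" for A :: "'b::comm_semiring_1 ^ 'd ^ 'e"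
  by (simp add: matrix_vector_mult_def vec_eq_iff sum_distrib_left mult.left_commute)

definition vec_theta_deriv :: "'a::comm_ring_1 fls ^ 'd \<Rightarrow> 'a fls ^ 'd" where
  "vec_theta_deriv v = (\<chi> i. theta_deriv (v $ i))"

definition mat_theta_deriv :: "'a::comm_ring_1 fls ^ 'd ^ 'e \<Rightarrow> 'a fls ^ 'd ^ 'e" where
  "mat_theta_deriv M = (\<chi> i j. theta_deriv (M $ i $ j))"

lemma vec_theta_deriv_add: "vec_theta_deriv (u + v) = vec_theta_deriv u + vec_theta_deriv v"
  by (simp add: vec_theta_deriv_def vec_eq_iff theta_deriv_add)

lemma vec_theta_deriv_diff: "vec_theta_deriv (u - v) = vec_theta_deriv u - vec_theta_deriv v"
  by (simp add: vec_theta_deriv_def vec_eq_iff theta_deriv_diff)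

lemma vec_theta_deriv_smult:
  "vec_theta_deriv (c *s v) = theta_deriv c *s v + c *s vec_theta_deriv v"
  by (simp add: vec_theta_deriv_def vec_eq_iff theta_deriv_mult)

lemma vec_theta_deriv_mult:
  "vec_theta_deriv (M *v v) = mat_theta_deriv M *v v + M *v vec_theta_deriv v"
  by (simp add: vec_theta_deriv_def mat_theta_deriv_def matrix_vector_mult_def vec_eq_iff
      theta_deriv_sum theta_deriv_mult sum.distrib)

lemma vval_ge_vec_theta_deriv: "vval_ge k v \<Longrightarrow> vval_ge (k + 1) (vec_theta_deriv v)"
  by (simp add: vval_ge_def vec_theta_deriv_def val_ge_theta_deriv)

text \<open>Kept apart from \<open>t_module\<close> because \<open>Reg_transport\<close> interprets
  it for a module that is known only through a change of variables.\<close>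

locale nilpotent_part =
  fixes E :: "('a::finite_field, 'd::finite) tws" and N :: "'a fls ^ 'd ^ 'd"
  assumes E_0: "E 0 = mat fls_X_inv + N" and N_N: "N ** N = 0"
begin

lemma N_N_vec [simp]: "N *v (N *v v) = 0"
  by (simp add: matrix_vector_mul_assoc N_N)

lemma E_0_apply: "E 0 *v v = fls_X_inv *s v + N *v v"
  by (simp add: E_0 matrix_vector_mult_add_rdistrib mat_vector_mult)

lemma matrix_inv_E_0: "matrix_inv (E 0) = mat fls_X - mat (fls_X\<^sup>2) ** N"
proof (rule matrix_inv_eqI)
  let ?B = "mat fls_X - mat (fls_X\<^sup>2) ** N"
  have TX: "fls_X * fls_X_inv = (1 :: 'a fls)" by (simp flip: fls_inverse_X)
  have X2: "fls_X\<^sup>2 * fls_X_inv = (fls_X :: 'a fls)"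
    by (simp add: power2_eq_square mult.assoc TX)
  show *: "?B ** E 0 = mat 1"
    by (simp add: matrix_eq E_0_apply TX X2 TX[unfolded mult.commute[of fls_X]]
        X2[unfolded mult.commute[of "fls_X\<^sup>2"]] matrix_vector_mult_diff_rdistrib mat_vector_mult
        matrix_vector_right_distrib matrix_vector_mult_smult vector_smult_assoc vector_add_ldistrib
        flip: matrix_vector_mul_assoc)
  then show "E 0 ** ?B = mat 1" by (simp add: matrix_left_right_inverse)
qed

text \<open>The Taylor expansion of the k-th power at theta + N stops after the linear term, since
  the square of N is 0. Writing that term as a derivative treats both signs of k alike and makes the
  formula linear in the monomial.\<close>

lemma matrix_powi_vec_E_0:
  "matrix_powi_vec (E 0) k v =
     (fls_X_inv powi k) *s v + theta_deriv (fls_X_inv powi k) *s (N *v v)"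
proof -
  have inv_apply: "matrix_inv (E 0) *v w = fls_X *s w - fls_X\<^sup>2 *s (N *v w)" for w
    by (simp add: matrix_inv_E_0 matrix_vector_mult_diff_rdistrib mat_vector_mult
        flip: matrix_vector_mul_assoc)
  note linear = matrix_vector_right_distrib matrix_vector_mult_smult N_N_vec
  have pos: "((*v) (E 0) ^^ n) v = (fls_X_inv ^ n) *s v + theta_deriv (fls_X_inv ^ n) *s (N *v v)" for n
  proof (induction n)
    case (Suc n)
    have "((*v) (E 0) ^^ Suc n) v =
        fls_X_inv *s ((fls_X_inv ^ n) *s v + theta_deriv (fls_X_inv ^ n) *s (N *v v)) +
        ((fls_X_inv ^ n) *s (N *v v))"
      by (simp only: funpow.simps o_apply Suc.IH E_0_apply linear) (simp add: mult.commute)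
    then show ?case by (simp add: vec_eq_iff theta_deriv_mult algebra_simps)
  qed simp
  have dX: "theta_deriv (fls_X :: 'a fls) = - (fls_X\<^sup>2)" by (simp add: theta_deriv_def)
  have neg: "((*v) (matrix_inv (E 0)) ^^ n) v = (fls_X ^ n) *s v + theta_deriv (fls_X ^ n) *s (N *v v)" for n
  proof (induction n)
    case (Suc n)
    have "((*v) (matrix_inv (E 0)) ^^ Suc n) v =
        fls_X *s ((fls_X ^ n) *s v + theta_deriv (fls_X ^ n) *s (N *v v)) -
        fls_X\<^sup>2 *s ((fls_X ^ n) *s (N *v v))"
      by (simp only: funpow.simps o_apply Suc.IH inv_apply linear) (simp add: mult.commute)
    then show ?case by (simp add: vec_eq_iff theta_deriv_mult dX algebra_simps)
  qed simp
  show ?thesis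
  proof (cases "k \<ge> 0")
    case True
    then show ?thesis using pos[of "nat k"] by (simp add: matrix_powi_vec_def power_int_def)
  next
    case False
    then have "fls_X_inv powi k = (fls_X ^ nat (- k) :: 'a fls)"
      by (simp add: power_int_def fls_inverse_X_inv)
    then show ?thesis using neg[of "nat (- k)"] False by (simp add: matrix_powi_vec_def)
  qed
qed

text \<open>Both sides agree on the monomials \<open>f n\<close> of the Laurent expansion of c; the
  derivation is continuous, so the formula may be summed.\<close>

lemma K_inf_scale_eq: "K_inf_scale E c v = c *s v + theta_deriv c *s (N *v v)"
proof -
  define s where "s = fls_subdegree c"
  define f where "f n = fls_const (c $$ (s + int n)) * fls_X_inv powi (- (s + int n))" for n :: nat
  have "f sums c"
    unfolding sums_fls_iff
  proof
    fix k
    show "\<forall>\<^sub>F n in sequentially. val_ge k ((\<Sum>i<n. f i) - c)"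
    proof (rule eventually_sequentiallyI[of "nat (k - s)"])
      fix n assume n: "nat (k - s) \<le> n"
      have "(\<Sum>i<n. f i) $$ j = c $$ j" if "j < k" for j
      proof -
        have *: "(\<Sum>i<n. f i) $$ j = (\<Sum>i<n. if int i = j - s then c $$ j else 0)"
          by (auto simp: fls_nth_sum f_def powi_X_inv_nth intro!: sum.cong)
        show ?thesis
        proof (cases "j \<ge> s")
          case True
          then have "(\<Sum>i<n. if int i = j - s then c $$ j else 0) =
              (\<Sum>i<n. if nat (j - s) = i then c $$ j else 0)"
            by (intro sum.cong) auto
          then show ?thesis using * n that True by (simp add: nat_less_iff)
        next
          case False
          then show ?thesis unfolding * by (auto simp: s_def intro: sum.neutral)
        qed
      qed
      then show "val_ge k ((\<Sum>i<n. f i) - c)" by (simp add: val_ge_def)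
    qed
  qed
  have "(\<lambda>n. f n *s v + theta_deriv (f n) *s (N *v v)) sums (c *s v + theta_deriv c *s (N *v v))"
    unfolding sums_vec_iff
  proof
    fix i
    show "(\<lambda>n. (f n *s v + theta_deriv (f n) *s (N *v v)) $ i) sums
        ((c *s v + theta_deriv c *s (N *v v)) $ i)"
      using fls_sums_add[OF fls_sums_mult[OF \<open>f sums c\<close>, of "v $ i"]
          fls_sums_mult[OF fls_sums_theta_deriv[OF \<open>f sums c\<close>], of "(N *v v) $ i"]]
      by (simp add: mult.commute)
  qed
  moreover have "(let j = s + int n in fls_const (c $$ j) *s matrix_powi_vec (E 0) (- j) v) =
      f n *s v + theta_deriv (f n) *s (N *v v)" for n
    by (simp add: Let_def matrix_powi_vec_E_0 f_def theta_deriv_mult vector_add_ldistrib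
        vector_smult_assoc)
  ultimately show ?thesis
    unfolding K_inf_scale_def s_def[symmetric] by (simp add: sums_iff)
qed

lemma A_scale_eq: "A_scale E a v = A_inf a *s v + theta_deriv (A_inf a) *s (N *v v)"
  by (simp add: A_scale_def K_inf_scale_eq)

sublocale A_module: module "A_scale E"
proof
  fix a b :: "'a poly" and v w :: "'a fls ^ 'd"
  show "A_scale E a (v + w) = A_scale E a v + A_scale E a w"
    by (simp add: A_scale_eq matrix_vector_right_distrib vector_add_ldistrib)
  show "A_scale E (a + b) v = A_scale E a v + A_scale E b v"
    by (simp add: A_scale_eq A_inf_add theta_deriv_add vector_sadd_rdistrib)
  have "A_scale E a (A_scale E b v) =
      A_inf a *s (A_inf b *s v + theta_deriv (A_inf b) *s (N *v v)) +
      theta_deriv (A_inf a) *s (A_inf b *s (N *v v))"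
    by (simp only: A_scale_eq matrix_vector_right_distrib matrix_vector_mult_smult N_N_vec) simp
  also have "\<dots> = A_scale E (a * b) v"
    by (simp add: A_scale_eq A_inf_mult theta_deriv_mult vec_eq_iff algebra_simps)
  finally show "A_scale E a (A_scale E b v) = A_scale E (a * b) v" .
  show "A_scale E 1 v = v" by (simp add: A_scale_eq)
qed

end

section \<open>Bases, coordinates and uniqueness of the regulator\<close>

context nilpotent_part
begin

text \<open>Replaces coefficient functions on the set \<open>range b\<close> by families over the
  index type, which fit coordinate matrices. Injectivity of b is contained in the right-hand side: a
  repeated vector gives a relation with coefficients 1 and -1.\<close>

lemma is_A_basis_iff:
  "is_A_basis E L b \<longleftrightarrow>
     (\<forall>a. (\<Sum>i\<in>UNIV. A_scale E (a i) (b i)) = 0 \<longrightarrow> (\<forall>i. a i = 0)) \<and>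
     L = range (\<lambda>a. \<Sum>i\<in>UNIV. A_scale E (a i) (b i))"
proof -
  have reindex: "(\<Sum>v\<in>range b. A_scale E (f v) v) = (\<Sum>i\<in>UNIV. A_scale E (f (b i)) (b i))"
    if "inj b" for f
    using that by (simp add: sum.reindex o_def)
  have span: "A_module.span (range b) = range (\<lambda>a. \<Sum>i\<in>UNIV. A_scale E (a i) (b i))" if "inj b"
    unfolding A_module.span_finite[OF finite_imageI[OF finite]]
  proof (intro equalityI image_subsetI)
    fix f
    show "(\<Sum>v\<in>range b. A_scale E (f v) v) \<in> range (\<lambda>a. \<Sum>i\<in>UNIV. A_scale E (a i) (b i))"
      by (rule range_eqI[of _ _ "\<lambda>i. f (b i)"]) (rule reindex[OF that])
  next
    fix a
    show "(\<Sum>i\<in>UNIV. A_scale E (a i) (b i)) \<in> range (\<lambda>f. \<Sum>v\<in>range b. A_scale E (f v) v)"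
      by (rule range_eqI[of _ _ "\<lambda>v. a (inv b v)"]) (simp add: reindex that)
  qed
  have indep: "A_module.dependent (range b) \<longleftrightarrow>
      (\<exists>a. (\<Sum>i\<in>UNIV. A_scale E (a i) (b i)) = 0 \<and> (\<exists>i. a i \<noteq> 0))" if "inj b"
  proof
    assume "A_module.dependent (range b)"
    then show "\<exists>a. (\<Sum>i\<in>UNIV. A_scale E (a i) (b i)) = 0 \<and> (\<exists>i. a i \<noteq> 0)"
      using reindex[OF that] by (force simp: A_module.dependent_finite)
  next
    assume "\<exists>a. (\<Sum>i\<in>UNIV. A_scale E (a i) (b i)) = 0 \<and> (\<exists>i. a i \<noteq> 0)"
    then obtain a i where a: "(\<Sum>i\<in>UNIV. A_scale E (a i) (b i)) = 0" "a i \<noteq> 0" by blast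
    have "(\<Sum>v\<in>range b. A_scale E (a (inv b v)) v) = 0"
      using a(1) that by (simp add: reindex)
    moreover have "a (inv b (b i)) \<noteq> 0" using a(2) that by simp
    ultimately show "A_module.dependent (range b)"
      unfolding A_module.dependent_finite[OF finite_imageI[OF finite]]
      by (intro exI[of _ "\<lambda>v. a (inv b v)"]) blast
  qed
  have inj: "inj b" if *: "\<forall>a. (\<Sum>i\<in>UNIV. A_scale E (a i) (b i)) = 0 \<longrightarrow> (\<forall>i. a i = 0)"
  proof (rule injI, rule ccontr)
    fix i j assume ij: "b i = b j" "i \<noteq> j"
    define a :: "'d \<Rightarrow> 'a poly" where "a k = (if k = i then 1 else if k = j then -1 else 0)" for k
    have "(\<Sum>k\<in>UNIV. A_scale E (a k) (b k)) = (\<Sum>k\<in>{i,j}. A_scale E (a k) (b k))"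
      by (rule sum.mono_neutral_right) (auto simp: a_def)
    also have "\<dots> = 0" using ij by (simp add: a_def)
    finally have "a i = 0" using * by blast
    then show False by (simp add: a_def)
  qed
  show ?thesis
  proof (cases "inj b")
    case True
    then show ?thesis
      unfolding is_A_basis_def indep[OF True] span[OF True] by (simp add: eq_commute[of L])
  next
    case False
    then have "\<not> (\<forall>a. (\<Sum>i\<in>UNIV. A_scale E (a i) (b i)) = 0 \<longrightarrow> (\<forall>i. a i = 0))"
      using inj by blast
    then show ?thesis using False unfolding is_A_basis_def by simp
  qed
qed

end

text \<open>By \<open>sum_K_inf_scale_axis\<close> this is the combination of the unit vectors with
  coefficients c under the action of K_inf; the derivative comes from a.v = a v + a' N v.\<close>

definition K_comb :: "'a::field fls ^ 'd ^ 'd \<Rightarrow> 'a fls ^ 'd::finite \<Rightarrow> 'a fls ^ 'd" where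
  "K_comb N c = c + N *v vec_theta_deriv c"

definition K_coord :: "'a::field fls ^ 'd ^ 'd \<Rightarrow> 'a fls ^ 'd::finite \<Rightarrow> 'a fls ^ 'd" where
  "K_coord N v = v - N *v vec_theta_deriv v"

text \<open>The product of \<open>N\<close> and its derivative vanishes in all cases below, because the nonzero
  entries of \<open>N\<close> lie in the first row. It makes \<open>v \<mapsto> v - N v'\<close> the coordinate
  map of the \<open>K\<^sub>\<infinity>\<close>-vector space with respect to the unit vectors.\<close>

locale t_module = nilpotent_part E N
  for E :: "('a::finite_field, 'd::finite) tws" and N +
  assumes N_deriv: "N ** mat_theta_deriv N = 0" and N_val: "mval_ge (-1) N"
    and E_A: "E n $ i $ j \<in> range A_inf"
    and E_finite: "\<exists>d. \<forall>n>d. E n = 0"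
begin

lemma N_A: "N $ i $ j \<in> range A_inf"
proof -
  have "N $ i $ j = E 0 $ i $ j - (if i = j then fls_X_inv else 0)"
    by (simp add: E_0 mat_def)
  then show ?thesis by (auto simp: E_A intro: A_inf_range_closed simp del: image_iff)
qed

lemma N_deriv_vec [simp]: "N *v (mat_theta_deriv N *v v) = 0"
  by (simp add: matrix_vector_mul_assoc N_deriv)

lemma K_coord_comb [simp]: "K_coord N (K_comb N c) = c"
  by (simp add: K_coord_def K_comb_def vec_theta_deriv_add vec_theta_deriv_mult
      matrix_vector_right_distrib)

lemma K_comb_coord [simp]: "K_comb N (K_coord N c) = c"
  by (simp add: K_coord_def K_comb_def vec_theta_deriv_diff vec_theta_deriv_mult
      matrix_vector_mult_diff_distrib matrix_vector_right_distrib)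

lemma K_comb_eq_iff [simp]: "K_comb N c = K_comb N c' \<longleftrightarrow> c = c'"
  by (metis K_coord_comb)

lemma K_comb_add: "K_comb N (c + c') = K_comb N c + K_comb N c'"
  by (simp add: K_comb_def vec_theta_deriv_add matrix_vector_right_distrib)

lemma K_comb_0 [simp]: "K_comb N 0 = 0"
  by (simp add: K_comb_def vec_theta_deriv_def vec_eq_iff matrix_vector_mult_def)

lemma K_comb_sum: "K_comb N (sum f S) = (\<Sum>i\<in>S. K_comb N (f i))"
  by (induction S rule: infinite_finite_induct) (auto simp: K_comb_add)

text \<open>The product rule for the derivative of a c absorbs the term of the action that contains
  the derivative of a, so in coordinates scalars act by plain multiplication.\<close>

lemma K_inf_scale_comb: "K_inf_scale E a (K_comb N c) = K_comb N (a *s c)"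
  by (simp add: K_inf_scale_eq K_comb_def vec_theta_deriv_smult matrix_vector_right_distrib
      matrix_vector_mult_smult vector_add_ldistrib add_ac)

lemma A_scale_comb: "A_scale E a (K_comb N c) = K_comb N (A_inf a *s c)"
  by (simp add: A_scale_def K_inf_scale_comb)

lemma K_comb_axis: "K_comb N (axis i 1) = axis i 1"
proof -
  have "vec_theta_deriv (axis i 1) = (0 :: 'a fls ^ 'd)"
    by (simp add: vec_theta_deriv_def axis_def vec_eq_iff)
  then show ?thesis by (simp add: K_comb_def)
qed

lemma K_coord_axis: "(\<chi> i. K_coord N (axis i 1)) = mat 1"
  using K_coord_comb[of "axis _ 1"] by (simp add: K_comb_axis) (simp add: mat_def axis_def vec_eq_iff)

lemma sum_K_inf_scale_axis: "(\<Sum>j\<in>UNIV. K_inf_scale E (c $ j) (axis j 1)) = K_comb N c"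
proof -
  have "(\<Sum>j\<in>UNIV. K_inf_scale E (c $ j) (axis j 1)) = K_comb N (\<Sum>j\<in>UNIV. c $ j *s axis j 1)"
    by (simp add: K_comb_sum flip: K_inf_scale_comb) (simp add: K_comb_axis)
  then show ?thesis by (simp add: basis_expansion)
qed

lemma sum_A_scale_comb:
  "(\<Sum>j\<in>UNIV. A_scale E (a j) (K_comb N (W $ j))) = K_comb N ((\<chi> j. A_inf (a j)) v* W)"
proof -
  have "(\<Sum>j\<in>UNIV. A_inf (a j) *s W $ j) = (\<chi> j. A_inf (a j)) v* W"
    by (simp add: vector_matrix_mult_def vec_eq_iff)
  then show ?thesis by (simp add: A_scale_comb flip: K_comb_sum)
qed

lemma sum_K_inf_scale_comb:
  "(\<Sum>j\<in>UNIV. K_inf_scale E (a $ j) (K_comb N (W $ j))) = K_comb N (a v* W)"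
proof -
  have "(\<Sum>j\<in>UNIV. a $ j *s W $ j) = a v* W"
    by (simp add: vector_matrix_mult_def vec_eq_iff)
  then show ?thesis by (simp add: K_inf_scale_comb flip: K_comb_sum)
qed

lemma K_coord_A:
  assumes "v \<in> integral_lattice"
  shows "K_coord N v \<in> integral_lattice"
  using assms N_A unfolding integral_lattice_def mem_Collect_eq
  by (auto simp: K_coord_def matrix_vector_mult_def vec_theta_deriv_def
      intro!: A_inf_range_closed A_inf_range_sum simp del: image_iff)

lemma K_comb_A:
  assumes "v \<in> integral_lattice"
  shows "K_comb N v \<in> integral_lattice"
  using assms N_A unfolding integral_lattice_def mem_Collect_eq
  by (auto simp: K_comb_def matrix_vector_mult_def vec_theta_deriv_def
      intro!: A_inf_range_closed A_inf_range_sum simp del: image_iff)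

lemma integral_lattice_eq_range: "integral_lattice = range (\<lambda>a. (\<chi> j. A_inf (a j)) :: 'a fls ^ 'd)"
proof (intro equalityI subsetI)
  fix v :: "'a fls ^ 'd" assume "v \<in> integral_lattice"
  then have "\<forall>i. \<exists>p. v $ i = A_inf p" by (auto simp: integral_lattice_def)
  then obtain a where "\<And>i. v $ i = A_inf (a i)" by metis
  then have "v = (\<chi> j. A_inf (a j))" by (simp add: vec_eq_iff)
  then show "v \<in> range (\<lambda>a. \<chi> j. A_inf (a j))" by blast
qed (auto simp: integral_lattice_def)

text \<open>Since scalars act coordinatewise after \<open>K_coord\<close>, lattices with the twisted
  action become row lattices of ordinary matrices, and determinants become available.\<close>

lemma is_A_basis_coord:
  "is_A_basis E L b \<longleftrightarrow>
     (\<forall>x\<in>integral_lattice. x v* (\<chi> i. K_coord N (b i)) = 0 \<longrightarrow> x = 0) \<and>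
     K_coord N ` L = (\<lambda>x. x v* (\<chi> i. K_coord N (b i))) ` integral_lattice"
proof -
  define W where "W = (\<chi> i. K_coord N (b i))"
  have b: "b i = K_comb N (W $ i)" for i by (simp add: W_def)
  have "(\<forall>a. (\<Sum>i\<in>UNIV. A_scale E (a i) (b i)) = 0 \<longrightarrow> (\<forall>i. a i = 0)) \<longleftrightarrow>
      (\<forall>x\<in>integral_lattice. x v* W = 0 \<longrightarrow> x = 0)"
    unfolding b sum_A_scale_comb integral_lattice_eq_range
    using K_comb_eq_iff[of _ 0] by (simp add: vec_eq_iff)
  moreover have "L = K_comb N ` S \<longleftrightarrow> K_coord N ` L = S" for S
    by (auto simp: image_image)
  moreover have "range (\<lambda>a. \<Sum>i\<in>UNIV. A_scale E (a i) (b i)) =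
      K_comb N ` (\<lambda>x. x v* W) ` integral_lattice"
    unfolding b sum_A_scale_comb integral_lattice_eq_range by (simp add: image_image)
  ultimately show ?thesis
    unfolding is_A_basis_iff W_def[symmetric] by simp
qed

text \<open>The coordinate map and its inverse preserve integrality, because N has entries in A and
  A is stable under d/dtheta.\<close>

lemma is_A_basis_integral_lattice: "is_A_basis E integral_lattice (\<lambda>i. axis i 1)"
proof -
  have "K_coord N ` integral_lattice = integral_lattice"
  proof (intro equalityI subsetI)
    fix v :: "'a fls ^ 'd" assume "v \<in> integral_lattice"
    then show "v \<in> K_coord N ` integral_lattice"
      by (intro image_eqI[of _ _ "K_comb N v"]) (simp_all add: K_comb_A)
  qed (auto simp: K_coord_A)
  then show ?thesis by (simp add: is_A_basis_coord K_coord_axis)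
qed

text \<open>Two \<open>A\<close>-bases of the same lattice differ by a matrix in \<open>GL(A)\<close>, whose determinant is a
  nonzero constant.\<close>

lemma is_A_basis_det:
  assumes "is_A_basis E L b" "is_A_basis E L b'"
  obtains c where "c \<noteq> 0"
    "det (\<chi> i. K_coord N (b' i)) = fls_const c * det (\<chi> i. K_coord N (b i))"
proof -
  have *: "\<exists>G. (\<forall>i. G $ i \<in> integral_lattice) \<and> (\<chi> i. K_coord N (y i)) = G ** (\<chi> i. K_coord N (x i))"
    if "is_A_basis E L x" "is_A_basis E L y" for x y
  proof -
    have "y i \<in> L" for i
    proof -
      have "A_module.span (range y) = L" using that(2) by (simp add: is_A_basis_def)
      then show ?thesis using A_module.span_superset by blast
    qed
    then have "\<forall>i. \<exists>g\<in>integral_lattice. K_coord N (y i) = g v* (\<chi> i. K_coord N (x i))"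
      using that(1) unfolding is_A_basis_coord by blast
    then obtain g where g: "\<And>i. g i \<in> integral_lattice"
        "\<And>i. K_coord N (y i) = g i v* (\<chi> i. K_coord N (x i))"
      by metis
    have "(\<chi> i. K_coord N (y i)) = (\<chi> i. g i) ** (\<chi> i. K_coord N (x i))"
      by (simp only: g(2)) (simp add: vec_eq_iff matrix_matrix_mult_def vector_matrix_mult_def)
    then show ?thesis using g(1) by (intro exI[of _ "\<chi> i. g i"]) simp
  qed
  define W W' where "W = (\<chi> i. K_coord N (b i))" and "W' = (\<chi> i. K_coord N (b' i))"
  obtain G where G: "\<And>i. G $ i \<in> integral_lattice" "W' = G ** W"
    using *[OF assms] by (auto simp: W_def W'_def)
  obtain H where H: "\<And>i. H $ i \<in> integral_lattice" "W = H ** W'"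
    using *[OF assms(2,1)] by (auto simp: W_def W'_def)
  have "H ** G = mat 1"
  proof -
    have row: "(H ** G - mat 1) $ i \<in> integral_lattice" for i
      using G(1) H(1) unfolding integral_lattice_def mem_Collect_eq
      by (auto simp: matrix_matrix_mult_def mat_def intro!: A_inf_range_closed A_inf_range_sum
          simp del: image_iff)
    have "(H ** G - mat 1) ** W = H ** (G ** W) - W"
      using matrix_add_rdistrib[of "H ** G" "- mat 1" W]
      by (simp add: matrix_mul_minus_left matrix_mul_assoc)
    also have "\<dots> = 0" by (simp flip: G(2) H(2))
    finally have "(H ** G - mat 1) $ i v* W = 0" for i
      by (simp add: vec_eq_iff matrix_matrix_mult_def vector_matrix_mult_def)
    then have "(H ** G - mat 1) $ i = 0" for i
      using assms(1) row unfolding is_A_basis_coord W_def by blast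
    then have "H ** G - mat 1 = 0" by (simp add: vec_eq_iff)
    then show ?thesis by simp
  qed
  then have "det H * det G = 1" by (metis det_I det_mul)
  moreover obtain h where "det H = A_inf h"
    using H(1) A_inf_range_det[of H] by (auto simp: integral_lattice_def)
  moreover obtain g where g: "det G = A_inf g"
    using G(1) A_inf_range_det[of G] by (auto simp: integral_lattice_def)
  ultimately have "A_inf g * A_inf h = 1" by (simp add: mult.commute)
  then obtain c where "c \<noteq> 0" "g = [:c:]" by (rule A_inf_unit)
  then show ?thesis using that[of c] G(2) g by (simp add: det_mul W_def W'_def)
qed

text \<open>Another choice of u or w multiplies det V by a nonzero constant
  (\<open>is_A_basis_det\<close>), and two monic elements that differ by a constant factor are
  equal. So the description in \<open>Reg\<close> has exactly one solution.\<close>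

lemma Reg_eqI:
  assumes u: "is_A_basis E (unit_lattice E) u"
    and r: "monic_inf (det (\<chi> i. K_coord N (u i)))"
  shows "Reg E = det (\<chi> i. K_coord N (u i))"
proof -
  define U where "U = (\<chi> i. K_coord N (u i))"
  have U: "u i = K_comb N (U $ i)" for i by (simp add: U_def)
  have U0: "det U \<noteq> 0" using r unfolding monic_inf_def U_def by auto
  show ?thesis
    unfolding Reg_def U_def[symmetric]
  proof (rule the_equality)
    have "u i = (\<Sum>j\<in>UNIV. K_inf_scale E (U $ i $ j) (axis j 1))" for i
      by (simp add: U sum_K_inf_scale_axis)
    then show "\<exists>u w V \<gamma>. is_A_basis E (unit_lattice E) u \<and> is_A_basis E integral_lattice w \<and>
      (\<forall>i. u i = (\<Sum>j\<in>UNIV. K_inf_scale E (V $ i $ j) (w j))) \<and>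
      \<gamma> \<noteq> 0 \<and> det U = fls_const \<gamma> * det V \<and> monic_inf (det U)"
      using u is_A_basis_integral_lattice r
      by (intro exI[of _ u] exI[of _ "\<lambda>i. axis i 1"] exI[of _ U] exI[of _ 1]) (simp add: U_def)
  next
    fix s assume "\<exists>u w V \<gamma>. is_A_basis E (unit_lattice E) u \<and> is_A_basis E integral_lattice w \<and>
      (\<forall>i. u i = (\<Sum>j\<in>UNIV. K_inf_scale E (V $ i $ j) (w j))) \<and>
      \<gamma> \<noteq> 0 \<and> s = fls_const \<gamma> * det V \<and> monic_inf s"
    then obtain u' w V \<gamma> where *: "is_A_basis E (unit_lattice E) u'" "is_A_basis E integral_lattice w"
      "\<And>i. u' i = (\<Sum>j\<in>UNIV. K_inf_scale E (V $ i $ j) (w j))"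
      "\<gamma> \<noteq> 0" "s = fls_const \<gamma> * det V" "monic_inf s" by blast
    define W where "W = (\<chi> i. K_coord N (w i))"
    have W: "w i = K_comb N (W $ i)" for i by (simp add: W_def)
    have "K_coord N (u' i) = V $ i v* W" for i
      unfolding *(3) W sum_K_inf_scale_comb by simp
    then have "(\<chi> i. K_coord N (u' i)) = V ** W"
      by (simp add: vec_eq_iff matrix_matrix_mult_def vector_matrix_mult_def)
    moreover obtain c where c: "c \<noteq> 0" "det (\<chi> i. K_coord N (u' i)) = fls_const c * det U"
      using is_A_basis_det[OF u *(1)] unfolding U_def by blast
    moreover obtain d where d: "d \<noteq> 0" "det W = fls_const d"
      using is_A_basis_det[OF is_A_basis_integral_lattice *(2)] unfolding W_def
      by (auto simp: K_coord_axis)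
    ultimately have "det V * fls_const d = fls_const c * det U" by (simp add: det_mul)
    then have "det V = fls_const (c / d) * det U"
      using d(1) by (simp add: field_simps flip: fls_const_divide_const)
    moreover define e where "e = \<gamma> * (c / d)"
    ultimately have e: "e \<noteq> 0" "s = fls_const e * det U"
      using *(4,5) c(1) d(1) by (simp_all add: mult.assoc[symmetric])
    then have "s $$ fls_subdegree s = e * det U $$ fls_subdegree (det U)"
      using U0 by (simp add: fls_const_nonzero)
    then have "e = 1" using *(6) r by (simp add: monic_inf_def U_def)
    then show "s = det U" using e by simp
  qed
qed

end

text \<open>In the Leibniz expansion every permutation except the identity picks an off-diagonal
  entry, which lies in the maximal ideal, while the other factors have nonnegative
  valuation.\<close>

lemma val_ge_det_minus_1:
  fixes M :: "'a::field fls ^ 'd ^ 'd"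
  assumes "mval_ge 1 (M - mat 1)"
  shows "val_ge 1 (det M - 1)"
proof -
  have diag: "val_ge 1 (M $ i $ i - 1)" and off: "i \<noteq> j \<Longrightarrow> val_ge 1 (M $ i $ j)" for i j
  proof -
    have "val_ge 1 ((M - mat 1) $ i $ j)" for i j using assms by (simp add: mval_ge_def)
    from this[of i i] this[of i j]
    show "val_ge 1 (M $ i $ i - 1)" "i \<noteq> j \<Longrightarrow> val_ge 1 (M $ i $ j)" by (auto simp: mat_def)
  qed
  have M0: "val_ge 0 (M $ i $ j)" for i j
    using val_ge_add[OF val_ge_mono[OF diag[of i], of 0] val_ge_1] val_ge_mono[OF off, of i j 0]
    by (cases "i = j") auto
  have prod0: "val_ge 0 (\<Prod>i\<in>S. M $ i $ p i)" for S p
  proof (induction S rule: infinite_finite_induct)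
    case (insert x F)
    then show ?case using val_ge_mult[OF M0 insert.IH] by simp
  qed auto
  have prod_id: "val_ge 1 ((\<Prod>i\<in>S. M $ i $ i) - 1)" for S
  proof (induction S rule: infinite_finite_induct)
    case (insert x F)
    have eq: "M $ x $ x * (\<Prod>i\<in>F. M $ i $ i) - 1 =
        M $ x $ x * ((\<Prod>i\<in>F. M $ i $ i) - 1) + (M $ x $ x - 1)" by (simp add: algebra_simps)
    show ?case
      unfolding prod.insert[OF insert(1,2)] eq
      using val_ge_mult[OF M0[of x x] insert.IH] by (intro val_ge_add diag) simp
  qed auto
  define t where "t p = of_int (sign p) * (\<Prod>i\<in>UNIV. M $ i $ p i)" for p
  have det: "det M = t id + (\<Sum>p\<in>{p. p permutes UNIV} - {id}. t p)"
    unfolding det_def t_def by (rule sum.remove) (auto simp: permutes_id finite_permutations)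
  have "val_ge 1 (t p)" if p: "p \<noteq> id" for p
  proof -
    obtain i where i: "p i \<noteq> i" using p by (metis eq_id_iff)
    have "val_ge (1 + 0) (M $ i $ p i * (\<Prod>i\<in>UNIV - {i}. M $ i $ p i))"
      using i by (intro val_ge_mult off prod0) auto
    moreover have "(\<Prod>i\<in>UNIV. M $ i $ p i) = M $ i $ p i * (\<Prod>i\<in>UNIV - {i}. M $ i $ p i)"
      by (rule prod.remove) auto
    ultimately have "val_ge (0 + 1) (t p)"
      unfolding t_def by (intro val_ge_mult val_ge_of_int) simp
    then show ?thesis by simp
  qed
  then have rest: "val_ge 1 (\<Sum>p\<in>{p. p permutes UNIV} - {id}. t p)"
    by (intro val_ge_sum) auto
  from val_ge_add[OF prod_id[of UNIV] rest] show ?thesis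
    by (simp add: det t_def algebra_simps)
qed

lemma monic_inf_1_plus: "val_ge 1 (x - 1) \<Longrightarrow> monic_inf x"
proof -
  assume *: "val_ge 1 (x - 1)"
  have "x $$ j = (if j = 0 then 1 else 0)" if "j < 1" for j
    using * that unfolding val_ge_def by (metis eq_iff_diff_eq_0 fls_minus_nth fls_one_nth)
  moreover from this have "fls_subdegree x = 0"
    by (intro fls_subdegree_eqI) auto
  ultimately show ?thesis by (simp add: monic_inf_def)
qed

section \<open>Lattices of logarithms\<close>

text \<open>P is a candidate for Log, given by explicit coefficients. The series behind the definite
  descriptions \<open>Exp_tws\<close> and \<open>Log_tws\<close> are then identified as
  \<open>tws_inv P\<close> and P.\<close>

locale t_module_log = t_module E N
  for E :: "('a::finite_field, 'd::finite) tws" and N +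
  fixes P :: "('a, 'd) tws"
  assumes P_0: "P 0 = mat 1" and P_eq: "tws_mult (tws_const (E 0)) P = tws_mult P E"
    and P_val: "mval_ge (int n) (P n)"
begin

abbreviation C where "C \<equiv> tws_inv P"

lemma C_eq: "tws_mult C (tws_const (E 0)) = tws_mult E C"
proof -
  have "tws_mult (tws_mult C (tws_mult (tws_const (E 0)) P)) C = tws_mult C (tws_const (E 0))"
    by (simp add: tws_mult_assoc tws_inv_mult_right P_0)
  also have "tws_mult C (tws_mult (tws_const (E 0)) P) = E"
    unfolding P_eq by (simp add: tws_inv_mult_left P_0 flip: tws_mult_assoc)
  finally show ?thesis by simp
qed

lemma Exp_eq: "Exp_tws E = C"
  using E_0 N_N C_eq by (intro Exp_tws_eqI) auto

lemma Log_eq: "Log_tws E = P"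
  by (intro Log_tws_eqI) (simp_all add: Exp_eq tws_inv_mult_left tws_inv_mult_right P_0)

lemma C_val: "mval_ge (int n) (C n)"
  by (rule mval_ge_tws_inv) (rule P_val)

definition exp_term :: "'a fls ^ 'd \<Rightarrow> nat \<Rightarrow> 'a fls ^ 'd" where
  "exp_term x n = C n *v frob_vec n x"

lemma exp_term_val: "vval_ge k x \<Longrightarrow> 0 \<le> k \<Longrightarrow> vval_ge (int n + int CARD('a) ^ n * k) (exp_term x n)"
  unfolding exp_term_def by (intro vval_ge_matrix_vector_mult C_val vval_ge_frob_vec)

lemma exp_term_add: "exp_term (x + y) n = exp_term x n + exp_term y n"
  by (simp add: exp_term_def frob_vec_add matrix_vector_right_distrib)

lemma exp_term_const: "exp_term (fls_const c *s x) n = fls_const c *s exp_term x n"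
proof -
  have "frob_vec n (fls_const c *s x) = fls_const c *s frob_vec n x"
    by (simp add: frob_vec_def vec_eq_iff frob_mult)
  then show ?thesis by (simp add: exp_term_def matrix_vector_mult_smult)
qed

lemma exp_term_sums_add:
  "exp_term x sums s \<Longrightarrow> exp_term y sums r \<Longrightarrow> exp_term (x + y) sums (s + r)"
  unfolding sums_def by (simp add: exp_term_add sum.distrib vec_fls_tendsto_add)

text \<open>Applying A tau^i to a series moves its n-th term to index n + i. With zeros as padding,
  the series for different i can be added index by index.\<close>

lemma sums_shift:
  fixes f :: "nat \<Rightarrow> 'a fls ^ 'd"
  assumes "f sums s"
  shows "(\<lambda>n. if i \<le> n then A *v frob_vec i (f (n - i)) else 0) sums (A *v frob_vec i s)"
proof -
  have part: "(\<Sum>n<m. if i \<le> n then A *v frob_vec i (f (n - i)) else 0) =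
      A *v frob_vec i (\<Sum>j<m - i. f j)" for m
    by (induction m) (auto simp: Suc_diff_le frob_vec_add matrix_vector_right_distrib)
  have "filterlim (\<lambda>m. m - i) sequentially sequentially"
    by (rule filterlim_minus_const_nat_at_top)
  from filterlim_compose[OF assms[unfolded sums_def] this]
  have "(\<lambda>m. \<Sum>j<m - i. f j) \<longlonglongrightarrow> s" .
  then show ?thesis
    unfolding sums_def part by (intro tendsto_matrix_vector_mult tendsto_frob_vec)
qed

text \<open>The functional equation \<open>Exp(\<partial>E\<^sub>t x) = E\<^sub>t Exp(x)\<close>, at every point where the series for
  \<open>Exp(x)\<close> converges.\<close>

lemma exp_term_sums_E_0:
  assumes "exp_term x sums s" and d: "\<forall>n>d. E n = 0"
  shows "exp_term (E 0 *v x) sums (\<Sum>i\<le>d. E i *v frob_vec i s)"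
proof -
  have eq: "exp_term (E 0 *v x) n =
      (\<Sum>i\<le>d. if i \<le> n then E i *v frob_vec i (exp_term x (n - i)) else 0)" for n
  proof -
    have "exp_term (E 0 *v x) n = tws_mult C (tws_const (E 0)) n *v frob_vec n x"
      by (simp add: exp_term_def tws_mult_const_right frob_vec_matrix_vector_mult
          matrix_vector_mul_assoc)
    also have "\<dots> = (\<Sum>i\<le>n. E i *v frob_vec i (exp_term x (n - i)))"
      unfolding C_eq
      by (auto simp: tws_mult_def matrix_vector_mult_sum_left exp_term_def frob_vec_frob_vec
          frob_vec_matrix_vector_mult matrix_vector_mul_assoc intro!: sum.cong)
    also have "\<dots> = (\<Sum>i\<in>{..n} \<inter> {..d}. E i *v frob_vec i (exp_term x (n - i)))"
    proof (rule sum.mono_neutral_right)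
      show "\<forall>i\<in>{..n} - {..n} \<inter> {..d}. E i *v frob_vec i (exp_term x (n - i)) = 0"
      proof
        fix i assume "i \<in> {..n} - {..n} \<inter> {..d}"
        then have "i > d" by auto
        then show "E i *v frob_vec i (exp_term x (n - i)) = 0" using d by simp
      qed
    qed auto
    also have "\<dots> = (\<Sum>i\<le>d. if i \<le> n then E i *v frob_vec i (exp_term x (n - i)) else 0)"
      by (subst Int_commute, subst sum.inter_restrict) (auto intro!: sum.cong)
    finally show ?thesis .
  qed
  have "(\<lambda>m. \<Sum>i\<le>d. \<Sum>n<m. if i \<le> n then E i *v frob_vec i (exp_term x (n - i)) else 0)
      \<longlonglongrightarrow> (\<Sum>i\<le>d. E i *v frob_vec i s)"
    using sums_shift[OF assms(1)] by (intro vec_fls_tendsto_sum) (simp add: sums_def)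
  then show ?thesis
    unfolding sums_def eq by (subst sum.swap)
qed

text \<open>Asks for convergence explicitly: convergence of Exp at every point is not yet known, and
  \<open>tws_eval\<close> of a divergent series would be meaningless.\<close>

definition exp_integral :: "'a fls ^ 'd \<Rightarrow> bool" where
  "exp_integral x \<longleftrightarrow> (\<exists>s\<in>integral_lattice. exp_term x sums s)"

lemma exp_integral_0: "exp_integral 0"
proof -
  have "(0 :: 'a fls ^ 'd) \<in> integral_lattice"
    by (simp add: integral_lattice_def A_inf_range_closed del: image_iff)
  moreover have "exp_term 0 = (\<lambda>n. 0)" by (simp add: exp_term_def fun_eq_iff)
  ultimately show ?thesis by (auto simp: exp_integral_def sums_def)
qed

lemma exp_integral_add: "exp_integral x \<Longrightarrow> exp_integral y \<Longrightarrow> exp_integral (x + y)"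
proof -
  assume "exp_integral x" "exp_integral y"
  then obtain s r where *: "s \<in> integral_lattice" "exp_term x sums s"
    "r \<in> integral_lattice" "exp_term y sums r" by (auto simp: exp_integral_def)
  then have "s + r \<in> integral_lattice"
    by (simp add: integral_lattice_def A_inf_range_closed del: image_iff)
  then show ?thesis using exp_term_sums_add[OF *(2,4)] by (auto simp: exp_integral_def)
qed

lemma exp_integral_const:
  assumes "exp_integral x"
  shows "exp_integral (fls_const c *s x)"
proof -
  obtain s where *: "s \<in> integral_lattice" "exp_term x sums s"
    using assms by (auto simp: exp_integral_def)
  then have "fls_const c *s s \<in> integral_lattice"
    by (simp add: integral_lattice_def A_inf_range_closed del: image_iff)
  moreover have "exp_term (fls_const c *s x) sums (fls_const c *s s)"
    using *(2) unfolding sums_vec_iff by (simp add: exp_term_const fls_sums_mult)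
  ultimately show ?thesis by (auto simp: exp_integral_def)
qed

lemma exp_integral_E_0:
  assumes "exp_integral x"
  shows "exp_integral (E 0 *v x)"
proof -
  obtain s where *: "s \<in> integral_lattice" "exp_term x sums s"
    using assms by (auto simp: exp_integral_def)
  obtain d where d: "\<forall>n>d. E n = 0" using E_finite by blast
  have "(\<Sum>i\<le>d. E i *v frob_vec i s) \<in> integral_lattice"
    using *(1) E_A unfolding integral_lattice_def mem_Collect_eq
    by (auto simp: matrix_vector_mult_def frob_vec_def
        intro!: A_inf_range_closed A_inf_range_sum simp del: image_iff)
  then show ?thesis using exp_term_sums_E_0[OF *(2) d] by (auto simp: exp_integral_def)
qed

text \<open>Horner's scheme for a reduces the claim to constants, over which Exp is linear, and to
  the action of theta, which is the functional equation with coefficients in A.\<close>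

lemma exp_integral_A_scale:
  assumes "exp_integral x"
  shows "exp_integral (A_scale E a x)"
proof (induction a)
  case (pCons c p)
  have "A_scale E (pCons c p) x = A_scale E [:c:] x + A_scale E [:0, 1:] (A_scale E p x)"
    by (simp flip: A_module.scale_left_distrib)
  also have "\<dots> = fls_const c *s x + E 0 *v A_scale E p x"
    by (simp add: A_scale_eq E_0_apply)
  finally show ?case
    by (simp add: exp_integral_add exp_integral_const exp_integral_E_0 pCons assms)
qed (simp add: exp_integral_0)

lemma exp_term_summable: "vval_ge 0 x \<Longrightarrow> summable (exp_term x)"
  using exp_term_val[of 0 x] by (intro vec_fls_summable_nat[of 0]) simp

lemma log_sums:
  assumes "vval_ge 0 x"
  shows "(\<lambda>n. P n *v frob_vec n x) sums tws_eval P x"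
proof -
  have "vval_ge (int n + int CARD('a) ^ n * 0) (P n *v frob_vec n x)" for n
    by (intro vval_ge_matrix_vector_mult P_val vval_ge_frob_vec assms)
  then have "summable (\<lambda>n. P n *v frob_vec n x)"
    by (intro vec_fls_summable_nat[of 0]) simp
  then show ?thesis by (simp add: tws_eval_def summable_sums)
qed

lemma vval_ge_sums_tail:
  fixes f :: "nat \<Rightarrow> 'a fls ^ 'd"
  assumes "f sums s" "\<And>n. vval_ge (int n) (f n)"
  shows "vval_ge (int k) (s - (\<Sum>n<k. f n))"
proof -
  have "(\<lambda>n. f (n + k)) sums (s - (\<Sum>n<k. f n))"
  proof -
    have "(\<lambda>m. \<Sum>n<m + k. f n) \<longlonglongrightarrow> s"
      using assms(1) unfolding sums_def by (rule LIMSEQ_ignore_initial_segment)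
    then have "(\<lambda>m. (\<Sum>n<m + k. f n) + (- (\<Sum>n<k. f n))) \<longlonglongrightarrow> s + (- (\<Sum>n<k. f n))"
      by (rule vec_fls_tendsto_add) simp
    moreover have "(\<Sum>n<m + k. f n) + (- (\<Sum>n<k. f n)) = (\<Sum>n<m. f (n + k))" for m
      by (induction m) (simp_all add: algebra_simps)
    ultimately show ?thesis by (simp add: sums_def)
  qed
  then show ?thesis
    by (rule vval_ge_sums) (rule vval_ge_mono[OF assms(2)], simp)
qed

text \<open>The double sum of Exp over Log is cut along the triangle n + m < k. Inside, it is the
  evaluation of the product of \<open>C\<close> and P, which is 1; each remaining tail has valuation
  at least n + (k - n).\<close>

lemma Exp_Log:
  assumes x: "vval_ge 0 x"
  shows "exp_term (tws_eval P x) sums x"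
  unfolding sums_vec_fls_iff
proof
  define L where "L = tws_eval P x"
  define g where "g m = P m *v frob_vec m x" for m
  have g: "vval_ge (int m) (g m)" for m
    using vval_ge_matrix_vector_mult[OF P_val vval_ge_frob_vec[OF x, of m], of m] by (simp add: g_def)
  have L: "g sums L" using log_sums[OF x] unfolding g_def[abs_def] L_def .
  have key: "vval_ge (int k) ((\<Sum>n<k. exp_term L n) - x)" if k: "k > 0" for k
  proof -
    define h where "h n m = C n *v frob_vec n (g m)" for n m
    have "(\<Sum>n<k. exp_term L n) = (\<Sum>n<k. \<Sum>m<k - n. h n m) +
        (\<Sum>n<k. C n *v frob_vec n (L - (\<Sum>m<k - n. g m)))"
    proof -
      have "exp_term L n = (\<Sum>m<k - n. h n m) + C n *v frob_vec n (L - (\<Sum>m<k - n. g m))" for n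
        by (simp add: exp_term_def h_def frob_vec_diff frob_vec_sum
            matrix_vector_mult_diff_distrib matrix_vector_mult_sum_right)
      then show ?thesis by (simp add: sum.distrib)
    qed
    moreover have "(\<Sum>n<k. \<Sum>m<k - n. h n m) = x"
    proof -
      have "(\<Sum>n<k. \<Sum>m<k - n. h n m) = (\<Sum>(n,m)\<in>Sigma {..<k} (\<lambda>n. {..<k - n}). h n m)"
        by (subst sum.Sigma) auto
      also have "Sigma {..<k} (\<lambda>n. {..<k - n}) = {(n, m). n + m < k}" by auto
      also have "(\<Sum>(n,m)\<in>{(n, m). n + m < k}. h n m) = (\<Sum>r<k. \<Sum>n\<le>r. h n (r - n))"
        by (rule sum.triangle_reindex)
      also have "\<dots> = (\<Sum>r<k. tws_mult C P r *v frob_vec r x)"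
        by (auto simp: tws_mult_def matrix_vector_mult_sum_left h_def g_def frob_vec_frob_vec
            frob_vec_matrix_vector_mult matrix_vector_mul_assoc intro!: sum.cong)
      also have "\<dots> = (\<Sum>r<k. if r = 0 then x else 0)"
        unfolding tws_inv_mult_left[of P, OF P_0] by (rule sum.cong) (auto simp: tws_const_def)
      also have "\<dots> = x" using k by simp
      finally show ?thesis .
    qed
    moreover have "vval_ge (int k) (\<Sum>n<k. C n *v frob_vec n (L - (\<Sum>m<k - n. g m)))"
    proof (rule vval_ge_sum)
      fix n assume n: "n \<in> {..<k}"
      have "vval_ge (int n + int (k - n)) (C n *v frob_vec n (L - (\<Sum>m<k - n. g m)))"
        by (intro vval_ge_matrix_vector_mult C_val vval_ge_frob_vec' vval_ge_sums_tail L g) simp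
      then show "vval_ge (int k) (C n *v frob_vec n (L - (\<Sum>m<k - n. g m)))" using n by simp
    qed
    ultimately show ?thesis by simp
  qed
  fix k :: int
  show "\<forall>\<^sub>F n in sequentially. vval_ge k ((\<Sum>i<n. exp_term (tws_eval P x) i) - x)"
  proof (rule eventually_sequentiallyI[of "Suc (nat k)"])
    fix n assume "Suc (nat k) \<le> n"
    then show "vval_ge k ((\<Sum>i<n. exp_term (tws_eval P x) i) - x)"
      using vval_ge_mono[OF key[of n], of k] by (simp add: L_def)
  qed
qed

text \<open>On the maximal ideal \<open>Exp\<close> differs from the identity by terms of higher valuation, so it
  is injective there.\<close>

lemma exp_small_integral:
  assumes y: "vval_ge 1 y" and "exp_integral y"
  shows "y = 0"
proof -
  obtain s where s: "s \<in> integral_lattice" "exp_term y sums s"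
    using assms(2) by (auto simp: exp_integral_def)
  have diff: "vval_ge (k + 1) (s - y)" if k: "vval_ge k y" "k \<ge> 1" for k
  proof -
    have "(\<lambda>n. exp_term y n - (if n = 0 then y else 0)) sums (s - y)"
      unfolding sums_vec_iff
    proof
      fix i
      have "(\<lambda>n. exp_term y n $ i) sums (s $ i)" using s(2) by (simp add: sums_vec_iff)
      moreover have "(\<lambda>n. if n = 0 then y $ i else 0) sums (y $ i)"
        using sums_If_finite[of "\<lambda>n::nat. n = 0" "\<lambda>n. y $ i"] by simp
      ultimately show "(\<lambda>n. (exp_term y n - (if n = 0 then y else 0)) $ i) sums ((s - y) $ i)"
        using fls_sums_diff by (fastforce simp: if_distrib[of "\<lambda>v. v $ i"] cong: if_cong)
    qed
    moreover have "vval_ge (k + 1) (exp_term y n - (if n = 0 then y else 0))" for n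
    proof (cases "n = 0")
      case False
      have "k \<le> int CARD('a) ^ n * k"
        using mult_right_mono[OF card_power_ge_1[where 'a='a, of n], of k] k by simp
      then have "k + 1 \<le> int n + int CARD('a) ^ n * k" using False by linarith
      then show ?thesis using vval_ge_mono[OF exp_term_val[OF k(1)]] False k by simp
    qed (simp add: exp_term_def)
    ultimately show ?thesis by (rule vval_ge_sums)
  qed
  \<comment> \<open>An integral value in the maximal ideal is 0. Then \<open>diff\<close> bounds y
    itself by k + 1 instead of k, and iterating forces y = 0.\<close>
  have "s = 0"
  proof -
    have "vval_ge 1 (s - y + y)"
      by (intro vval_ge_add y vval_ge_mono[OF diff[OF y]]) auto
    then have "val_ge 1 (s $ i)" for i by (simp add: vval_ge_def)
    moreover have "\<exists>p. s $ i = A_inf p" for i using s(1) by (auto simp: integral_lattice_def)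
    ultimately have "s $ i = 0" for i by (metis A_inf_0 A_inf_val_ge_1)
    then show ?thesis by (simp add: vec_eq_iff)
  qed
  then have step: "vval_ge (k + 1) y" if "vval_ge k y" "k \<ge> 1" for k
    using diff[OF that] by simp
  have "vval_ge (int n + 1) y" for n
  proof (induction n)
    case (Suc n)
    then show ?case using step[of "int n + 1"] by (simp add: algebra_simps)
  qed (use y in simp)
  then have "vval_ge k y" for k
    by (rule vval_ge_mono[of "int (nat k) + 1"]) auto
  then show ?thesis by (rule vval_ge_all_imp_0)
qed

definition log_axis :: "'d \<Rightarrow> 'a fls ^ 'd" where
  "log_axis i = tws_eval P (axis i 1)"

definition log_coord :: "'a fls ^ 'd ^ 'd" where
  "log_coord = (\<chi> i. K_coord N (log_axis i))"

lemma vval_ge_axis: "vval_ge 0 (axis i 1 :: 'a fls ^ 'd)"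
  by (simp add: vval_ge_def axis_def)

lemma log_axis_sums: "(\<lambda>n. P n *v axis i 1) sums log_axis i"
  using log_sums[OF vval_ge_axis[of i]] by (simp add: log_axis_def)

lemma log_coord_val: "mval_ge 1 (log_coord - mat 1)"
proof -
  define z where "z i = log_axis i - axis i 1" for i
  have "vval_ge 1 (z i)" for i
  proof -
    have "vval_ge (int n) (P n *v axis i 1)" for n
      using vval_ge_matrix_vector_mult[OF P_val vval_ge_axis, of n] by simp
    from vval_ge_sums_tail[OF log_axis_sums[of i] this, of 1] show ?thesis by (simp add: z_def P_0)
  qed
  then have "vval_ge 1 (K_coord N (z i))" for i
    unfolding K_coord_def
    using vval_ge_matrix_vector_mult[OF N_val vval_ge_vec_theta_deriv[of 1 "z i"]]
    by (intro vval_ge_diff) auto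
  moreover have "K_coord N (z i) = (log_coord - mat 1) $ i" for i
  proof -
    have "K_coord N (z i) = K_coord N (log_axis i) - K_coord N (axis i 1)"
      by (simp add: K_coord_def z_def vec_theta_deriv_diff matrix_vector_mult_diff_distrib)
    also have "K_coord N (axis i 1) = axis i 1"
      by (metis K_comb_axis K_coord_comb)
    finally show ?thesis
      by (simp add: log_coord_def vec_eq_iff axis_def mat_def eq_commute)
  qed
  ultimately show ?thesis by (simp add: mval_ge_def vval_ge_def)
qed

lemma log_coord_monic: "monic_inf (det log_coord)"
  by (intro monic_inf_1_plus val_ge_det_minus_1 log_coord_val)

lemma log_coord_inverse: "\<exists>B. B ** log_coord = mat 1"
proof -
  have "det log_coord \<noteq> 0" using log_coord_monic by (auto simp: monic_inf_def)
  then have "invertible log_coord" by (simp add: invertible_det_nz)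
  then show ?thesis by (auto simp: invertible_def)
qed

lemma exp_integral_log_comb:
  assumes "c \<in> integral_lattice"
  shows "exp_integral (K_comb N (c v* log_coord))"
proof -
  obtain a where a: "c = (\<chi> j. A_inf (a j))"
    using assms by (auto simp: integral_lattice_eq_range)
  have "K_comb N (c v* log_coord) = (\<Sum>j\<in>UNIV. A_scale E (a j) (log_axis j))"
    unfolding a sum_A_scale_comb[symmetric] by (simp add: log_coord_def)
  moreover have "exp_integral (log_axis j)" for j
    unfolding exp_integral_def
  proof
    show "axis j 1 \<in> (integral_lattice :: ('a fls ^ 'd) set)"
      by (auto simp: integral_lattice_def axis_def A_inf_range_closed simp del: image_iff)
    show "exp_term (log_axis j) sums axis j 1"
      unfolding log_axis_def by (rule Exp_Log) (rule vval_ge_axis)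
  qed
  moreover have "exp_integral (\<Sum>j\<in>S. A_scale E (a j) (log_axis j))" for S
    by (induction S rule: infinite_finite_induct)
      (auto intro: exp_integral_0 exp_integral_add exp_integral_A_scale calculation(2))
  ultimately show ?thesis by simp
qed

text \<open>Every vector is a lattice vector plus a vector of positive valuation. So \<open>Exp\<close> converges
  everywhere, and its integral values come from the lattice only.\<close>

lemma log_decomposition:
  obtains c y where "c \<in> integral_lattice" "vval_ge 1 y" "x = K_comb N (c v* log_coord) + y"
proof -
  obtain B where B: "B ** log_coord = mat 1" using log_coord_inverse by blast
  define e where "e = K_coord N x v* B"
  have e: "x = K_comb N (e v* log_coord)"
    by (simp add: e_def vector_matrix_mul_assoc B)
  have "\<forall>i. \<exists>p. val_ge 1 (e $ i - A_inf p)" by (simp add: A_inf_approx)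
  then obtain a where a: "\<And>i. val_ge 1 (e $ i - A_inf (a i))" by metis
  define c where "c = (\<chi> i. A_inf (a i))"
  define f where "f = (e - c) v* log_coord"
  have "vval_ge 0 (row i log_coord)" for i
  proof -
    have "val_ge 0 (log_coord $ i $ j)" for j
      using log_coord_val val_ge_add[OF val_ge_mono[of 1 "(log_coord - mat 1) $ i $ j" 0], of "mat 1 $ i $ j"]
      by (simp add: mval_ge_def mat_def)
    then show ?thesis by (simp add: vval_ge_def row_def)
  qed
  then have "val_ge (1 + 0) ((e - c) $ i * log_coord $ i $ j)" for i j
    using a by (intro val_ge_mult) (auto simp: c_def vval_ge_def row_def)
  then have "vval_ge 1 f"
    by (auto simp: f_def vval_ge_def vector_matrix_mult_def intro!: val_ge_sum)
  then have "vval_ge 1 (K_comb N f)"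
    unfolding K_comb_def using vval_ge_matrix_vector_mult[OF N_val vval_ge_vec_theta_deriv[of 1 f]]
    by (intro vval_ge_add) auto
  moreover have "x = K_comb N (c v* log_coord) + K_comb N f"
    unfolding e f_def K_comb_add[symmetric] by (simp add: vector_matrix_mult_diff_rdistrib algebra_simps)
  moreover have "c \<in> integral_lattice" by (simp add: c_def integral_lattice_def)
  ultimately show ?thesis using that by blast
qed

lemma exp_term_summable_all: "summable (exp_term x)"
proof -
  obtain c y where x: "c \<in> integral_lattice" "vval_ge 1 y" "x = K_comb N (c v* log_coord) + y"
    by (rule log_decomposition)
  have "summable (exp_term (K_comb N (c v* log_coord)))"
    using exp_integral_log_comb[OF x(1)] by (auto simp: exp_integral_def sums_iff)
  moreover have "summable (exp_term y)" using x(2) by (intro exp_term_summable) (rule vval_ge_mono, auto)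
  ultimately show ?thesis
    unfolding x(3) by (meson exp_term_sums_add summable_def)
qed

lemma tws_eval_Exp_sums: "exp_term x sums tws_eval (Exp_tws E) x"
  using exp_term_summable_all[of x] by (simp add: tws_eval_def Exp_eq summable_sums flip: exp_term_def)

lemma unit_lattice_eq: "unit_lattice E = (\<lambda>c. K_comb N (c v* log_coord)) ` integral_lattice"
proof (intro equalityI subsetI)
  fix x assume "x \<in> unit_lattice E"
  then have *: "exp_integral x"
    using tws_eval_Exp_sums[of x] by (auto simp: unit_lattice_def exp_integral_def)
  obtain c y where x: "c \<in> integral_lattice" "vval_ge 1 y" "x = K_comb N (c v* log_coord) + y"
    by (rule log_decomposition)
  have "exp_integral (fls_const (-1) *s K_comb N (c v* log_coord))"
    by (intro exp_integral_const exp_integral_log_comb x)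
  moreover have "x + fls_const (-1) *s K_comb N (c v* log_coord) = y"
    by (simp add: x(3) vec_eq_iff)
  ultimately have "exp_integral y" using exp_integral_add[OF *] by metis
  then have "y = 0" using exp_small_integral x(2) by blast
  then show "x \<in> (\<lambda>c. K_comb N (c v* log_coord)) ` integral_lattice" using x by simp
next
  fix x assume "x \<in> (\<lambda>c. K_comb N (c v* log_coord)) ` integral_lattice"
  then have "exp_integral x" using exp_integral_log_comb by blast
  then obtain s where "s \<in> integral_lattice" "exp_term x sums s" by (auto simp: exp_integral_def)
  then show "x \<in> unit_lattice E"
    using sums_unique2[OF _ tws_eval_Exp_sums, of x s] by (simp add: unit_lattice_def)
qed

lemma is_A_basis_log_axis: "is_A_basis E (unit_lattice E) log_axis"
  unfolding is_A_basis_coord log_coord_def[symmetric]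
proof (intro conjI ballI impI)
  fix x :: "'a fls ^ 'd" assume "x v* log_coord = 0"
  then show "x = 0"
    using log_coord_inverse by (metis matrix_left_right_inverse vector_matrix_mul_assoc
        vector_matrix_mul_rid vector_matrix_mult_0)
qed (simp add: unit_lattice_eq image_image)

theorem Reg_eq: "Reg E = det log_coord"
  using Reg_eqI[OF is_A_basis_log_axis] log_coord_monic by (simp add: log_coord_def)

end

text \<open>A change of variables \<open>Q \<in> GL(A)\<close> with \<open>Q E = F Q\<close> is an isomorphism of all the structures
  that enter the regulator.\<close>

lemma Reg_transport:
  fixes E F :: "('a::finite_field, 'd::finite) tws"
  assumes F: "t_module_log F N P" and E_0: "E 0 = mat fls_X_inv + N'"
    and QR: "Q ** R = mat 1" and RQ: "R ** Q = mat 1"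
    and Q_A: "\<And>i j. Q $ i $ j \<in> range A_inf" and R_A: "\<And>i j. R $ i $ j \<in> range A_inf"
    and eq: "tws_mult (tws_const Q) E = tws_mult F (tws_const Q)"
  shows "Reg E = Reg F"
proof -
  interpret F: t_module_log F N P by (rule F)
  have QE: "Q ** E n = F n ** frob_mat n Q" for n
    using fun_cong[OF eq, of n] by (simp add: tws_mult_const_left tws_mult_const_right)
  have E: "E n = R ** F n ** frob_mat n Q" for n
    using arg_cong[OF QE[of n], of "\<lambda>M. R ** M"] by (simp add: matrix_mul_assoc RQ)
  have RQv: "R *v (Q *v v) = v" and QRv: "Q *v (R *v v) = v" for v
    by (simp_all add: matrix_vector_mul_assoc RQ QR)
  have N': "N' = R ** N ** Q"
  proof -
    have "R ** F 0 ** Q = mat fls_X_inv ** (R ** Q) + R ** N ** Q"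
      by (simp add: F.E_0 matrix_add_ldistrib matrix_add_rdistrib matrix_mul_assoc mat_mult_commute)
    then show ?thesis using E[of 0] E_0 by (simp add: RQ)
  qed
  interpret E: nilpotent_part E N'
  proof
    have "N' ** N' = R ** N ** (Q ** R) ** N ** Q" by (simp add: N' matrix_mul_assoc)
    also have "\<dots> = R ** (N ** N) ** Q" by (simp add: QR flip: matrix_mul_assoc)
    finally show "N' ** N' = 0" by (simp add: F.N_N)
  qed (rule E_0)
  have scale: "Q *v K_inf_scale E c v = K_inf_scale F c (Q *v v)" for c v
    by (simp add: E.K_inf_scale_eq F.K_inf_scale_eq matrix_vector_right_distrib
        matrix_vector_mult_smult N' matrix_mul_assoc QR flip: matrix_vector_mul_assoc)
      (simp add: QRv)
  \<comment> \<open>The conjugate R Exp_F Q of the exponential of F; moving Q to the left past tau^n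
    twists it n times.\<close>
  define D where "D = (\<lambda>n. R ** F.C n ** frob_mat n Q)"
  have "Exp_tws E = D"
  proof (rule Exp_tws_eqI[of E N', OF E_0 E.N_N])
    show "D 0 = mat 1" by (simp add: D_def RQ)
    have "tws_mult D (tws_const (E 0)) n = tws_mult E D n" for n
    proof -
      have "tws_mult D (tws_const (E 0)) n = R ** (F.C n ** frob_mat n (Q ** E 0))"
        by (simp add: tws_mult_const_right D_def frob_mat_mult matrix_mul_assoc)
      also have "\<dots> = R ** (tws_mult F.C (tws_const (F 0)) n) ** frob_mat n Q"
        unfolding QE by (simp add: tws_mult_const_right frob_mat_mult matrix_mul_assoc)
      also have "\<dots> = (\<Sum>i\<le>n. R ** (F i ** frob_mat i (F.C (n - i))) ** frob_mat n Q)"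
        unfolding F.C_eq by (simp add: tws_mult_def matrix_mul_sum_left matrix_mul_sum_right)
      also have "\<dots> = tws_mult E D n"
        unfolding tws_mult_def
      proof (rule sum.cong[OF refl])
        fix i assume i: "i \<in> {..n}"
        have "E i ** frob_mat i (D (n - i)) =
            R ** F i ** (frob_mat i (Q ** R)) ** frob_mat i (F.C (n - i)) ** frob_mat n Q"
          using i by (simp add: E D_def frob_mat_mult frob_mat_frob_mat matrix_mul_assoc)
        then show "R ** (F i ** frob_mat i (F.C (n - i))) ** frob_mat n Q = E i ** frob_mat i (D (n - i))"
          by (simp add: QR matrix_mul_assoc)
      qed
      finally show ?thesis .
    qed
    then show "tws_mult D (tws_const (E 0)) = tws_mult E D" by blast
  qed
  then have Exp: "tws_eval (Exp_tws E) x = R *v tws_eval (Exp_tws F) (Q *v x)" for x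
  proof -
    assume ED: "Exp_tws E = D"
    have "D n *v frob_vec n x = R *v F.exp_term (Q *v x) n" for n
      by (simp add: D_def F.exp_term_def frob_vec_matrix_vector_mult matrix_vector_mul_assoc
          matrix_mul_assoc)
    moreover have "(\<lambda>n. R *v F.exp_term (Q *v x) n) sums (R *v tws_eval (Exp_tws F) (Q *v x))"
      using F.tws_eval_Exp_sums[of "Q *v x"] tendsto_matrix_vector_mult[of _ _ _ R]
      unfolding sums_def by (simp flip: matrix_vector_mult_sum_right)
    ultimately show ?thesis by (simp add: tws_eval_def ED sums_iff)
  qed
  have int: "M *v v \<in> integral_lattice"
    if "\<And>i j. M $ i $ j \<in> range A_inf" "v \<in> integral_lattice" for M :: "'a fls ^ 'd ^ 'd" and v
    using that unfolding integral_lattice_def mem_Collect_eq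
    by (auto simp: matrix_vector_mult_def intro!: A_inf_range_closed A_inf_range_sum simp del: image_iff)
  have int_Q: "Q *v v \<in> integral_lattice \<longleftrightarrow> v \<in> integral_lattice" for v
    using int[of Q v] int[of R "Q *v v"] Q_A R_A by (auto simp: RQv)
  have int_R: "R *v v \<in> integral_lattice \<longleftrightarrow> v \<in> integral_lattice" for v
    using int_Q[of "R *v v"] by (simp add: QRv)
  have unit: "x \<in> unit_lattice E \<longleftrightarrow> Q *v x \<in> unit_lattice F" for x
    by (simp add: unit_lattice_def Exp int_R)
  have sum_Q: "Q *v (\<Sum>i\<in>UNIV. A_scale E (a i) (b i)) = (\<Sum>i\<in>UNIV. A_scale F (a i) (Q *v b i))" for a b
    by (simp add: matrix_vector_mult_sum_right A_scale_def scale)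
  have Q_0: "Q *v v = 0 \<longleftrightarrow> v = 0" for v
    using RQv[of v] by auto
  have basis: "is_A_basis E L b \<longleftrightarrow> is_A_basis F L' (\<lambda>i. Q *v b i)"
    if L: "\<And>x. x \<in> L \<longleftrightarrow> Q *v x \<in> L'" for L L' b
  proof -
    have L': "L' = (*v) Q ` L"
      using L QRv by (auto intro!: image_eqI[of _ _ "R *v _"])
    have "L = X \<longleftrightarrow> (*v) Q ` L = (*v) Q ` X" for X
      by (rule inj_image_eq_iff[symmetric]) (metis RQv injI)
    then show ?thesis
      unfolding E.is_A_basis_iff F.is_A_basis_iff L' sum_Q[symmetric] Q_0
      by (simp add: image_image)
  qed
  have comb: "u = (\<Sum>j\<in>UNIV. K_inf_scale E (c j) (w j)) \<longleftrightarrow>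
      Q *v u = (\<Sum>j\<in>UNIV. K_inf_scale F (c j) (Q *v w j))" for u c w
    by (metis (no_types, lifting) RQv matrix_vector_mult_sum_right scale sum.cong)
  \<comment> \<open>The body of the description in \<open>Reg\<close>. Showing that it has the same
    solutions r for both modules transfers the regulator without a separate uniqueness proof for
    E.\<close>
  define reg where "reg G u w V \<gamma> r \<longleftrightarrow>
      is_A_basis G (unit_lattice G) u \<and> is_A_basis G integral_lattice w \<and>
      (\<forall>i. u i = (\<Sum>j\<in>UNIV. K_inf_scale G (V $ i $ j) (w j))) \<and>
      \<gamma> \<noteq> 0 \<and> r = fls_const \<gamma> * det V \<and> monic_inf r"
    for G :: "('a, 'd) tws" and u w :: "'d \<Rightarrow> 'a fls ^ 'd" and V :: "'a fls ^ 'd ^ 'd" and \<gamma> r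
  have reg: "reg E u w V \<gamma> r \<longleftrightarrow> reg F (\<lambda>i. Q *v u i) (\<lambda>i. Q *v w i) V \<gamma> r" for u w V \<gamma> r
    unfolding reg_def basis[OF unit] basis[OF int_Q[symmetric]] comb by blast
  have "(\<exists>u w V \<gamma>. reg E u w V \<gamma> r) \<longleftrightarrow> (\<exists>u w V \<gamma>. reg F u w V \<gamma> r)" for r
  proof
    assume "\<exists>u w V \<gamma>. reg F u w V \<gamma> r"
    then obtain u w V \<gamma> where "reg F u w V \<gamma> r" by blast
    then have "reg E (\<lambda>i. R *v u i) (\<lambda>i. R *v w i) V \<gamma> r" by (simp add: reg QRv)
    then show "\<exists>u w V \<gamma>. reg E u w V \<gamma> r" by blast
  qed (use reg in blast)
  then show ?thesis by (simp add: Reg_def reg_def)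
qed

section \<open>The coefficients \<open>\<beta>\<^sub>m\<close>\<close>

lemma K_inf_Fract: "b \<noteq> 0 \<Longrightarrow> K_inf (Fract a b) = A_inf a / A_inf b"
  unfolding K_inf_def by (rule fract_map_Fract) (auto simp: A_inf_mult)

lemma K_inf_to_fract [simp]: "K_inf (to_fract a) = A_inf a"
  by (simp add: to_fract_def K_inf_Fract)

lemma K_inf_add: "K_inf (x + y) = K_inf x + K_inf y"
proof -
  obtain a b c d where "x = Fract a b" "b \<noteq> 0" "y = Fract c d" "d \<noteq> 0"
    by (metis Fract_cases)
  then show ?thesis
    by (simp add: K_inf_Fract A_inf_add A_inf_mult add_frac_eq)
qed

lemma K_inf_mult: "K_inf (x * y) = K_inf x * K_inf y"
proof -
  obtain a b c d where "x = Fract a b" "b \<noteq> 0" "y = Fract c d" "d \<noteq> 0"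
    by (metis Fract_cases)
  then show ?thesis by (simp add: K_inf_Fract A_inf_mult)
qed

lemma K_inf_0 [simp]: "K_inf 0 = 0"
  using K_inf_to_fract[of 0] by (simp del: K_inf_to_fract)

lemma K_inf_1 [simp]: "K_inf 1 = 1"
  using K_inf_to_fract[of 1] by (simp del: K_inf_to_fract)

lemma K_inf_minus: "K_inf (- x) = - K_inf x"
  using K_inf_add[of x "- x"] by (simp add: eq_neg_iff_add_eq_0 add.commute)

lemma K_inf_diff: "K_inf (x - y) = K_inf x - K_inf y"
  using K_inf_add[of x "- y"] by (simp add: K_inf_minus)

lemma K_inf_power: "K_inf (x ^ n) = K_inf x ^ n"
  by (induction n) (simp_all add: K_inf_mult)

lemma K_inf_divide: "K_inf (x / y) = K_inf x / K_inf y"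
proof (cases "y = 0")
  case False
  have "K_inf (x / y) * K_inf y = K_inf x" using False by (simp flip: K_inf_mult)
  moreover have "K_inf y * K_inf (1 / y) = 1" using False by (simp flip: K_inf_mult)
  then have "K_inf y \<noteq> 0" by auto
  ultimately show ?thesis by (simp add: field_simps)
qed simp

lemma K_inf_numeral: "K_inf (numeral n) = numeral n"
proof -
  have "K_inf (of_nat k) = of_nat k" for k by (induction k) (simp_all add: K_inf_add)
  from this[of "numeral n"] show ?thesis by simp
qed

lemma K_inf_theta [simp]: "K_inf theta_K = fls_X_inv"
  by (simp add: theta_K_def theta_A_def)

lemma K_inf_const [simp]: "K_inf (const_K c) = fls_const c"
  by (simp add: const_K_def)

lemma theta_K_power_eq_iff: "theta_K ^ m = (theta_K ^ n :: 'a::finite_field K) \<longleftrightarrow> m = n"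
proof
  assume "theta_K ^ m = (theta_K ^ n :: 'a K)"
  then have "K_inf (theta_K ^ m :: 'a K) = K_inf (theta_K ^ n)" by simp
  then have "fls_X_inv ^ m = (fls_X_inv ^ n :: 'a fls)" by (simp only: K_inf_power K_inf_theta)
  then have "fls_subdegree (fls_X_inv ^ m :: 'a fls) = fls_subdegree (fls_X_inv ^ n :: 'a fls)" by simp
  then show "m = n" by simp
qed simp

lemma theta_K_twist_neq: "m > 0 \<Longrightarrow> theta_K - theta_K ^ (CARD('a) ^ m) \<noteq> (0 :: 'a::finite_field K)"
  using theta_K_power_eq_iff[of 1 "CARD('a) ^ m", where 'a='a] one_less_power[OF card_gt_1[where 'a='a], of m]
  by auto

lemma CHAR_fract: "CHAR('b::idom fract) = CHAR('b)"
proof (rule CHAR_eqI)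
  have of_nat: "of_nat n = to_fract (of_nat n :: 'b)" for n by (induction n) simp_all
  show "of_nat CHAR('b) = (0 :: 'b fract)" by (simp add: of_nat)
  show "CHAR('b) dvd n" if "of_nat n = (0 :: 'b fract)" for n
    using that by (simp add: of_nat of_nat_eq_0_iff_char_dvd)
qed

lemma power_card_add_K: "(x + y) ^ CARD('a) = x ^ CARD('a) + y ^ CARD('a)" for x :: "'a::finite_field K"
  by (intro power_card_add) (simp add: CHAR_fract)

lemma power_card_0_K [simp]: "0 ^ CARD('a::finite_field) = (0 :: 'a K)"
  by simp

lemma power_card_minus_K: "(- x) ^ CARD('a) = - (x ^ CARD('a))" for x :: "'a::finite_field K"
  using power_card_add_K[of x "- x"] by (simp add: eq_neg_iff_add_eq_0 add.commute)

lemma power_card_sum_K: "(\<Sum>i\<in>S. f i) ^ CARD('a) = (\<Sum>i\<in>S. f i ^ CARD('a))" for f :: "'b \<Rightarrow> 'a::finite_field K"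
  by (induction S rule: infinite_finite_induct) (simp_all add: power_card_add_K)

lemma const_K_power_card [simp]: "const_K c ^ CARD('a) = const_K (c :: 'a::finite_field)"
proof -
  have "const_K 1 = (1 :: 'a K)" by (simp add: const_K_def flip: one_pCons)
  moreover have "const_K (a * b) = const_K a * const_K b" for a b :: 'a
    by (simp add: const_K_def flip: to_fract_mult)
  ultimately have "const_K c ^ n = const_K (c ^ n)" for n by (induction n) simp_all
  then show ?thesis by (simp add: finite_field_power_card_eq_same)
qed

section \<open>Twisting and differentiating the coefficients of polynomials in t\<close>

abbreviation twist_poly :: "'a::finite_field K poly \<Rightarrow> 'a K poly" where
  "twist_poly \<equiv> map_poly (\<lambda>c. c ^ CARD('a))"

lemma twist_poly_add: "twist_poly (p + q) = twist_poly p + twist_poly q"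
  by (intro poly_eqI) (simp add: coeff_map_poly power_card_add_K)

lemma twist_poly_mult: "twist_poly (p * q) = twist_poly p * twist_poly q"
  by (intro poly_eqI) (simp add: coeff_map_poly coeff_mult power_card_sum_K power_mult_distrib)

lemma twist_poly_smult: "twist_poly (smult c p) = smult (c ^ CARD('a)) (twist_poly p)"
  for p :: "'a::finite_field K poly"
  by (intro poly_eqI) (simp add: coeff_map_poly power_mult_distrib)

lemma twist_poly_eq_0: "twist_poly p = 0 \<longleftrightarrow> p = (0 :: 'a::finite_field K poly)"
  by (rule map_poly_eq_0_iff) auto

lemma twist_Kt_Fract: "d \<noteq> 0 \<Longrightarrow> twist_Kt 1 (Fract p d) = Fract (twist_poly p) (twist_poly d)"
  for p :: "'a::finite_field K poly"
  unfolding twist_Kt_def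
  by (subst fract_map_Fract) (auto simp: twist_poly_mult twist_poly_eq_0 Fract_conv_to_fract)

abbreviation deriv_K :: "'a::finite_field K \<Rightarrow> 'a K" where
  "deriv_K \<equiv> fract_deriv pderiv"

lemma deriv_K_Fract: "b \<noteq> 0 \<Longrightarrow> deriv_K (Fract a b) = Fract (pderiv a * b - a * pderiv b) (b\<^sup>2)"
  by (rule fract_deriv_Fract) (simp_all add: pderiv_mult algebra_simps)

lemma deriv_K_to_fract: "deriv_K (to_fract a) = to_fract (pderiv a)"
  by (simp add: to_fract_def deriv_K_Fract)

lemma deriv_K_add: "deriv_K (x + y) = deriv_K x + deriv_K y"
proof -
  obtain a b c d where "x = Fract a b" "b \<noteq> 0" "y = Fract c d" "d \<noteq> 0"
    by (metis Fract_cases)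
  then show ?thesis
    by (simp add: deriv_K_Fract eq_fract pderiv_add pderiv_mult) (simp add: power2_eq_square algebra_simps)
qed

lemma deriv_K_mult: "deriv_K (x * y) = deriv_K x * y + x * deriv_K y"
proof -
  obtain a b c d where "x = Fract a b" "b \<noteq> 0" "y = Fract c d" "d \<noteq> 0"
    by (metis Fract_cases)
  then show ?thesis
    by (simp add: deriv_K_Fract eq_fract pderiv_mult) (simp add: power2_eq_square algebra_simps)
qed

lemma deriv_K_0 [simp]: "deriv_K 0 = 0"
  using deriv_K_to_fract[of 0] by simp

lemma deriv_K_1 [simp]: "deriv_K 1 = 0"
  using deriv_K_to_fract[of 1] by (simp add: pderiv_1)

lemma deriv_K_const [simp]: "deriv_K (const_K c) = 0"
  by (simp add: const_K_def deriv_K_to_fract)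

lemma deriv_K_minus: "deriv_K (- x) = - deriv_K x"
  using deriv_K_add[of x "- x"] by (simp add: eq_neg_iff_add_eq_0 add.commute)

lemma deriv_K_power: "deriv_K (x ^ n) = of_nat n * x ^ (n - 1) * deriv_K x"
proof (induction n)
  case (Suc n)
  then show ?case by (cases n) (simp_all add: deriv_K_mult algebra_simps)
qed simp

lemma deriv_K_twist: "m > 0 \<Longrightarrow> deriv_K (x ^ (CARD('a) ^ m)) = 0" for x :: "'a::finite_field K"
proof -
  assume "m > 0"
  then have "of_nat (CARD('a) ^ m) = (0 :: 'a)"
    by (simp add: finite_field_of_nat_card)
  then have "of_nat (CARD('a) ^ m) = (0 :: 'a K)"
    by (simp add: of_nat_eq_0_iff_char_dvd CHAR_fract del: of_nat_power)
  then show ?thesis by (simp add: deriv_K_power del: of_nat_power)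
qed

lemma deriv_K_sum: "deriv_K (\<Sum>i\<in>S. f i) = (\<Sum>i\<in>S. deriv_K (f i))"
  by (induction S rule: infinite_finite_induct) (simp_all add: deriv_K_add)

abbreviation deriv_poly :: "'a::finite_field K poly \<Rightarrow> 'a K poly" where
  "deriv_poly \<equiv> map_poly deriv_K"

lemma deriv_poly_add: "deriv_poly (p + q) = deriv_poly p + deriv_poly q"
  by (intro poly_eqI) (simp add: coeff_map_poly deriv_K_add)

lemma deriv_poly_mult: "deriv_poly (p * q) = deriv_poly p * q + p * deriv_poly q"
  by (intro poly_eqI) (simp add: coeff_map_poly coeff_mult deriv_K_sum deriv_K_mult sum.distrib)

lemma deriv_poly_smult: "deriv_K c = 0 \<Longrightarrow> deriv_poly (smult c p) = smult c (deriv_poly p)"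
  by (intro poly_eqI) (simp add: coeff_map_poly deriv_K_mult)

lemma d_theta_Fract:
  "d \<noteq> 0 \<Longrightarrow> d_theta (Fract p d) = Fract (deriv_poly p * d - p * deriv_poly d) (d\<^sup>2)"
  unfolding d_theta_def by (rule fract_deriv_Fract) (simp_all add: deriv_poly_mult)

text \<open>Numerators of \<open>B_ser\<close> over the denominators \<open>B_den\<close>, possibly
  with common factors. Fixed representatives let evaluation, twist and derivative be computed by the
  \<open>Fract\<close> rules. The linear factor in the last clause brings the second summand to the
  denominator of the first.\<close>

fun B_num :: "'a::finite_field poly \<Rightarrow> 'a \<Rightarrow> nat \<Rightarrow> 'a K poly" where
  "B_num \<kappa>1 \<kappa>2 0 = 1"
| "B_num \<kappa>1 \<kappa>2 (Suc 0) = [:to_fract \<kappa>1:]"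
| "B_num \<kappa>1 \<kappa>2 (Suc (Suc m)) =
     smult (to_fract \<kappa>1 ^ (CARD('a) ^ Suc m)) (B_num \<kappa>1 \<kappa>2 (Suc m)) +
     smult (const_K \<kappa>2) ([:- (theta_K ^ (CARD('a) ^ Suc m)), 1:] * B_num \<kappa>1 \<kappa>2 m)"

fun B_den :: "nat \<Rightarrow> 'a::finite_field K poly" where
  "B_den 0 = 1"
| "B_den (Suc m) = [:- (theta_K ^ (CARD('a) ^ Suc m)), 1:] * B_den m"

lemma B_den_neq_0 [simp]: "B_den m \<noteq> 0"
  by (induction m) (simp_all del: mult_pCons_left)

lemma B_ser_eq_Fract: "B_ser \<kappa>1 \<kappa>2 (int m) = Fract (B_num \<kappa>1 \<kappa>2 m) (B_den m)"
proof (induction m rule: less_induct)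
  case (less m)
  have t: "t_Kt - K_to_Kt c = to_fract [:- c, 1:]" for c :: "'a K"
    by (simp add: t_Kt_def K_to_Kt_def flip: to_fract_diff)
  consider "m = 0" | "m = Suc 0" | k where "m = Suc (Suc k)" by (metis old.nat.exhaust)
  then show ?case
  proof cases
    case 1
    then show ?thesis by (simp add: B_ser.simps[of _ _ 0] One_fract_def)
  next
    case 2
    have "B_ser \<kappa>1 \<kappa>2 (- 1) = 0" "B_ser \<kappa>1 \<kappa>2 0 = 1"
      by (simp_all add: B_ser.simps[of _ _ "-1"] B_ser.simps[of _ _ 0])
    then show ?thesis
      using 2 by (simp add: B_ser.simps[of _ _ 1] t) (simp add: K_to_Kt_def Fract_conv_to_fract)
  next
    case 3
    have IH: "B_ser \<kappa>1 \<kappa>2 (int m - 1) = Fract (B_num \<kappa>1 \<kappa>2 (Suc k)) (B_den (Suc k))"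
      "B_ser \<kappa>1 \<kappa>2 (int m - 2) = Fract (B_num \<kappa>1 \<kappa>2 k) (B_den k)"
      using less[of "Suc k"] less[of k] 3 by (simp_all del: B_num.simps B_den.simps)
    have nat: "nat (int m - 1) = Suc k" "nat (int m) = Suc (Suc k)" using 3 by auto
    define d where "d = (B_den k :: 'a K poly)"
    define p where "p = [:- (theta_K ^ (CARD('a) ^ Suc k)), 1 :: 'a K:]"
    define p' where "p' = [:- (theta_K ^ (CARD('a) ^ Suc (Suc k))), 1 :: 'a K:]"
    have nz: "d \<noteq> 0" "p \<noteq> 0" "p' \<noteq> 0" by (simp_all add: d_def p_def p'_def)
    have "B_ser \<kappa>1 \<kappa>2 (int m) =
        (K_to_Kt (to_fract \<kappa>1 ^ (CARD('a) ^ nat (int m - 1))) * B_ser \<kappa>1 \<kappa>2 (int m - 1) +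
         K_to_Kt (const_K \<kappa>2) * B_ser \<kappa>1 \<kappa>2 (int m - 2)) /
        (t_Kt - K_to_Kt (theta_K ^ (CARD('a) ^ nat (int m))))"
      using 3 by (subst B_ser.simps) auto
    also have "\<dots> =
        (to_fract [:to_fract \<kappa>1 ^ (CARD('a) ^ Suc k):] * Fract (B_num \<kappa>1 \<kappa>2 (Suc k)) (p * d) +
         to_fract [:const_K \<kappa>2:] * Fract (B_num \<kappa>1 \<kappa>2 k) d) / to_fract p'"
      unfolding IH nat t by (simp only: K_to_Kt_def d_def p_def p'_def B_den.simps)
    also have "\<dots> = Fract (smult (to_fract \<kappa>1 ^ (CARD('a) ^ Suc k)) (B_num \<kappa>1 \<kappa>2 (Suc k)) +
        smult (const_K \<kappa>2) (p * B_num \<kappa>1 \<kappa>2 k)) (p' * (p * d))"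
      using nz by (simp add: Fract_conv_to_fract field_simps flip: to_fract_mult to_fract_add)
    finally show ?thesis by (simp only: 3 d_def p_def p'_def B_num.simps B_den.simps)
  qed
qed

lemma poly_B_den: "poly (B_den m) (theta_K :: 'a::finite_field K) \<noteq> 0"
  using theta_K_twist_neq[of "Suc _", where 'a='a] by (induction m) auto

lemma twist_poly_theta:
  "twist_poly [:- (theta_K ^ (CARD('a) ^ Suc m)), 1 :: 'a::finite_field K:] =
     [:- (theta_K ^ (CARD('a) ^ Suc (Suc m))), 1:]"
  by (simp add: map_poly_pCons power_card_minus_K mult.commute flip: power_mult)

lemma poly_theta_shift: "poly [:- c, 1:] x = x - (c :: 'b::comm_ring_1)"
  by simp

lemma poly_twist_B_den: "poly (twist_poly (B_den m)) (theta_K :: 'a::finite_field K) \<noteq> 0"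
proof (induction m)
  case (Suc m)
  then show ?case
    unfolding B_den.simps twist_poly_mult twist_poly_theta poly_mult poly_theta_shift
    using theta_K_twist_neq[of "Suc (Suc m)", where 'a='a] by simp
qed simp

text \<open>The denominators contain theta only through q-th powers, so the derivative of a quotient
  reduces to that of its numerator.\<close>

lemma deriv_B_den: "deriv_poly (B_den m) = 0"
proof (induction m)
  case (Suc m)
  have "deriv_poly [:- (theta_K ^ (CARD('a) ^ Suc m)), 1 :: 'a K:] = 0"
    by (simp add: map_poly_pCons deriv_K_minus deriv_K_twist del: power_Suc)
  then show ?case using Suc by (simp add: deriv_poly_mult del: power_Suc mult_pCons_left)
qed (simp add: map_poly_1)

lemma beta_eq: "beta \<kappa>1 \<kappa>2 (int m) = poly (B_num \<kappa>1 \<kappa>2 m) theta_K / poly (B_den m) theta_K"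
  by (simp add: beta_def B_ser_eq_Fract fract_eval_Fract poly_B_den)

lemma beta_tilde_eq: "beta_tilde \<kappa>1 \<kappa>2 (int m) =
    poly (twist_poly (B_num \<kappa>1 \<kappa>2 m)) theta_K / poly (twist_poly (B_den m)) theta_K"
  by (simp only: beta_tilde_def B_ser_eq_Fract twist_Kt_Fract[OF B_den_neq_0]
      fract_eval_Fract[OF poly_twist_B_den])

lemma beta_hat_eq: "beta_hat \<kappa>1 \<kappa>2 (int m) =
    poly (deriv_poly (B_num \<kappa>1 \<kappa>2 m)) theta_K / poly (B_den m) theta_K"
  unfolding beta_hat_def B_ser_eq_Fract d_theta_Fract[OF B_den_neq_0]
  by (subst fract_eval_Fract) (simp_all add: poly_B_den deriv_B_den power2_eq_square)

lemma B_ser_neg: "m < 0 \<Longrightarrow> B_ser \<kappa>1 \<kappa>2 m = Fract 0 1"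
  by (subst B_ser.simps) (simp add: Zero_fract_def)

lemma beta_neg: "m < 0 \<Longrightarrow> beta \<kappa>1 \<kappa>2 m = 0"
  unfolding beta_def by (simp only: B_ser_neg, subst fract_eval_Fract) simp_all

lemma beta_tilde_neg: "m < 0 \<Longrightarrow> beta_tilde \<kappa>1 \<kappa>2 m = 0"
  unfolding beta_tilde_def
  by (simp only: B_ser_neg twist_Kt_Fract one_neq_zero not_False_eq_True, subst fract_eval_Fract) simp_all

text \<open>The common shape of the recursions below: \<open>e\<^sub>1\<close> and \<open>e\<^sub>2\<close> are the last two factors of the
  denominator.\<close>

lemma quotient_rec:
  fixes n0 :: "'b::field"
  assumes "d \<noteq> 0" "e1 \<noteq> 0" "e2 \<noteq> 0"
  shows "e2 * ((a * n1 + k * (e1 * n0)) / (e2 * (e1 * d))) = a * (n1 / (e1 * d)) + k * (n0 / d)"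
  using assms by (simp add: field_simps)

lemma beta_0: "beta \<kappa>1 \<kappa>2 0 = 1"
  using beta_eq[of \<kappa>1 \<kappa>2 0] by simp

lemma beta_1: "(theta_K - theta_K ^ CARD('a)) * beta \<kappa>1 \<kappa>2 1 = to_fract (\<kappa>1 :: 'a::finite_field poly)"
  using beta_eq[of \<kappa>1 \<kappa>2 1] theta_K_twist_neq[of 1, where 'a='a] by simp

lemma beta_rec:
  "(theta_K - theta_K ^ (CARD('a) ^ Suc (Suc m))) * beta \<kappa>1 \<kappa>2 (int m + 2) =
     to_fract (\<kappa>1 :: 'a::finite_field poly) ^ (CARD('a) ^ Suc m) * beta \<kappa>1 \<kappa>2 (int m + 1) +
     const_K \<kappa>2 * beta \<kappa>1 \<kappa>2 (int m)"
proof -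
  have "int m + 2 = int (Suc (Suc m))" "int m + 1 = int (Suc m)" by auto
  then show ?thesis
    by (simp only: beta_eq B_num.simps B_den.simps poly_add poly_smult poly_mult poly_theta_shift)
      (intro quotient_rec poly_B_den theta_K_twist_neq zero_less_Suc)
qed

lemma beta_tilde_0: "beta_tilde \<kappa>1 \<kappa>2 0 = 1"
  using beta_tilde_eq[of \<kappa>1 \<kappa>2 0] by simp

lemma beta_tilde_1:
  "(theta_K - theta_K ^ (CARD('a) ^ 2)) * beta_tilde \<kappa>1 \<kappa>2 1 = to_fract (\<kappa>1 :: 'a::finite_field poly) ^ CARD('a)"
  using beta_tilde_eq[of \<kappa>1 \<kappa>2 1] theta_K_twist_neq[of 2, where 'a='a] twist_poly_theta[of 0, where 'a='a]
  by (simp add: map_poly_pCons power2_eq_square)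

lemma beta_tilde_rec:
  "(theta_K - theta_K ^ (CARD('a) ^ Suc (Suc (Suc m)))) * beta_tilde \<kappa>1 \<kappa>2 (int m + 2) =
     to_fract (\<kappa>1 :: 'a::finite_field poly) ^ (CARD('a) ^ Suc (Suc m)) * beta_tilde \<kappa>1 \<kappa>2 (int m + 1) +
     const_K \<kappa>2 * beta_tilde \<kappa>1 \<kappa>2 (int m)"
proof -
  have "int m + 2 = int (Suc (Suc m))" "int m + 1 = int (Suc m)" by auto
  moreover have "(to_fract \<kappa>1 ^ (CARD('a) ^ Suc m)) ^ CARD('a) = to_fract \<kappa>1 ^ (CARD('a) ^ Suc (Suc m))"
    by (simp add: mult.commute flip: power_mult)
  ultimately show ?thesis
    by (simp only: beta_tilde_eq B_num.simps B_den.simps twist_poly_add twist_poly_smult twist_poly_mult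
        twist_poly_theta const_K_power_card poly_add poly_smult poly_mult poly_theta_shift)
      (intro quotient_rec poly_twist_B_den theta_K_twist_neq zero_less_Suc)
qed

text \<open>Only \<open>\<B>\<^sub>1\<close> depends on \<open>\<kappa>\<^sub>1\<close> through an untwisted coefficient, and \<open>q\<close>-th powers are
  constants for \<open>\<partial>\<^sub>\<theta>\<close>; so \<open>\<partial>\<^sub>\<theta>\<B>\<^sub>m\<close> is a multiple of \<open>\<B>\<^sub>m\<^sub>-\<^sub>1\<^sup>(\<^sup>1\<^sup>)\<close>.\<close>

lemma beta_hat_eq_beta_tilde:
  "(theta_K - theta_K ^ CARD('a)) * beta_hat \<kappa>1 \<kappa>2 (int m) =
     to_fract (pderiv \<kappa>1) * beta_tilde \<kappa>1 \<kappa>2 (int m - 1)" for \<kappa>1 :: "'a::finite_field poly"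
proof -
  let ?c = "theta_K - theta_K ^ CARD('a) :: 'a K"
  have c: "?c \<noteq> 0" using theta_K_twist_neq[of 1, where 'a='a] by simp
  have h0: "beta_hat \<kappa>1 \<kappa>2 0 = 0" using beta_hat_eq[of \<kappa>1 \<kappa>2 0] by (simp add: map_poly_1)
  have h1: "?c * beta_hat \<kappa>1 \<kappa>2 1 = to_fract (pderiv \<kappa>1)"
    using beta_hat_eq[of \<kappa>1 \<kappa>2 1] c by (simp add: map_poly_pCons deriv_K_to_fract)
  have rec: "(theta_K - theta_K ^ (CARD('a) ^ Suc (Suc m))) * beta_hat \<kappa>1 \<kappa>2 (int m + 2) =
     to_fract \<kappa>1 ^ (CARD('a) ^ Suc m) * beta_hat \<kappa>1 \<kappa>2 (int m + 1) + const_K \<kappa>2 * beta_hat \<kappa>1 \<kappa>2 (int m)" for m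
  proof -
    have "int m + 2 = int (Suc (Suc m))" "int m + 1 = int (Suc m)" by auto
    moreover have "deriv_poly (B_num \<kappa>1 \<kappa>2 (Suc (Suc m))) =
        smult (to_fract \<kappa>1 ^ (CARD('a) ^ Suc m)) (deriv_poly (B_num \<kappa>1 \<kappa>2 (Suc m))) +
        smult (const_K \<kappa>2) ([:- (theta_K ^ (CARD('a) ^ Suc m)), 1:] * deriv_poly (B_num \<kappa>1 \<kappa>2 m))"
    proof -
      have "deriv_poly [:- (theta_K ^ (CARD('a) ^ Suc m)), 1 :: 'a K:] = 0"
        by (simp add: map_poly_pCons deriv_K_minus deriv_K_twist del: power_Suc)
      then show ?thesis
        by (simp only: B_num.simps deriv_poly_add deriv_poly_smult[OF deriv_K_twist[of "Suc m", OF zero_less_Suc]]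
            deriv_poly_smult[OF deriv_K_const] deriv_poly_mult) simp
    qed
    ultimately show ?thesis
      by (simp only: beta_hat_eq B_den.simps poly_add poly_smult poly_mult poly_theta_shift)
        (intro quotient_rec poly_B_den theta_K_twist_neq zero_less_Suc)
  qed
  show ?thesis
  proof (induction m rule: less_induct)
    case (less m)
    \<comment> \<open>The recursion of \<open>beta_tilde\<close> starts at index 2, which
      corresponds to m = 3 here; the smaller cases come from its initial values.\<close>
    consider "m = 0" | "m = 1" | "m = 2" | k where "m = Suc (Suc (Suc k))"
      by (metis One_nat_def Suc_1 old.nat.exhaust)
    then show ?case
    proof cases
      case 1
      then show ?thesis by (simp add: h0 beta_tilde_neg)
    next
      case 2
      then show ?thesis using h1 by (simp add: beta_tilde_0)
    next
      case 3
      let ?d = "theta_K - theta_K ^ (CARD('a) ^ 2) :: 'a K"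
      have "?d * beta_hat \<kappa>1 \<kappa>2 2 = to_fract \<kappa>1 ^ CARD('a) * beta_hat \<kappa>1 \<kappa>2 1"
        using rec[of 0] h0 by (simp add: power2_eq_square)
      then have "?d * (?c * beta_hat \<kappa>1 \<kappa>2 2) = to_fract \<kappa>1 ^ CARD('a) * to_fract (pderiv \<kappa>1)"
        unfolding h1[symmetric] by (simp only: mult.left_commute[of ?c] mult.left_commute[of ?d ?c])
      also have "\<dots> = ?d * (to_fract (pderiv \<kappa>1) * beta_tilde \<kappa>1 \<kappa>2 1)"
        unfolding beta_tilde_1[of \<kappa>1 \<kappa>2, symmetric] by (simp only: mult_ac)
      finally show ?thesis using 3 theta_K_twist_neq[of 2, where 'a='a] by simp
    next
      case 4
      let ?d = "theta_K - theta_K ^ (CARD('a) ^ Suc (Suc (Suc k))) :: 'a K"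
      have IH: "?c * beta_hat \<kappa>1 \<kappa>2 (int k + 2) = to_fract (pderiv \<kappa>1) * beta_tilde \<kappa>1 \<kappa>2 (int k + 1)"
        "?c * beta_hat \<kappa>1 \<kappa>2 (int k + 1) = to_fract (pderiv \<kappa>1) * beta_tilde \<kappa>1 \<kappa>2 (int k)"
        using less[of "Suc (Suc k)"] less[of "Suc k"] 4 by (simp_all add: add.commute)
      have "?d * (?c * beta_hat \<kappa>1 \<kappa>2 (int k + 3)) =
          to_fract \<kappa>1 ^ (CARD('a) ^ Suc (Suc k)) * (?c * beta_hat \<kappa>1 \<kappa>2 (int k + 2)) +
          const_K \<kappa>2 * (?c * beta_hat \<kappa>1 \<kappa>2 (int k + 1))"
        using arg_cong[OF rec[of "Suc k"], of "\<lambda>x. ?c * x"] by (simp add: algebra_simps del: power_Suc)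
      also have "\<dots> = ?d * (to_fract (pderiv \<kappa>1) * beta_tilde \<kappa>1 \<kappa>2 (int k + 2))"
        unfolding IH using arg_cong[OF beta_tilde_rec[of k \<kappa>1 \<kappa>2], of "\<lambda>x. to_fract (pderiv \<kappa>1) * x"]
        by (simp add: algebra_simps del: power_Suc)
      finally show ?thesis using 4 theta_K_twist_neq[of "Suc (Suc (Suc k))", where 'a='a]
        by (simp add: add.commute del: power_Suc)
    qed
  qed
qed

section \<open>The recursion in \<open>K\<^sub>\<infinity>\<close> and the exterior square\<close>

lemma fls_sums_Suc: "f sums s \<Longrightarrow> (\<lambda>n. f (Suc n)) sums (s - f 0)" for s :: "'a::field fls"
  unfolding sums_fls_iff
proof
  fix k assume "\<forall>k. \<forall>\<^sub>F n in sequentially. val_ge k (sum f {..<n} - s)"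
  then have "\<forall>\<^sub>F n in sequentially. val_ge k (sum f {..<n} - s)" by blast
  then have ev: "\<forall>\<^sub>F n in sequentially. val_ge k (sum f {..<Suc n} - s)"
    by (subst eventually_sequentially_Suc)
  have eq: "(\<Sum>i<n. f (Suc i)) - (s - f 0) = sum f {..<Suc n} - s" for n
    by (simp only: sum.lessThan_Suc_shift) simp
  show "\<forall>\<^sub>F n in sequentially. val_ge k ((\<Sum>n<n. f (Suc n)) - (s - f 0))"
    unfolding eq by (rule ev)
qed

definition gap :: "nat \<Rightarrow> 'a::finite_field fls" where
  "gap n = fls_X_inv - frob n fls_X_inv"

lemma gap_0 [simp]: "gap 0 = 0"
  by (simp add: gap_def)

lemma gap_neq_0: "n > 0 \<Longrightarrow> gap n \<noteq> (0 :: 'a::finite_field fls)"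
  using theta_power_diff_neq_0[of n, where 'a='a] unfolding gap_def by (metis right_minus_eq)

lemma K_inf_gap: "K_inf (theta_K - theta_K ^ (CARD('a) ^ n)) = (gap n :: 'a::finite_field fls)"
  by (simp add: K_inf_diff K_inf_power gap_def frob_def)

lemma theta_deriv_gap: "n > 0 \<Longrightarrow> theta_deriv (gap n) = 1"
  by (simp add: gap_def theta_deriv_diff theta_deriv_frob)

lemma val_ge_gap: "val_ge (- (int CARD('a) ^ n)) (gap n :: 'a::finite_field fls)"
  unfolding gap_def
proof (rule val_ge_diff)
  show "val_ge (- (int CARD('a) ^ n)) (fls_X_inv :: 'a fls)"
    using card_power_ge_1[of n, where 'a='a] by (intro val_ge_mono[OF val_ge_X_inv]) simp
  show "val_ge (- (int CARD('a) ^ n)) (frob n (fls_X_inv :: 'a fls))"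
    using val_ge_frob[OF val_ge_X_inv, of n, where 'a='a] by simp
qed

lemma fls_subdegree_gap:
  assumes "n > 0"
  shows "fls_subdegree (gap n :: 'a::finite_field fls) = - (int CARD('a) ^ n)"
proof -
  have "1 < int CARD('a) ^ n" using assms card_gt_1[where 'a='a] by (intro one_less_power) auto
  then have "gap n $$ (- (int CARD('a) ^ n)) \<noteq> (0 :: 'a)"
    by (auto simp: gap_def frob_def)
  moreover have "gap n \<noteq> (0 :: 'a fls)" using assms by (rule gap_neq_0)
  ultimately show ?thesis
    using val_ge_gap[of n, where 'a='a] by (auto simp: val_ge_iff intro: order.antisym fls_subdegree_leI)
qed

text \<open>Each step of a recursion divides by some \<open>gap n\<close>; the q^n gained here is
  the source of the decay of all coefficients.\<close>

lemma val_ge_gap_mult_iff: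
  assumes "n > 0"
  shows "val_ge k (gap n * x) \<longleftrightarrow> val_ge (k + int CARD('a) ^ n) (x :: 'a::finite_field fls)"
  using gap_neq_0[OF assms, where 'a='a] by (cases "x = 0") (auto simp: val_ge_iff fls_subdegree_gap[OF assms])

lemma le_card_power: "int n \<le> int CARD('a::finite_field) ^ n - 1"
proof (induction n)
  case (Suc n)
  have "int CARD('a) ^ n * 2 \<le> int CARD('a) ^ n * int CARD('a)"
    using card_gt_1[where 'a='a] by (intro mult_left_mono) auto
  moreover have "int CARD('a) ^ Suc n = int CARD('a) ^ n * int CARD('a)" by simp
  ultimately show ?case using Suc by linarith
qed simp

locale rank2 =
  fixes \<kappa>1 :: "'a::finite_field poly" and \<kappa>2 :: 'a
  assumes \<kappa>2: "\<kappa>2 \<noteq> 0"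
begin

abbreviation k1 :: "'a fls" where "k1 \<equiv> A_inf \<kappa>1"
abbreviation k2 :: "'a fls" where "k2 \<equiv> fls_const \<kappa>2"

lemma k2 [simp]: "k2 \<noteq> 0"
  using \<kappa>2 by simp

text \<open>The two solutions of the recursion, shifted by one so that the initial values are
  \<open>(0, 1)\<close> and \<open>(1, 0)\<close>: \<open>B (n + 1)\<close> is \<open>\<beta>\<^sub>n\<close> and \<open>Y (n + 1)\<close> is
  \<open>\<kappa>\<^sub>2 / (\<theta> - \<theta>\<^sup>(\<^sup>1\<^sup>))\<close> times \<open>\<beta>\<close>-tilde of index \<open>n - 1\<close>.\<close>

definition B :: "nat \<Rightarrow> 'a fls" where
  "B n = K_inf (beta \<kappa>1 \<kappa>2 (int n - 1))"

definition Y :: "nat \<Rightarrow> 'a fls" where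
  "Y n = (if n = 0 then 1 else K_inf (prefactor \<kappa>2 * beta_tilde \<kappa>1 \<kappa>2 (int n - 2)))"

definition solution :: "(nat \<Rightarrow> 'a fls) \<Rightarrow> bool" where
  "solution X \<longleftrightarrow> (\<forall>n. gap (Suc n) * X (Suc (Suc n)) = frob n k1 * X (Suc n) + k2 * X n)"

lemma solutionD: "solution X \<Longrightarrow> gap (Suc n) * X (Suc (Suc n)) = frob n k1 * X (Suc n) + k2 * X n"
  by (simp add: solution_def)

lemma frob_k1: "frob n k1 = K_inf (to_fract \<kappa>1 ^ (CARD('a) ^ n))"
  by (simp add: frob_def K_inf_power)

lemma K_inf_prefactor: "gap (Suc 0) * K_inf (prefactor \<kappa>2) = k2"
  using gap_neq_0[of "Suc 0", where 'a='a] K_inf_gap[of 1, where 'a='a]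
  by (simp add: prefactor_def K_inf_divide)

lemma B_0 [simp]: "B 0 = 0" and B_1 [simp]: "B (Suc 0) = 1"
  by (simp_all add: B_def beta_neg beta_0)

lemma Y_0 [simp]: "Y 0 = 1" and Y_1 [simp]: "Y (Suc 0) = 0"
  by (simp_all add: Y_def beta_tilde_neg)

lemma B_solution: "solution B"
  unfolding solution_def
proof
  fix n
  show "gap (Suc n) * B (Suc (Suc n)) = frob n k1 * B (Suc n) + k2 * B n"
  proof (cases n)
    case 0
    then show ?thesis
      using arg_cong[OF beta_1[of \<kappa>1 \<kappa>2], of K_inf] K_inf_gap[of 1, where 'a='a]
      by (simp add: B_def K_inf_mult beta_0 beta_neg)
  next
    case (Suc m)
    have "int (Suc (Suc n)) - 1 = int m + 2" "int (Suc n) - 1 = int m + 1" "int n - 1 = int m"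
      using Suc by auto
    then show ?thesis
      using arg_cong[OF beta_rec[of m \<kappa>1 \<kappa>2], of K_inf] Suc
      by (simp only: B_def K_inf_mult K_inf_add K_inf_gap K_inf_const frob_k1)
  qed
qed

text \<open>For n = 0 the recursion reads gap 1 * Y 2 = k2, the equation behind the prefactor. It
  dictates the value \<open>Y 0 = 1\<close>, where the formula with \<open>beta_tilde\<close> would
  give 0.\<close>

lemma Y_solution: "solution Y"
  unfolding solution_def
proof
  fix n
  show "gap (Suc n) * Y (Suc (Suc n)) = frob n k1 * Y (Suc n) + k2 * Y n"
  proof (cases n)
    case 0
    then show ?thesis
      by (simp add: Y_def beta_tilde_0 beta_tilde_neg K_inf_prefactor)
  next
    case (Suc m)
    let ?p = "K_inf (prefactor \<kappa>2)"
    have *: "gap (Suc n) * K_inf (beta_tilde \<kappa>1 \<kappa>2 (int n)) =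
        frob n k1 * K_inf (beta_tilde \<kappa>1 \<kappa>2 (int n - 1)) + k2 * K_inf (beta_tilde \<kappa>1 \<kappa>2 (int n - 2))"
    proof (cases m)
      case 0
      then show ?thesis
        using arg_cong[OF beta_tilde_1[of \<kappa>1 \<kappa>2], of K_inf] K_inf_gap[of 2, where 'a='a] frob_k1[of 1] Suc
        by (simp add: K_inf_mult beta_tilde_0 beta_tilde_neg numeral_2_eq_2)
    next
      case (Suc l)
      have "int n = int l + 2" "int n - 1 = int l + 1" "int n - 2 = int l"
        using Suc \<open>n = Suc m\<close> by auto
      then show ?thesis
        using arg_cong[OF beta_tilde_rec[of l \<kappa>1 \<kappa>2], of K_inf] Suc \<open>n = Suc m\<close>
        by (simp only: K_inf_mult K_inf_add K_inf_gap K_inf_const frob_k1)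
    qed
    have Y: "Y (Suc (Suc n)) = ?p * K_inf (beta_tilde \<kappa>1 \<kappa>2 (int n))"
      "Y (Suc n) = ?p * K_inf (beta_tilde \<kappa>1 \<kappa>2 (int n - 1))"
      "Y n = ?p * K_inf (beta_tilde \<kappa>1 \<kappa>2 (int n - 2))"
      using Suc by (simp_all add: Y_def K_inf_mult)
    have "gap (Suc n) * Y (Suc (Suc n)) = ?p * (gap (Suc n) * K_inf (beta_tilde \<kappa>1 \<kappa>2 (int n)))"
      by (simp add: Y mult_ac)
    also have "\<dots> = frob n k1 * Y (Suc n) + k2 * Y n"
      unfolding * Y by (simp add: algebra_simps)
    finally show ?thesis .
  qed
qed

definition W :: "nat \<Rightarrow> 'a fls" where
  "W n = B (Suc n) * Y n - B n * Y (Suc n)"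

lemma W_0 [simp]: "W 0 = 1"
  by (simp add: W_def)

text \<open>The terms with kappa1 cancel in the determinant. What remains is a recursion of order
  one, the one for the logarithm of theta - kappa2 tau.\<close>

lemma W_Suc: "gap (Suc n) * W (Suc n) = - k2 * W n"
proof -
  have "gap (Suc n) * W (Suc n) =
      (gap (Suc n) * B (Suc (Suc n))) * Y (Suc n) - B (Suc n) * (gap (Suc n) * Y (Suc (Suc n)))"
    by (simp add: W_def algebra_simps)
  also have "\<dots> = - k2 * W n"
    unfolding solutionD[OF B_solution] solutionD[OF Y_solution] by (simp add: W_def algebra_simps)
  finally show ?thesis .
qed

lemma W_val: "val_ge (int n) (W n)"
proof (induction n)
  case (Suc n)
  have "val_ge (0 + int n) (k2 * W n)" by (intro val_ge_mult Suc) simp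
  then have "val_ge (int n) (gap (Suc n) * W (Suc n))" by (simp add: W_Suc)
  then have "val_ge (int n + int CARD('a) ^ Suc n) (W (Suc n))" by (simp only: val_ge_gap_mult_iff[OF zero_less_Suc])
  then show ?case
    using card_power_ge_1[of "Suc n", where 'a='a] by (elim val_ge_mono) simp
qed simp

end

lemma tws_mult_deg_2:
  fixes P E :: "('a::finite_field, 'd::finite) tws"
  assumes E: "\<And>n. n > 2 \<Longrightarrow> E n = 0"
  shows "tws_mult P E 0 = P 0 ** E 0"
    and "tws_mult P E (Suc 0) = P (Suc 0) ** frob_mat (Suc 0) (E 0) + P 0 ** E 1"
    and "tws_mult P E (Suc (Suc n)) = P (Suc (Suc n)) ** frob_mat (Suc (Suc n)) (E 0) +
      P (Suc n) ** frob_mat (Suc n) (E 1) + P n ** frob_mat n (E 2)"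
proof -
  show "tws_mult P E 0 = P 0 ** E 0" by (simp add: tws_mult_def)
  show "tws_mult P E (Suc 0) = P (Suc 0) ** frob_mat (Suc 0) (E 0) + P 0 ** E 1"
    by (simp add: tws_mult_def add.commute)
  have "(\<Sum>i<n. P i ** frob_mat i (E (Suc (Suc n) - i))) = 0"
    by (rule sum.neutral) (auto simp: E)
  moreover have "{..Suc (Suc n)} = {..<n} \<union> {n, Suc n, Suc (Suc n)}" by auto
  ultimately show "tws_mult P E (Suc (Suc n)) = P (Suc (Suc n)) ** frob_mat (Suc (Suc n)) (E 0) +
      P (Suc n) ** frob_mat (Suc n) (E 1) + P n ** frob_mat n (E 2)"
    by (simp add: tws_mult_def Suc_diff_le numeral_2_eq_2 flip: lessThan_Suc_atMost)
qed

lemma vector_1_1: "(vector [vector [x]] :: 'b::zero ^ 1 ^ 1) = mat x"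
  by (simp add: vec_eq_iff mat_def vector_def forall_1)

lemma frob_mat_mat_1: "frob_mat n (mat x) = mat (frob n x)"
  by (simp add: frob_mat_def mat_def vec_eq_iff)

context rank2
begin

lemma Alt2_eq: "Alt2 \<kappa>2 n = mat (if n = 0 then fls_X_inv else if n = 1 then - k2 else 0)"
  by (simp add: Alt2_def vector_1_1)

sublocale Alt: t_module_log "Alt2 \<kappa>2" 0 "\<lambda>n. mat (W n)"
proof
  show "Alt2 \<kappa>2 0 = mat fls_X_inv + 0" by (simp add: Alt2_eq)
  show "\<exists>d. \<forall>n>d. Alt2 \<kappa>2 n = 0" by (rule exI[of _ 1]) (simp add: Alt2_eq)
  show "Alt2 \<kappa>2 n $ i $ j \<in> range A_inf" for n i j
    by (simp add: Alt2_eq mat_def A_inf_range_closed del: image_iff)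
  show "mval_ge (int n) (mat (W n))" for n
    using W_val[of n] by (simp add: mval_ge_def mat_def)
  show "tws_mult (tws_const (Alt2 \<kappa>2 0)) (\<lambda>n. mat (W n)) = tws_mult (\<lambda>n. mat (W n)) (Alt2 \<kappa>2)"
  proof
    fix n
    have deg: "Alt2 \<kappa>2 n = 0" if "n > 2" for n using that by (simp add: Alt2_eq)
    have rec: "fls_X_inv * W (Suc n) = W (Suc n) * frob (Suc n) fls_X_inv - W n * k2" for n
      using W_Suc[of n] by (simp add: gap_def algebra_simps)
    consider "n = 0" | "n = Suc 0" | m where "n = Suc (Suc m)" by (metis old.nat.exhaust)
    then show "tws_mult (tws_const (Alt2 \<kappa>2 0)) (\<lambda>n. mat (W n)) n = tws_mult (\<lambda>n. mat (W n)) (Alt2 \<kappa>2) n"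
      by cases (simp_all add: tws_mult_const_left tws_mult_deg_2[OF deg] Alt2_eq frob_mat_mat_1
          mat_mat_mult mat_add rec frob_minus)
  qed
qed (simp_all add: mval_ge_def mat_theta_deriv_def)

lemma Log_Alt2_sums: "W sums Log_Alt2 \<kappa>2 1"
proof -
  have v: "vector [1] = (axis 1 1 :: 'a fls ^ 1)"
    by (simp add: vec_eq_iff axis_def vector_def forall_1)
  have "(\<lambda>n. (mat (W n) *v axis 1 1) $ (1::1)) sums (Alt.log_axis 1 $ 1)"
    using Alt.log_axis_sums[of 1] by (simp add: sums_vec_iff)
  then show ?thesis
    by (simp add: Log_Alt2_def Alt.Log_eq v Alt.log_axis_def mat_vector_mult)
qed

lemma Reg_Alt2: "Reg (Alt2 \<kappa>2) = Log_Alt2 \<kappa>2 1"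
proof -
  have v: "vector [1] = (axis 1 1 :: 'a fls ^ 1)"
    by (simp add: vec_eq_iff axis_def vector_def forall_1)
  show ?thesis
    by (simp add: Alt.Reg_eq det_1 Alt.log_coord_def Alt.log_axis_def K_coord_def Log_Alt2_def Alt.Log_eq v)
qed

lemma Log_Alt2_eq:
  "Log_Alt2 \<kappa>2 1 = 1 + K_inf (const_K \<kappa>2 / (theta_K - theta_K ^ CARD('a))) *
     (\<Sum>n. let m = int n + 1 in
        K_inf (beta \<kappa>1 \<kappa>2 m * beta_tilde \<kappa>1 \<kappa>2 (m - 2) - beta \<kappa>1 \<kappa>2 (m - 1) * beta_tilde \<kappa>1 \<kappa>2 (m - 1)))"
proof -
  let ?p = "K_inf (prefactor \<kappa>2)"
  define f where "f n = K_inf (beta \<kappa>1 \<kappa>2 (int n + 1) * beta_tilde \<kappa>1 \<kappa>2 (int n + 1 - 2) -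
      beta \<kappa>1 \<kappa>2 (int n + 1 - 1) * beta_tilde \<kappa>1 \<kappa>2 (int n + 1 - 1))" for n
  have p: "?p \<noteq> 0" using K_inf_prefactor \<kappa>2 by auto
  have W: "W (Suc n) = ?p * f n" for n
    by (simp add: W_def B_def Y_def f_def K_inf_mult K_inf_diff algebra_simps)
  \<comment> \<open>The terms W carry the prefactor; dividing by it yields convergence and value of
    the series in f at once.\<close>
  have "(\<lambda>n. inverse ?p * (?p * f n)) sums (inverse ?p * (Log_Alt2 \<kappa>2 1 - 1))"
    using fls_sums_Suc[OF Log_Alt2_sums] unfolding W by (intro fls_sums_mult) simp
  then have "f sums (inverse ?p * (Log_Alt2 \<kappa>2 1 - 1))" using p by (simp flip: mult.assoc)
  then have "suminf f = inverse ?p * (Log_Alt2 \<kappa>2 1 - 1)" by (simp add: sums_iff)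
  then have "Log_Alt2 \<kappa>2 1 = 1 + ?p * suminf f" using p by (simp flip: mult.assoc)
  then show ?thesis by (simp add: f_def[abs_def] Let_def prefactor_def)
qed

end

section \<open>The symmetric square\<close>

context rank2
begin

declare \<kappa>2 [simp]

text \<open>The coefficients of \<open>Log\<close> are bilinear in solutions of the recursion: these are the three
  entries of a row, for a pair of solutions.\<close>

definition row1 where "row1 X Z n = gap n * (X (Suc n) * Z (Suc n)) / k2"
definition row2 where "row2 X Z n = (frob n k1 * (X (Suc n) * Z (Suc n)) +
  k2 * (X (Suc n) * Z n + X n * Z (Suc n))) / k2"
definition row3 where "row3 X Z n = X (Suc n) * Z (Suc n)" for X Z :: "nat \<Rightarrow> 'a fls"

lemma row3_rec: "gap n * row3 X Z n = k2 * row1 X Z n"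
  by (simp add: row1_def row3_def)

text \<open>The origin of \<open>row2\<close>: in the product of the recursions for X and Z, divided
  by kappa2, it is the cofactor of the twist of kappa1.\<close>

lemma row1_rec:
  assumes "solution X" "solution Z"
  shows "gap (Suc n) * row1 X Z (Suc n) = frob n k1 * row2 X Z n + k2 * (X n * Z n)"
proof -
  have "gap (Suc n) * row1 X Z (Suc n) =
      (gap (Suc n) * X (Suc (Suc n))) * (gap (Suc n) * Z (Suc (Suc n))) / k2"
    by (simp add: row1_def mult_ac)
  also have "\<dots> = frob n k1 * row2 X Z n + k2 * (X n * Z n)"
    unfolding solutionD[OF assms(1)] solutionD[OF assms(2)]
    using k2 by (simp add: row2_def field_simps del: k2)
  finally show ?thesis .
qed

lemma row2_rec:
  assumes "solution X" "solution Z"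
  shows "gap (Suc n) * row2 X Z (Suc n) =
    frob (Suc n) k1 * row1 X Z (Suc n) + k2 * row2 X Z n + frob n k1 * row3 X Z n"
proof -
  have "gap (Suc n) * row2 X Z (Suc n) = frob (Suc n) k1 * row1 X Z (Suc n) +
      ((gap (Suc n) * X (Suc (Suc n))) * Z (Suc n) + X (Suc n) * (gap (Suc n) * Z (Suc (Suc n))))"
    using k2 by (simp add: row1_def row2_def field_simps del: k2)
  also have "\<dots> = frob (Suc n) k1 * row1 X Z (Suc n) + k2 * row2 X Z n + frob n k1 * row3 X Z n"
    unfolding solutionD[OF assms(1)] solutionD[OF assms(2)]
    using k2 by (simp add: row2_def row3_def field_simps del: k2)
  finally show ?thesis .
qed

definition s :: "nat \<Rightarrow> 'a fls ^ 3" where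
  "s n = vector [row1 B Y n, row2 B Y n, row3 B Y n]"

definition r :: "nat \<Rightarrow> 'a fls ^ 3" where
  "r n = vector [row1 B B n, row2 B B n, row3 B B n]"

definition dk1 :: "'a fls" where "dk1 = theta_deriv k1"

definition P1 :: "nat \<Rightarrow> 'a fls ^ 3" where
  "P1 n = (if n = 0 then axis 1 1 else k2 *s vec_theta_deriv (r n) - (2 * dk1) *s s n)"

text \<open>The sequence r starts with (0, k1/k2, 1) and s with the second unit vector; this
  multiple of s turns the initial value into the third unit vector.\<close>

definition P3 :: "nat \<Rightarrow> 'a fls ^ 3" where
  "P3 n = r n - (k1 / k2) *s s n"

definition Sym_log :: "('a, 3) tws" where
  "Sym_log n = vector [P1 n, s n, P3 n]"

lemma s_nth: "s n $ 1 = row1 B Y n" "s n $ 2 = row2 B Y n" "s n $ 3 = row3 B Y n"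
  by (simp_all add: s_def)

lemma r_nth: "r n $ 1 = row1 B B n" "r n $ 2 = row2 B B n" "r n $ 3 = row3 B B n"
  by (simp_all add: r_def)

lemma s_0: "s 0 $ 1 = 0" "s 0 $ 2 = 1" "s 0 $ 3 = 0"
  by (simp_all add: s_nth row1_def row2_def row3_def)

lemma r_0: "r 0 $ 1 = 0" "r 0 $ 2 = k1 / k2" "r 0 $ 3 = 1"
  by (simp_all add: r_nth row1_def row2_def row3_def)

text \<open>The equation \<open>\<partial>E\<^sub>t Log = Log E\<^sub>t\<close> for one row \<open>p\<close> of \<open>Log\<close>; the defect \<open>e\<close> is the contribution of
  the other rows through the nilpotent part of \<open>\<partial>E\<^sub>t\<close>.\<close>

definition row_rec :: "(nat \<Rightarrow> 'a fls ^ 3) \<Rightarrow> (nat \<Rightarrow> 'a fls ^ 3) \<Rightarrow> bool" where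
  "row_rec p e \<longleftrightarrow> (\<forall>n.
     gap (Suc n) * p (Suc n) $ 1 =
       frob n k1 * p n $ 2 + (if n = 0 then 0 else k2 * p (n - 1) $ 3) - e (Suc n) $ 1 \<and>
     gap (Suc n) * p (Suc n) $ 2 =
       frob (Suc n) k1 * p (Suc n) $ 1 + k2 * p n $ 2 + frob n k1 * p n $ 3 - e (Suc n) $ 2 \<and>
     gap (Suc n) * p (Suc n) $ 3 = k2 * p (Suc n) $ 1 - e (Suc n) $ 3)"

text \<open>For n > 0 the product X n * Z n is \<open>row3\<close> at n - 1. At n = 0 there is no
  predecessor, so the product of the initial values has to vanish, as it does for the pairs (B, Y)
  and (B, B).\<close>

lemma row_rec_bilinear:
  assumes "solution X" "solution Z" "X 0 * Z 0 = 0"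
  shows "row_rec (\<lambda>n. vector [row1 X Z n, row2 X Z n, row3 X Z n]) (\<lambda>n. 0)"
  unfolding row_rec_def
proof (intro allI conjI, goal_cases)
  case (1 n)
  show ?case using row1_rec[OF assms(1,2), of n] assms(3) by (cases n) (simp_all add: row3_def)
qed (simp_all add: row2_rec[OF assms(1,2)] row3_rec)

lemma row_rec_s: "row_rec s (\<lambda>n. 0)"
  using row_rec_bilinear[OF B_solution Y_solution] by (simp add: s_def[abs_def])

lemma row_rec_r: "row_rec r (\<lambda>n. 0)"
  using row_rec_bilinear[OF B_solution B_solution] by (simp add: r_def[abs_def])

lemma row_rec_linear:
  assumes "row_rec p e" "row_rec p' e'"
  shows "row_rec (\<lambda>n. a *s p n + b *s p' n) (\<lambda>n. a *s e n + b *s e' n)"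
  unfolding row_rec_def
proof (intro allI conjI, goal_cases)
  note p = assms(1)[unfolded row_rec_def, rule_format]
  note p' = assms(2)[unfolded row_rec_def, rule_format]
  have lin: "c * (a * x + b * y) = a * (c * x) + b * (c * y)" for c x y
    by (simp add: algebra_simps)
  {
    case (1 n)
    show ?case
      unfolding vector_add_component vector_smult_component lin[of "gap _"] p[THEN conjunct1]
        p'[THEN conjunct1]
      by (simp add: algebra_simps)
  next
    case (2 n)
    show ?case
      unfolding vector_add_component vector_smult_component lin[of "gap _"]
        p[THEN conjunct2, THEN conjunct1] p'[THEN conjunct2, THEN conjunct1]
      by (simp add: algebra_simps)
  next
    case (3 n)
    show ?case
      unfolding vector_add_component vector_smult_component lin[of "gap _"]
        p[THEN conjunct2, THEN conjunct2] p'[THEN conjunct2, THEN conjunct2]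
      by (simp add: algebra_simps)
  }
qed

lemma row_rec_P3: "row_rec P3 (\<lambda>n. 0)"
  using row_rec_linear[OF row_rec_r row_rec_s, of 1 "- (k1 / k2)"]
  by (simp add: P3_def[abs_def] vector_smult_lneg)

text \<open>Differentiating the equations for \<open>r\<close> produces the defect \<open>r\<close>, because \<open>\<theta> - \<theta>\<^sup>(\<^sup>n\<^sup>)\<close> has
  derivative 1. The twisted coefficients are constants, apart from \<open>\<kappa>\<^sub>1\<^sup>(\<^sup>0\<^sup>) = \<kappa>\<^sub>1\<close> for \<open>n = 0\<close>; the
  multiple of \<open>s\<close> in \<open>P1\<close> corrects for that.\<close>

lemma row_rec_P1: "row_rec P1 (\<lambda>n. k2 *s r n)"
proof -
  have d: "gap (Suc n) * theta_deriv x = theta_deriv (gap (Suc n) * x) - x" for n x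
    by (simp add: theta_deriv_mult theta_deriv_gap)
  have r1: "gap (Suc n) * r (Suc n) $ 1 = frob n k1 * r n $ 2 + (if n = 0 then 0 else k2 * r (n - 1) $ 3)"
    and r2: "gap (Suc n) * r (Suc n) $ 2 =
       frob (Suc n) k1 * r (Suc n) $ 1 + k2 * r n $ 2 + frob n k1 * r n $ 3"
    and r3: "gap (Suc n) * r (Suc n) $ 3 = k2 * r (Suc n) $ 1" for n
    using row_rec_r unfolding row_rec_def by simp_all
  have s1: "gap (Suc n) * s (Suc n) $ 1 = frob n k1 * s n $ 2 + (if n = 0 then 0 else k2 * s (n - 1) $ 3)"
    and s2: "gap (Suc n) * s (Suc n) $ 2 =
       frob (Suc n) k1 * s (Suc n) $ 1 + k2 * s n $ 2 + frob n k1 * s n $ 3"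
    and s3: "gap (Suc n) * s (Suc n) $ 3 = k2 * s (Suc n) $ 1" for n
    using row_rec_s unfolding row_rec_def by simp_all
  have fd: "theta_deriv (frob n k1) = (if n = 0 then dk1 else 0)" for n
    by (simp add: dk1_def theta_deriv_frob)
  have P1: "P1 (Suc n) $ i = k2 * theta_deriv (r (Suc n) $ i) - 2 * dk1 * s (Suc n) $ i" for n i
    by (simp add: P1_def vec_theta_deriv_def)
  have gP1: "gap (Suc n) * P1 (Suc n) $ i =
      k2 * theta_deriv (gap (Suc n) * r (Suc n) $ i) - 2 * dk1 * (gap (Suc n) * s (Suc n) $ i) -
      k2 * r (Suc n) $ i" for n i
    using arg_cong[OF d[of n "r (Suc n) $ i"], of "\<lambda>x. k2 * x"] by (simp add: P1 algebra_simps)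
  have dk2: "theta_deriv (k2 * x) = k2 * theta_deriv x" for x
    by (simp add: theta_deriv_mult)
  have dr0: "k2 * theta_deriv (r 0 $ 2) = dk1" "theta_deriv (r 0 $ 3) = 0"
  proof -
    have "k2 * theta_deriv (r 0 $ 2) = theta_deriv (k2 * r 0 $ 2)" by (simp add: dk2)
    then show "k2 * theta_deriv (r 0 $ 2) = dk1" by (simp add: r_0 dk1_def)
  qed (simp add: r_0)
  \<comment> \<open>As r 0 $ 2 = k1/k2, the differentiated term is the square of k1 up to the factor
    k2. This is the origin of the factor 2 in the correction term of \<open>P1\<close>.\<close>
  have kd: "k2 * theta_deriv (k1 * r 0 $ 2) = 2 * (k1 * dk1)"
  proof -
    have "k2 * theta_deriv (k1 * r 0 $ 2) = dk1 * (k2 * r 0 $ 2) + k1 * (k2 * theta_deriv (r 0 $ 2))"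
      by (simp add: theta_deriv_mult dk1_def algebra_simps)
    also have "\<dots> = 2 * (k1 * dk1)" by (simp add: dr0) (simp add: r_0)
    finally show ?thesis .
  qed
  have P1_3: "P1 n $ 3 = k2 * theta_deriv (r n $ 3) - 2 * dk1 * s n $ 3" for n
  proof (cases n)
    case 0
    then show ?thesis by (simp add: P1_def axis_def r_0 s_0)
  qed (simp add: P1)
  have P1_2: "P1 n $ 2 = k2 * theta_deriv (r n $ 2) - 2 * dk1 * s n $ 2 + (if n = 0 then dk1 else 0)" for n
  proof (cases n)
    case 0
    then show ?thesis by (simp add: P1_def axis_def dr0 s_0)
  qed (simp add: P1)
  show ?thesis
    unfolding row_rec_def
  proof (intro allI conjI)
    fix n
    show "gap (Suc n) * P1 (Suc n) $ 1 =
        frob n k1 * P1 n $ 2 + (if n = 0 then 0 else k2 * P1 (n - 1) $ 3) - (k2 *s r (Suc n)) $ 1"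
      unfolding gP1 r1 s1 P1_3 P1_2
      by (cases "n = 0")
        (simp_all add: kd dr0 s_0 theta_deriv_add theta_deriv_mult[of "frob n k1"] dk2 fd algebra_simps)
    show "gap (Suc n) * P1 (Suc n) $ 2 =
        frob (Suc n) k1 * P1 (Suc n) $ 1 + k2 * P1 n $ 2 + frob n k1 * P1 n $ 3 - (k2 *s r (Suc n)) $ 2"
      unfolding gP1 r2 s2
      unfolding P1_3[of n] P1_2[of n] P1
      by (cases "n = 0")
        (simp_all add: theta_deriv_add theta_deriv_mult[of "frob _ k1"] theta_deriv_mult[of k1] dk2 fd
          r_0(3) dr0 s_0 algebra_simps flip: dk1_def)
    show "gap (Suc n) * P1 (Suc n) $ 3 = k2 * P1 (Suc n) $ 1 - (k2 *s r (Suc n)) $ 3"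
      unfolding gP1 r3 s3
      unfolding P1 by (simp add: dk2 algebra_simps)
  qed
qed

definition Sym_N :: "'a fls ^ 3 ^ 3" where
  "Sym_N = vector [vector [0, k1, k2], 0, 0]"

lemma Sym2_nth:
  "Sym2 \<kappa>1 \<kappa>2 0 = vector [vector [fls_X_inv, k1, k2], vector [0, fls_X_inv, 0], vector [0, 0, fls_X_inv]]"
  "Sym2 \<kappa>1 \<kappa>2 1 = vector [vector [0, 0, 0], vector [k1, k2, 0], vector [0, k1, 0]]"
  "Sym2 \<kappa>1 \<kappa>2 2 = vector [vector [0, 0, 0], vector [0, 0, 0], vector [k2, 0, 0]]"
  by (simp_all add: Sym2_def Let_def)

lemma Sym2_0: "Sym2 \<kappa>1 \<kappa>2 0 = mat fls_X_inv + Sym_N"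
  by (simp add: Sym2_nth Sym_N_def vec_eq_iff forall_3 mat_def)

lemma Sym_log_eq:
  "tws_mult (tws_const (Sym2 \<kappa>1 \<kappa>2 0)) Sym_log = tws_mult Sym_log (Sym2 \<kappa>1 \<kappa>2)"
proof
  fix n
  have deg: "Sym2 \<kappa>1 \<kappa>2 n = 0" if "n > 2" for n using that by (simp add: Sym2_def Let_def)
  have T1: "tws_mult Sym_log (Sym2 \<kappa>1 \<kappa>2) (Suc 0) =
      Sym_log (Suc 0) ** frob_mat (Suc 0) (Sym2 \<kappa>1 \<kappa>2 0) + Sym_log 0 ** Sym2 \<kappa>1 \<kappa>2 1"
    by (rule tws_mult_deg_2(2)) (rule deg)
  have T2: "tws_mult Sym_log (Sym2 \<kappa>1 \<kappa>2) (Suc (Suc m)) =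
      Sym_log (Suc (Suc m)) ** frob_mat (Suc (Suc m)) (Sym2 \<kappa>1 \<kappa>2 0) +
      Sym_log (Suc m) ** frob_mat (Suc m) (Sym2 \<kappa>1 \<kappa>2 1) + Sym_log m ** frob_mat m (Sym2 \<kappa>1 \<kappa>2 2)" for m
    by (rule tws_mult_deg_2(3)) (rule deg)
  have g: "gap n * x = y \<longleftrightarrow> fls_X_inv * x = x * frob n fls_X_inv + y" for n and x y :: "'a fls"
    by (auto simp: gap_def algebra_simps)
  \<comment> \<open>The first row of \<open>Sym_N\<close> times Log. The multiple of s subtracted in
    \<open>P3\<close> makes it equal to k2 r, which is exactly the defect in the recursion of
    \<open>P1\<close>.\<close>
  have k: "k1 * s n $ i + k2 * P3 n $ i = k2 * r n $ i" for n i
    using k2 by (simp add: P3_def algebra_simps del: k2)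
  note rr = row_rec_P1[unfolded row_rec_def, rule_format] row_rec_s[unfolded row_rec_def, rule_format]
    row_rec_P3[unfolded row_rec_def, rule_format]
  consider "n = 0" | "n = Suc 0" | m where "n = Suc (Suc m)" by (metis old.nat.exhaust)
  then show "tws_mult (tws_const (Sym2 \<kappa>1 \<kappa>2 0)) Sym_log n = tws_mult Sym_log (Sym2 \<kappa>1 \<kappa>2) n"
  proof cases
    case 1
    have "Sym_log 0 = mat 1"
      using k2 by (simp add: Sym_log_def vec_eq_iff forall_3 mat_def P1_def axis_def s_0 P3_def r_0 del: k2)
    then show ?thesis using 1 by (simp add: tws_mult_const_left tws_mult_deg_2[OF deg])
  next
    case 2
    show ?thesis
      unfolding 2 tws_mult_const_left T1
      unfolding Sym2_nth Sym_log_def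
      using rr(1)[of 0] rr(2)[of 0] rr(3)[of 0] k[of "Suc 0"]
      by (simp add: vec_eq_iff forall_3 matrix_matrix_mult_def sum_3 frob_mat_def g)
  next
    case 3
    show ?thesis
      unfolding 3 tws_mult_const_left T2
      unfolding Sym2_nth Sym_log_def
      using rr(1)[of "Suc m"] rr(2)[of "Suc m"] rr(3)[of "Suc m"] k[of "Suc (Suc m)"]
      by (simp add: vec_eq_iff forall_3 matrix_matrix_mult_def sum_3 frob_mat_def g)
  qed
qed

end

section \<open>Degree bounds for the logarithm of the symmetric square\<close>

locale rank2_small = rank2 +
  assumes degree_\<kappa>1: "degree \<kappa>1 \<le> 1" and CHAR_neq_2: "CHAR('a) \<noteq> 2"
begin

lemma CHAR_not_dvd_2: "\<not> CHAR('a) dvd 2"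
proof
  assume "CHAR('a) dvd 2"
  then have "CHAR('a) \<le> 2" by (simp add: dvd_imp_le)
  moreover have "CHAR('a) > 1" by (rule prime_gt_1_nat) simp
  ultimately show False using CHAR_neq_2 by simp
qed

lemma two_neq_0: "(2 :: 'a) \<noteq> 0"
  using CHAR_not_dvd_2 of_nat_eq_0_iff_char_dvd[of 2, where 'a='a] by simp

lemma card_ge_3: "CARD('a) \<ge> 3"
proof (rule ccontr)
  assume "\<not> CARD('a) \<ge> 3"
  then have "CARD('a) = 2" using card_gt_1[where 'a='a] by simp
  then have "of_nat 2 = (0 :: 'a)" using finite_field_of_nat_card[where 'a='a] by metis
  then show False using two_neq_0 by simp
qed

text \<open>Matches the valuation q^n - 2 of r against the required n. It rests on q >= 3 and would
  fail for q = 2 and n = 1.\<close>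

lemma le_card_power_2: "n > 0 \<Longrightarrow> int n \<le> int CARD('a) ^ n - 2"
proof -
  assume "n > 0"
  then obtain m where n: "n = Suc m" by (cases n) auto
  have "int CARD('a) ^ m * 3 \<le> int CARD('a) ^ m * int CARD('a)"
    using card_ge_3 by (intro mult_left_mono) auto
  moreover have "int CARD('a) ^ Suc m = int CARD('a) ^ m * int CARD('a)" by simp
  ultimately show ?thesis
    unfolding n using le_card_power[of m, where 'a='a] card_power_ge_1[of m, where 'a='a] by linarith
qed

lemma k1_val: "val_ge (-1) k1"
  using val_ge_A_inf[OF degree_\<kappa>1] by simp

lemma frob_val: "val_ge (-1) z \<Longrightarrow> val_ge (- (int CARD('a) ^ n)) (frob n z)" for z :: "'a fls"
  using val_ge_frob[of "-1" z n] by simp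

lemma dk1_val: "val_ge 0 dk1"
  using val_ge_theta_deriv[OF k1_val] by (simp add: dk1_def)

lemma val_ge_mult_le: "val_ge k x \<Longrightarrow> val_ge l y \<Longrightarrow> m \<le> k + l \<Longrightarrow> val_ge m (x * y)" for x :: "'b::field fls"
  using val_ge_mult val_ge_mono by blast

lemma val_ge_k2_mult: "val_ge k x \<Longrightarrow> val_ge k (k2 * x)"
  by (rule val_ge_mult_le[of 0]) auto

lemma val_ge_div_k2: "val_ge k x \<Longrightarrow> val_ge k (x / k2)"
proof -
  have "x / k2 = fls_const (inverse \<kappa>2) * x"
    by (simp add: field_simps flip: fls_const_divide_const)
  then show "val_ge k x \<Longrightarrow> val_ge k (x / k2)" by (simp add: val_ge_mult_le[of 0])
qed

text \<open>As kappa1 has degree at most 1, its n-th twist costs at most q^n, which X (n + 1) has in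
  stock up to d; the division by \<open>gap (Suc n)\<close> earns q^(n+1). The slack d is 1 for B,
  whose value 1 at index 1 has valuation 0, and 0 for Y, which vanishes there.\<close>

lemma solution_val:
  assumes X: "solution X" "val_ge (1 - d) (X (Suc 0))" "val_ge 0 (X 0)" and d: "0 \<le> d" "d \<le> 1"
  shows "val_ge (int CARD('a) ^ n - d) (X (Suc n))" and "val_ge 0 (X n)"
proof -
  have *: "val_ge (int CARD('a) ^ n - d) (X (Suc n)) \<and> val_ge 0 (X n)" for n
  proof (induction n)
    case (Suc n)
    then have IH: "val_ge (int CARD('a) ^ n - d) (X (Suc n))" "val_ge 0 (X n)" by auto
    have "val_ge (- d) (frob n k1 * X (Suc n) + k2 * X n)"
      using d by (intro val_ge_add val_ge_mult_le[OF frob_val[OF k1_val] IH(1)] val_ge_k2_mult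
          val_ge_mono[OF IH(2)]) auto
    then have "val_ge (- d) (gap (Suc n) * X (Suc (Suc n)))" by (simp only: solutionD[OF X(1)])
    then have "val_ge (int CARD('a) ^ Suc n - d) (X (Suc (Suc n)))"
      unfolding val_ge_gap_mult_iff[OF zero_less_Suc] by (simp add: algebra_simps)
    moreover have "val_ge 0 (X (Suc n))"
      using card_power_ge_1[of n, where 'a='a] d by (intro val_ge_mono[OF IH(1)]) linarith
    ultimately show ?case by blast
  qed (simp add: X)
  show "val_ge (int CARD('a) ^ n - d) (X (Suc n))" "val_ge 0 (X n)" using *[of n] by auto
qed

lemma B_val: "val_ge (int CARD('a) ^ n - 1) (B (Suc n))" and B_val_0: "val_ge 0 (B n)"
  using solution_val[OF B_solution, of 1] by simp_all

lemma Y_val: "val_ge (int CARD('a) ^ n) (Y (Suc n))" and Y_val_0: "val_ge 0 (Y n)"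
  using solution_val[OF Y_solution, of 0] by simp_all

lemma row3_BY_val: "val_ge (2 * int CARD('a) ^ n - 1) (row3 B Y n)"
  unfolding row3_def by (rule val_ge_mult_le[OF B_val Y_val]) simp

lemma row3_BB_val: "val_ge (2 * int CARD('a) ^ n - 2) (row3 B B n)"
  unfolding row3_def by (rule val_ge_mult_le[OF B_val B_val]) simp

text \<open>The product in \<open>row3\<close> has valuation 2 q^n - 1, of which a factor
  \<open>gap n\<close> or a twist of kappa1 costs at most q^n. The mixed products in
  \<open>row2\<close> contain one decaying factor each.\<close>

lemma s_val: "vval_ge (int CARD('a) ^ n - 1) (s n)"
proof -
  have "val_ge (int CARD('a) ^ n - 1) (row1 B Y n)"
    unfolding row1_def row3_def[symmetric]
    by (intro val_ge_div_k2 val_ge_mult_le[OF val_ge_gap row3_BY_val]) simp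
  moreover have "val_ge (int CARD('a) ^ n - 1) (row2 B Y n)"
    unfolding row2_def row3_def[symmetric]
    by (intro val_ge_div_k2 val_ge_add val_ge_mult_le[OF frob_val[OF k1_val] row3_BY_val]
        val_ge_k2_mult val_ge_mult_le[OF B_val Y_val_0] val_ge_mult_le[OF B_val_0 Y_val]) auto
  moreover have "val_ge (int CARD('a) ^ n - 1) (row3 B Y n)"
    using card_power_ge_1[of n, where 'a='a] by (intro val_ge_mono[OF row3_BY_val]) linarith
  ultimately show ?thesis by (simp add: vval_ge_def forall_3 s_nth)
qed

lemma r_val: "vval_ge (int CARD('a) ^ n - 2) (r n)"
proof -
  have "val_ge (int CARD('a) ^ n - 2) (row1 B B n)"
    unfolding row1_def row3_def[symmetric]
    by (intro val_ge_div_k2 val_ge_mult_le[OF val_ge_gap row3_BB_val]) simp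
  moreover have "val_ge (int CARD('a) ^ n - 2) (row2 B B n)"
    unfolding row2_def row3_def[symmetric]
    by (intro val_ge_div_k2 val_ge_add val_ge_mult_le[OF frob_val[OF k1_val] row3_BB_val]
        val_ge_k2_mult val_ge_mult_le[OF B_val B_val_0] val_ge_mult_le[OF B_val_0 B_val]) auto
  moreover have "val_ge (int CARD('a) ^ n - 2) (row3 B B n)"
    using card_power_ge_1[of n, where 'a='a] by (intro val_ge_mono[OF row3_BB_val]) linarith
  ultimately show ?thesis by (simp add: vval_ge_def forall_3 r_nth)
qed

lemma Sym_log_0: "Sym_log 0 = mat 1"
  by (simp add: Sym_log_def vec_eq_iff forall_3 mat_def P1_def axis_def s_0 P3_def r_0)

text \<open>The third row is the tightest, with bound q^n - 2: it contains r undifferentiated, and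
  k1 costs s one. In the first row the derivative gains one.\<close>

lemma Sym_log_val: "mval_ge (int n) (Sym_log n)"
proof (cases "n = 0")
  case True
  then show ?thesis by (simp add: Sym_log_0 mval_ge_def mat_def)
next
  case False
  let ?q = "int CARD('a) ^ n"
  have n: "int n \<le> ?q - 2" using le_card_power_2 False by simp
  have s: "val_ge (?q - 1) (s n $ i)" and r: "val_ge (?q - 2) (r n $ i)" for i
    using s_val r_val by (auto simp: vval_ge_def)
  have "val_ge (int n) (P1 n $ i)" for i
  proof -
    have "val_ge (int n) (k2 * theta_deriv (r n $ i))"
      using n by (intro val_ge_k2_mult val_ge_mono[OF val_ge_theta_deriv[OF r]]) linarith
    moreover have "val_ge (int n) (2 * dk1 * s n $ i)"
      using n by (intro val_ge_mult_le[OF val_ge_mult[OF val_ge_numeral dk1_val] s]) linarith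
    ultimately show ?thesis using False by (simp add: P1_def vec_theta_deriv_def val_ge_diff)
  qed
  moreover have "val_ge (int n) (P3 n $ i)" for i
  proof -
    have "val_ge (int n) (k1 / k2 * s n $ i)"
      using n by (intro val_ge_mult_le[OF val_ge_div_k2[OF k1_val] s]) linarith
    moreover have "val_ge (int n) (r n $ i)" using n by (rule val_ge_mono[OF r])
    ultimately show ?thesis by (simp add: P3_def val_ge_diff)
  qed
  moreover have "val_ge (int n) (s n $ i)" for i using n by (intro val_ge_mono[OF s]) linarith
  ultimately show ?thesis by (simp add: mval_ge_def forall_3 Sym_log_def)
qed

sublocale Sym: t_module_log "Sym2 \<kappa>1 \<kappa>2" Sym_N Sym_log
proof
  show "Sym2 \<kappa>1 \<kappa>2 0 = mat fls_X_inv + Sym_N" by (rule Sym2_0)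
  show "Sym_N ** Sym_N = 0" "Sym_N ** mat_theta_deriv Sym_N = 0"
    by (simp_all add: Sym_N_def vec_eq_iff forall_3 matrix_matrix_mult_def sum_3 mat_theta_deriv_def)
  have "val_ge (-1) k2" by (rule val_ge_mono[OF val_ge_const]) simp
  then show "mval_ge (-1) Sym_N"
    using k1_val by (simp add: mval_ge_def forall_3 Sym_N_def)
  have "\<forall>i j. Sym2 \<kappa>1 \<kappa>2 n $ i $ j \<in> range A_inf" for n
    by (simp add: Sym2_def Let_def forall_3 A_inf_range_closed del: image_iff)
  then show "Sym2 \<kappa>1 \<kappa>2 n $ i $ j \<in> range A_inf" for n i j by blast
  show "\<exists>d. \<forall>n>d. Sym2 \<kappa>1 \<kappa>2 n = 0" by (rule exI[of _ 2]) (simp add: Sym2_def Let_def)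
  show "Sym_log 0 = mat 1" by (rule Sym_log_0)
  show "tws_mult (tws_const (Sym2 \<kappa>1 \<kappa>2 0)) Sym_log = tws_mult Sym_log (Sym2 \<kappa>1 \<kappa>2)"
    by (rule Sym_log_eq)
  show "mval_ge (int n) (Sym_log n)" for n by (rule Sym_log_val)
qed

subsection \<open>The series in the matrix \<open>M\<close>\<close>

lemma q_series_from_eqI:
  assumes "(\<lambda>n. K_inf (c (int n + int k)) * frob (n + k) z) sums t"
  shows "q_series_from k c z = t"
  using assms by (simp add: q_series_from_def Let_def frob_def sums_iff)

text \<open>Bridges two conventions: the series of the statement start at m = 1, the families built
  from B and Y at 0 with a vanishing term there. The factor a takes up the prefactor that Y already
  contains.\<close>

lemma q_series_from_1_eqI:
  assumes "f sums t" "f 0 = 0" "\<And>n. f (Suc n) = a * (K_inf (c (int n + 1)) * frob (Suc n) z)"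
  shows "a * q_series_from 1 c z = t"
proof (cases "a = 0")
  case True
  then have "f n = 0" for n using assms(2,3) by (cases n) auto
  then have "f = (\<lambda>n. 0)" by auto
  then show ?thesis using assms(1) True by (auto simp: sums_iff)
next
  case False
  have "(\<lambda>n. f (Suc n)) sums t" using fls_sums_Suc[OF assms(1)] assms(2) by simp
  then have "(\<lambda>n. inverse a * f (Suc n)) sums (inverse a * t)" by (rule fls_sums_mult)
  then have "q_series_from 1 c z = inverse a * t"
    using False by (intro q_series_from_eqI) (simp add: assms(3) flip: mult.assoc)
  then show ?thesis using False by (simp flip: mult.assoc)
qed

lemma L1_tilde_sums:
  assumes z: "val_ge (-1) z"
  shows "(\<lambda>n. row3 B Y n * frob n z) sums L1_tilde \<kappa>1 \<kappa>2 z"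
proof -
  have "val_ge (int n + 0) (row3 B Y n * frob n z)" for n
    using le_card_power[of n, where 'a='a] by (intro val_ge_mult_le[OF row3_BY_val frob_val[OF z]]) simp
  then have *: "(\<lambda>n. row3 B Y n * frob n z) sums (\<Sum>n. row3 B Y n * frob n z)" by (rule fls_sums_nat)
  have "L1_tilde \<kappa>1 \<kappa>2 z = (\<Sum>n. row3 B Y n * frob n z)"
    unfolding L1_tilde_def
    by (rule q_series_from_1_eqI[OF *]) (simp_all add: row3_def B_def Y_def K_inf_mult beta_tilde_neg add.commute[of 1])
  then show ?thesis using * by simp
qed

lemma L2_tilde_sums: "(\<lambda>n. B n * Y (Suc n)) sums L2_tilde \<kappa>1 \<kappa>2 1"
proof -
  have "val_ge (int n + 0) (B n * Y (Suc n))" for n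
    using le_card_power[of n, where 'a='a] by (intro val_ge_mult_le[OF B_val_0 Y_val]) simp
  then have *: "(\<lambda>n. B n * Y (Suc n)) sums (\<Sum>n. B n * Y (Suc n))" by (rule fls_sums_nat)
  have "L2_tilde \<kappa>1 \<kappa>2 1 = (\<Sum>n. B n * Y (Suc n))"
    unfolding L2_tilde_def
    by (rule q_series_from_1_eqI[OF *]) (simp_all add: B_def Y_def K_inf_mult beta_neg)
  then show ?thesis using * by simp
qed

lemma Log_phi2_sums:
  assumes z: "val_ge (-1) z"
  shows "(\<lambda>n. row3 B B n * frob n z) sums Log_phi2 \<kappa>1 \<kappa>2 z"
proof -
  have "val_ge (int n + (-1)) (row3 B B n * frob n z)" for n
    using le_card_power[of n, where 'a='a] by (intro val_ge_mult_le[OF row3_BB_val frob_val[OF z]]) linarith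
  then have *: "(\<lambda>n. row3 B B n * frob n z) sums (\<Sum>n. row3 B B n * frob n z)" by (rule fls_sums_nat)
  have "Log_phi2 \<kappa>1 \<kappa>2 z = (\<Sum>n. row3 B B n * frob n z)"
    unfolding Log_phi2_def
    by (rule q_series_from_eqI) (use * in \<open>simp add: row3_def B_def power2_eq_square K_inf_mult\<close>)
  then show ?thesis using * by simp
qed

lemma L2_sums: "(\<lambda>n. B (Suc n) * B n) sums L2 \<kappa>1 \<kappa>2 1"
proof -
  have "val_ge (int n + 0) (B (Suc n) * B n)" for n
    using le_card_power[of n, where 'a='a] by (intro val_ge_mult_le[OF B_val B_val_0]) simp
  then have *: "(\<lambda>n. B (Suc n) * B n) sums (\<Sum>n. B (Suc n) * B n)" by (rule fls_sums_nat)
  have "1 * L2 \<kappa>1 \<kappa>2 1 = (\<Sum>n. B (Suc n) * B n)"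
    unfolding L2_def
    by (rule q_series_from_1_eqI[OF *]) (simp_all add: B_def K_inf_mult beta_neg add.commute[of 1])
  then show ?thesis using * by simp
qed

lemma K_inf_beta_hat: "K_inf (beta_hat \<kappa>1 \<kappa>2 (int m)) = dk1 / k2 * Y (Suc m)"
proof -
  have g: "gap (Suc 0) \<noteq> (0 :: 'a fls)" by (rule gap_neq_0) simp
  have "gap (Suc 0) * K_inf (beta_hat \<kappa>1 \<kappa>2 (int m)) = dk1 * K_inf (beta_tilde \<kappa>1 \<kappa>2 (int m - 1))"
    using arg_cong[OF beta_hat_eq_beta_tilde[of \<kappa>1 \<kappa>2 m], of K_inf] K_inf_gap[of 1, where 'a='a]
    by (simp add: K_inf_mult dk1_def A_inf_pderiv)
  moreover have "gap (Suc 0) * (dk1 / k2 * Y (Suc m)) = dk1 * K_inf (beta_tilde \<kappa>1 \<kappa>2 (int m - 1))"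
  proof -
    have "gap (Suc 0) * (dk1 / k2 * Y (Suc m)) =
        (gap (Suc 0) * K_inf (prefactor \<kappa>2)) / k2 * (dk1 * K_inf (beta_tilde \<kappa>1 \<kappa>2 (int m - 1)))"
      by (simp add: Y_def K_inf_mult)
    then show ?thesis by (simp add: K_inf_prefactor)
  qed
  ultimately show ?thesis using g by (metis mult_left_cancel)
qed

text \<open>Beta-hat is dk1/k2 times a value of Y, so the hat series reduce to the tilde
  series.\<close>

lemma L1_hat_eq:
  assumes z: "val_ge (-1) z"
  shows "L1_hat \<kappa>1 \<kappa>2 z = 2 * dk1 / k2 * L1_tilde \<kappa>1 \<kappa>2 z"
proof -
  have "(\<lambda>n. 2 * dk1 / k2 * (row3 B Y n * frob n z)) sums (2 * dk1 / k2 * L1_tilde \<kappa>1 \<kappa>2 z)"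
    by (intro fls_sums_mult L1_tilde_sums z)
  then have "1 * L1_hat \<kappa>1 \<kappa>2 z = 2 * dk1 / k2 * L1_tilde \<kappa>1 \<kappa>2 z"
    unfolding L1_hat_def
  proof (rule q_series_from_1_eqI)
    fix n
    have "K_inf (beta_hat \<kappa>1 \<kappa>2 (int n + 1)) = dk1 / k2 * Y (Suc (Suc n))"
      using K_inf_beta_hat[of "Suc n"] by (simp add: add.commute)
    then show "2 * dk1 / k2 * (row3 B Y (Suc n) * frob (Suc n) z) =
        1 * (K_inf (2 * beta \<kappa>1 \<kappa>2 (int n + 1) * beta_hat \<kappa>1 \<kappa>2 (int n + 1)) * frob (Suc n) z)"
      by (simp add: row3_def B_def K_inf_mult K_inf_numeral add.commute)
  qed (simp add: row3_def)
  then show ?thesis by simp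
qed

text \<open>The symmetric combination of B and Y at neighbouring indices is W plus twice one of its
  products. The series starts at m = 1, hence the subtraction of \<open>W 0 = 1\<close>.\<close>

lemma L2_hat_eq: "L2_hat \<kappa>1 \<kappa>2 1 = dk1 / k2 * (Log_Alt2 \<kappa>2 1 + 2 * L2_tilde \<kappa>1 \<kappa>2 1 - 1)"
proof -
  have "(\<lambda>n. dk1 / k2 * (W n + 2 * (B n * Y (Suc n)) - (if n = 0 then 1 else 0))) sums
      (dk1 / k2 * (Log_Alt2 \<kappa>2 1 + 2 * L2_tilde \<kappa>1 \<kappa>2 1 - 1))"
    using sums_If_finite[of "\<lambda>n::nat. n = 0" "\<lambda>n. 1 :: 'a fls"]
    by (intro fls_sums_mult fls_sums_diff fls_sums_add Log_Alt2_sums L2_tilde_sums) simp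
  then have "1 * L2_hat \<kappa>1 \<kappa>2 1 = dk1 / k2 * (Log_Alt2 \<kappa>2 1 + 2 * L2_tilde \<kappa>1 \<kappa>2 1 - 1)"
    unfolding L2_hat_def
  proof (rule q_series_from_1_eqI)
    fix n
    have h: "K_inf (beta_hat \<kappa>1 \<kappa>2 (int n + 1)) = dk1 / k2 * Y (Suc (Suc n))"
      "K_inf (beta_hat \<kappa>1 \<kappa>2 (int n)) = dk1 / k2 * Y (Suc n)"
      using K_inf_beta_hat[of "Suc n"] K_inf_beta_hat[of n] by (simp_all add: add.commute)
    have m: "int n + 1 - 1 = int n" by simp
    have b: "K_inf (beta \<kappa>1 \<kappa>2 (int n + 1)) = B (Suc (Suc n))" "K_inf (beta \<kappa>1 \<kappa>2 (int n)) = B (Suc n)"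
      by (simp_all add: B_def add.commute)
    show "dk1 / k2 * (W (Suc n) + 2 * (B (Suc n) * Y (Suc (Suc n))) - (if Suc n = 0 then 1 else 0)) =
        1 * (K_inf (beta_hat \<kappa>1 \<kappa>2 (int n + 1) * beta \<kappa>1 \<kappa>2 (int n + 1 - 1) +
          beta \<kappa>1 \<kappa>2 (int n + 1) * beta_hat \<kappa>1 \<kappa>2 (int n + 1 - 1)) * frob (Suc n) 1)"
      unfolding m K_inf_add K_inf_mult h b by (simp add: W_def algebra_simps)
  qed simp
  then show ?thesis by simp
qed

section \<open>The coordinate matrix of Log and the matrix M\<close>

definition S where "S = (\<Sum>n. s n)"
definition R where "R = (\<Sum>n. r n)"

lemma S_sums: "s sums S"
proof -
  have "vval_ge (int n + 0) (s n)" for n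
    using le_card_power[of n, where 'a='a] by (intro vval_ge_mono[OF s_val]) simp
  then show ?thesis unfolding S_def by (intro summable_sums vec_fls_summable_nat)
qed

lemma R_sums: "r sums R"
proof -
  have "vval_ge (int n + (-1)) (r n)" for n
    using le_card_power[of n, where 'a='a] by (intro vval_ge_mono[OF r_val]) linarith
  then show ?thesis unfolding R_def by (intro summable_sums vec_fls_summable_nat)
qed

lemma one_val: "val_ge (-1) (1 :: 'a fls)"
  by (rule val_ge_mono[OF val_ge_1]) simp

text \<open>Splitting \<open>gap n\<close> into theta and its twist turns one series into theta
  times its value at 1 minus its value at theta. This is how the values at theta enter M.\<close>

lemma row1_eq: "row1 X Z n = inverse k2 * (fls_X_inv * (row3 X Z n * frob n 1) - row3 X Z n * frob n fls_X_inv)"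
  by (simp add: row1_def row3_def gap_def field_simps)

lemma S_eq:
  "S $ 1 = inverse k2 * (fls_X_inv * L1_tilde \<kappa>1 \<kappa>2 1 - L1_tilde \<kappa>1 \<kappa>2 fls_X_inv)"
  "S $ 2 = inverse k2 * L1_tilde \<kappa>1 \<kappa>2 k1 + (Log_Alt2 \<kappa>2 1 + 2 * L2_tilde \<kappa>1 \<kappa>2 1)"
  "S $ 3 = L1_tilde \<kappa>1 \<kappa>2 1"
proof -
  have S: "(\<lambda>n. s n $ i) sums (S $ i)" for i using S_sums by (simp add: sums_vec_iff)
  have "(\<lambda>n. row1 B Y n) sums (inverse k2 * (fls_X_inv * L1_tilde \<kappa>1 \<kappa>2 1 - L1_tilde \<kappa>1 \<kappa>2 fls_X_inv))"
    unfolding row1_eq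
    by (intro fls_sums_mult fls_sums_diff L1_tilde_sums one_val val_ge_X_inv)
  then show "S $ 1 = inverse k2 * (fls_X_inv * L1_tilde \<kappa>1 \<kappa>2 1 - L1_tilde \<kappa>1 \<kappa>2 fls_X_inv)"
    using S[of 1] by (simp add: s_nth sums_iff)
  \<comment> \<open>The symmetric combination in \<open>row2\<close> is rewritten as the Wronskian
    plus twice one product, which brings \<open>Log_Alt2\<close> into the middle entry.\<close>
  have "row2 B Y = (\<lambda>n. inverse k2 * (row3 B Y n * frob n k1) + (W n + 2 * (B n * Y (Suc n))))"
    by (rule ext) (simp add: row2_def row3_def W_def field_simps)
  moreover have "(\<lambda>n. inverse k2 * (row3 B Y n * frob n k1) + (W n + 2 * (B n * Y (Suc n)))) sums
      (inverse k2 * L1_tilde \<kappa>1 \<kappa>2 k1 + (Log_Alt2 \<kappa>2 1 + 2 * L2_tilde \<kappa>1 \<kappa>2 1))"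
    by (intro fls_sums_mult fls_sums_add L1_tilde_sums k1_val Log_Alt2_sums L2_tilde_sums)
  ultimately show "S $ 2 = inverse k2 * L1_tilde \<kappa>1 \<kappa>2 k1 + (Log_Alt2 \<kappa>2 1 + 2 * L2_tilde \<kappa>1 \<kappa>2 1)"
    using S[of 2] by (simp add: s_nth sums_iff)
  show "S $ 3 = L1_tilde \<kappa>1 \<kappa>2 1"
    using S[of 3] L1_tilde_sums[OF one_val] by (simp add: s_nth sums_iff)
qed

lemma R_eq:
  "R $ 1 = inverse k2 * (fls_X_inv * Log_phi2 \<kappa>1 \<kappa>2 1 - Log_phi2 \<kappa>1 \<kappa>2 fls_X_inv)"
  "R $ 2 = inverse k2 * Log_phi2 \<kappa>1 \<kappa>2 k1 + 2 * L2 \<kappa>1 \<kappa>2 1"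
  "R $ 3 = Log_phi2 \<kappa>1 \<kappa>2 1"
proof -
  have R: "(\<lambda>n. r n $ i) sums (R $ i)" for i using R_sums by (simp add: sums_vec_iff)
  have "(\<lambda>n. row1 B B n) sums (inverse k2 * (fls_X_inv * Log_phi2 \<kappa>1 \<kappa>2 1 - Log_phi2 \<kappa>1 \<kappa>2 fls_X_inv))"
    unfolding row1_eq
    by (intro fls_sums_mult fls_sums_diff Log_phi2_sums one_val val_ge_X_inv)
  then show "R $ 1 = inverse k2 * (fls_X_inv * Log_phi2 \<kappa>1 \<kappa>2 1 - Log_phi2 \<kappa>1 \<kappa>2 fls_X_inv)"
    using R[of 1] by (simp add: r_nth sums_iff)
  have "row2 B B = (\<lambda>n. inverse k2 * (row3 B B n * frob n k1) + 2 * (B (Suc n) * B n))"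
    by (rule ext) (simp add: row2_def row3_def field_simps)
  moreover have "(\<lambda>n. inverse k2 * (row3 B B n * frob n k1) + 2 * (B (Suc n) * B n)) sums
      (inverse k2 * Log_phi2 \<kappa>1 \<kappa>2 k1 + 2 * L2 \<kappa>1 \<kappa>2 1)"
    by (intro fls_sums_mult fls_sums_add Log_phi2_sums k1_val L2_sums)
  ultimately show "R $ 2 = inverse k2 * Log_phi2 \<kappa>1 \<kappa>2 k1 + 2 * L2 \<kappa>1 \<kappa>2 1"
    using R[of 2] by (simp add: r_nth sums_iff)
  show "R $ 3 = Log_phi2 \<kappa>1 \<kappa>2 1"
    using R[of 3] Log_phi2_sums[OF one_val] by (simp add: r_nth sums_iff)
qed

text \<open>The correction at n = 0: the formula for the other \<open>P1 n\<close> would give (0,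
  -dk1, 0) there instead of the first unit vector, and e is the difference.\<close>

definition e :: "'a fls ^ 3" where "e = vector [1, dk1, 0]"

lemma Sym_log_axis:
  "Sym.log_axis i $ 1 = k2 * theta_deriv (R $ i) - 2 * dk1 * S $ i + e $ i"
  "Sym.log_axis i $ 2 = S $ i"
  "Sym.log_axis i $ 3 = R $ i - k1 / k2 * S $ i"
proof -
  have L: "(\<lambda>n. Sym_log n $ j $ i) sums (Sym.log_axis i $ j)" for j
  proof -
    have "(Sym_log n *v axis i 1) $ j = Sym_log n $ j $ i" for n
      by (simp add: matrix_vector_mult_def axis_def if_distrib[of "\<lambda>x. _ * x"] cong: if_cong)
    moreover have "(\<lambda>n. (Sym_log n *v axis i 1) $ j) sums (Sym.log_axis i $ j)"
      using Sym.log_axis_sums[of i] unfolding sums_vec_iff by blast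
    ultimately show ?thesis by simp
  qed
  have S: "(\<lambda>n. s n $ i) sums (S $ i)" and R: "(\<lambda>n. r n $ i) sums (R $ i)"
    using S_sums R_sums by (simp_all add: sums_vec_iff)
  show "Sym.log_axis i $ 2 = S $ i"
    using L[of 2] S by (simp add: Sym_log_def sums_iff)
  have "(\<lambda>n. r n $ i - k1 / k2 * s n $ i) sums (R $ i - k1 / k2 * S $ i)"
    by (intro fls_sums_diff fls_sums_mult R S)
  then show "Sym.log_axis i $ 3 = R $ i - k1 / k2 * S $ i"
    using L[of 3] by (simp add: Sym_log_def P3_def sums_iff)
  have k2r0: "k2 * theta_deriv (k1 / k2) = dk1"
  proof -
    have "k2 * theta_deriv (k1 / k2) = theta_deriv (k2 * (k1 / k2))" by (simp only: theta_deriv_mult) simp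
    then show ?thesis by (simp add: dk1_def)
  qed
  have "P1 n $ i = k2 * theta_deriv (r n $ i) - 2 * dk1 * s n $ i + (if n = 0 then e $ i else 0)" for n
  proof (cases "n = 0")
    case True
    have "\<forall>i. P1 0 $ i = k2 * theta_deriv (r 0 $ i) - 2 * dk1 * s 0 $ i + e $ i"
      by (simp add: forall_3 P1_def axis_def r_0 s_0 e_def k2r0)
    then show ?thesis using True by simp
  qed (simp add: P1_def vec_theta_deriv_def)
  moreover have "(\<lambda>n. k2 * theta_deriv (r n $ i) - 2 * dk1 * s n $ i + (if n = 0 then e $ i else 0)) sums
      (k2 * theta_deriv (R $ i) - 2 * dk1 * S $ i + e $ i)"
    using sums_If_finite[of "\<lambda>n::nat. n = 0" "\<lambda>n. e $ i"]
    by (intro fls_sums_add fls_sums_diff fls_sums_mult fls_sums_theta_deriv R S) simp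
  ultimately show "Sym.log_axis i $ 1 = k2 * theta_deriv (R $ i) - 2 * dk1 * S $ i + e $ i"
    using L[of 1] by (simp add: Sym_log_def sums_iff)
qed

text \<open>Subtracting N times the derivative cancels the derivative of R in the first coordinate
  and one of the two copies of dk1 * S; so no derivatives of the series survive in the
  determinant.\<close>

lemma Sym_log_coord:
  "Sym.log_coord $ i $ 1 = e $ i - dk1 * S $ i"
  "Sym.log_coord $ i $ 2 = S $ i"
  "Sym.log_coord $ i $ 3 = R $ i - k1 / k2 * S $ i"
proof -
  have d: "k2 * theta_deriv (R $ i - k1 / k2 * S $ i) =
      k2 * theta_deriv (R $ i) - dk1 * S $ i - k1 * theta_deriv (S $ i)"
  proof -
    have k2_deriv: "k2 * theta_deriv x = theta_deriv (k2 * x)" for x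
      by (simp add: theta_deriv_mult)
    have "k2 * (R $ i - k1 / k2 * S $ i) = k2 * R $ i - k1 * S $ i" by (simp add: right_diff_distrib)
    then show ?thesis
      unfolding k2_deriv by (simp add: theta_deriv_diff theta_deriv_mult[of k1] dk1_def)
  qed
  have "(Sym_N *v vec_theta_deriv (Sym.log_axis i)) $ 1 =
      k1 * theta_deriv (S $ i) + k2 * theta_deriv (R $ i - k1 / k2 * S $ i)"
    by (simp add: Sym_N_def matrix_vector_mult_def sum_3 vec_theta_deriv_def Sym_log_axis)
  note N = this[unfolded d]
  show "Sym.log_coord $ i $ 1 = e $ i - dk1 * S $ i"
    by (simp add: Sym.log_coord_def K_coord_def Sym_log_axis N algebra_simps)
  have N_other: "(Sym_N *v v) $ 2 = 0" "(Sym_N *v v) $ 3 = 0" for v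
    by (simp_all add: Sym_N_def matrix_vector_mult_def)
  show "Sym.log_coord $ i $ 2 = S $ i" "Sym.log_coord $ i $ 3 = R $ i - k1 / k2 * S $ i"
    by (simp_all add: Sym.log_coord_def K_coord_def Sym_log_axis N_other)
qed

text \<open>M arises from the transpose of \<open>log_coord\<close> by subtracting dk1 times the
  second row from the first, adding v times the second row to the third, and subtracting u times the
  third column from the first. The last step reflects \<open>row1_eq\<close>.\<close>

lemma det_M_mat: "det (M_mat \<kappa>1 \<kappa>2) = det Sym.log_coord"
proof -
  define u v where "u = fls_X_inv / k2" and "v = k1 / k2"
  have M: "M_mat \<kappa>1 \<kappa>2 = vector [
      vector [1 - 2 * dk1 * (S $ 1 - u * S $ 3), dk1 - 2 * dk1 * S $ 2, - 2 * dk1 * S $ 3],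
      vector [S $ 1 - u * S $ 3, S $ 2, S $ 3],
      vector [R $ 1 - u * R $ 3, R $ 2, R $ 3]]"
    by (simp add: M_mat_def Let_def vec_eq_iff forall_3 S_eq R_eq L1_hat_eq L2_hat_eq one_val k1_val u_def
        A_inf_pderiv flip: dk1_def) (simp add: field_simps)
  show ?thesis
    unfolding M det_3 Sym_log_coord v_def[symmetric] by (simp add: e_def algebra_simps)
qed

lemma Reg_Sym2: "Reg (Sym2 \<kappa>1 \<kappa>2) = det (M_mat \<kappa>1 \<kappa>2)"
  by (simp add: Sym.Reg_eq det_M_mat)

lemma monic_det_M_mat: "monic_inf (det (M_mat \<kappa>1 \<kappa>2))"
  by (simp add: det_M_mat Sym.log_coord_monic)

end

section \<open>The tensor square\<close>

definition blk :: "'b::zero ^ 3 ^ 3 \<Rightarrow> 'b ^ 1 ^ 1 \<Rightarrow> 'b ^ 4 ^ 4" where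
  "blk A a = vector [
     vector [A $ 1 $ 1, A $ 1 $ 2, A $ 1 $ 3, 0],
     vector [A $ 2 $ 1, A $ 2 $ 2, A $ 2 $ 3, 0],
     vector [A $ 3 $ 1, A $ 3 $ 2, A $ 3 $ 3, 0],
     vector [0, 0, 0, a $ 1 $ 1]]"

definition ext :: "'b::zero ^ 3 \<Rightarrow> 'b ^ 1 \<Rightarrow> 'b ^ 4" where
  "ext v c = vector [v $ 1, v $ 2, v $ 3, c $ 1]"

lemma blk_mult: "blk A a ** blk B b = blk (A ** B) (a ** b)" for A :: "'b::semiring_1 ^ 3 ^ 3"
  by (simp add: blk_def vec_eq_iff forall_4 vector_4 matrix_matrix_mult_def sum_4 sum_3)

lemma blk_add: "blk A a + blk B b = blk (A + B) (a + b)" for A :: "'b::monoid_add ^ 3 ^ 3"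
  by (simp add: blk_def vec_eq_iff forall_4 vector_4)

lemma blk_0 [simp]: "blk 0 0 = 0"
  by (simp add: blk_def vec_eq_iff forall_4 vector_4)

lemma blk_sum: "(\<Sum>i\<in>S. blk (f i) (g i)) = blk (\<Sum>i\<in>S. f i) (\<Sum>i\<in>S. g i)"
  for f :: "'c \<Rightarrow> 'b::comm_monoid_add ^ 3 ^ 3"
  by (induction S rule: infinite_finite_induct) (simp_all add: blk_add)

lemma blk_mat: "blk (mat x) (mat x) = mat x"
  by (simp add: blk_def vec_eq_iff forall_4 vector_4 mat_def)

lemma frob_mat_blk: "frob_mat n (blk A a) = blk (frob_mat n A) (frob_mat n a)"
  by (simp add: blk_def vec_eq_iff forall_4 vector_4 frob_mat_def)

lemma mat_theta_deriv_blk: "mat_theta_deriv (blk A a) = blk (mat_theta_deriv A) (mat_theta_deriv a)"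
  by (simp add: blk_def vec_eq_iff forall_4 vector_4 mat_theta_deriv_def)

lemma mval_ge_blk: "mval_ge k A \<Longrightarrow> mval_ge k a \<Longrightarrow> mval_ge k (blk A a)"
  by (simp add: blk_def mval_ge_def forall_4 vector_4)

lemma tws_mult_blk:
  "tws_mult (\<lambda>n. blk (P n) (p n)) (\<lambda>n. blk (E n) (e n)) = (\<lambda>n. blk (tws_mult P E n) (tws_mult p e n))"
  by (rule ext) (simp add: tws_mult_def frob_mat_blk blk_mult blk_sum)

lemma tws_const_blk: "tws_const (blk A a) = (\<lambda>n. blk (tws_const A n) (tws_const a n))"
  by (auto simp: tws_const_def fun_eq_iff)

lemma blk_vector_mult: "blk A a *v ext v c = ext (A *v v) (a *v c)" for A :: "'b::semiring_1 ^ 3 ^ 3"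
  by (simp add: blk_def ext_def vec_eq_iff forall_4 vector_4 matrix_vector_mult_def sum_4 sum_3)

lemma axis_ext:
  "axis 1 1 = ext (axis 1 1) 0" "axis 2 1 = ext (axis 2 1) 0" "axis 3 1 = ext (axis 3 1) 0"
  "axis 4 1 = ext 0 (axis 1 1)"
  by (simp_all add: ext_def vec_eq_iff forall_4 vector_4 axis_def)

lemma ext_sums: "f sums v \<Longrightarrow> g sums c \<Longrightarrow> (\<lambda>n. ext (f n) (g n)) sums ext v c"
  for v :: "'b::{comm_monoid_add,topological_space} ^ 3"
  unfolding sums_vec_iff by (simp add: ext_def forall_4 vector_4)

lemma K_coord_ext: "K_coord (blk N M) (ext v c) = ext (K_coord N v) (K_coord M c)"
proof -
  have "vec_theta_deriv (ext v c) = ext (vec_theta_deriv v) (vec_theta_deriv c)"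
    by (simp add: vec_theta_deriv_def ext_def vec_eq_iff forall_4 vector_4)
  moreover have "ext x y - ext x' y' = ext (x - x') (y - y')" for x x' :: "'a fls ^ 3" and y y'
    by (simp add: ext_def vec_eq_iff forall_4 vector_4)
  ultimately show ?thesis by (simp add: K_coord_def blk_vector_mult)
qed

lemma det_blk: "det (blk A a) = det A * a $ 1 $ 1" for A :: "'b::comm_ring_1 ^ 3 ^ 3"
proof -
  have f1234: "finite {2::4, 3, 4}" "1 \<notin> {2::4, 3, 4}" by auto
  have f234: "finite {3::4, 4}" "2 \<notin> {3::4, 4}" by auto
  have f34: "finite {4::4}" "3 \<notin> {4::4}" by auto
  show ?thesis
    unfolding det_3
    unfolding det_def UNIV_4
    unfolding sum_over_permutations_insert[OF f1234]
    unfolding sum_over_permutations_insert[OF f234]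
    unfolding sum_over_permutations_insert[OF f34]
    unfolding permutes_sing
    by (simp add: sign_swap_id permutation_swap_id sign_compose sign_id swap_id_eq permutation_compose
        blk_def vector_4 algebra_simps)
qed

lemma t_module_log_blk:
  assumes "t_module_log E N P" "t_module_log E' N' P'"
  shows "t_module_log (\<lambda>n. blk (E n) (E' n)) (blk N N') (\<lambda>n. blk (P n) (P' n))"
proof -
  interpret A: t_module_log E N P by fact
  interpret B: t_module_log E' N' P' by fact
  show ?thesis
  proof
    show "blk (E 0) (E' 0) = mat fls_X_inv + blk N N'"
      by (simp add: A.E_0 B.E_0 blk_add flip: blk_mat)
    show "blk N N' ** blk N N' = 0" by (simp add: blk_mult A.N_N B.N_N)
    show "blk N N' ** mat_theta_deriv (blk N N') = 0"
      by (simp add: blk_mult mat_theta_deriv_blk A.N_deriv B.N_deriv)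
    show "mval_ge (-1) (blk N N')" by (intro mval_ge_blk A.N_val B.N_val)
    have "\<forall>i j. blk (E n) (E' n) $ i $ j \<in> range A_inf" for n
      by (simp add: blk_def forall_4 vector_4 A.E_A B.E_A A_inf_range_closed(5) del: image_iff)
    then show "blk (E n) (E' n) $ i $ j \<in> range A_inf" for n i j by blast
    obtain d d' where "\<forall>n>d. E n = 0" "\<forall>n>d'. E' n = 0"
      using A.E_finite B.E_finite by blast
    then show "\<exists>d. \<forall>n>d. blk (E n) (E' n) = 0"
      by (intro exI[of _ "max d d'"]) simp
    show "blk (P 0) (P' 0) = mat 1" by (simp add: A.P_0 B.P_0 blk_mat)
    show "tws_mult (tws_const (blk (E 0) (E' 0))) (\<lambda>n. blk (P n) (P' n)) =
        tws_mult (\<lambda>n. blk (P n) (P' n)) (\<lambda>n. blk (E n) (E' n))"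
      by (simp add: tws_const_blk tws_mult_blk A.P_eq B.P_eq)
    show "mval_ge (int n) (blk (P n) (P' n))" for n by (intro mval_ge_blk A.P_val B.P_val)
  qed
qed

text \<open>On a direct sum both Log and the nilpotent part act blockwise, so the coordinate matrix
  is block diagonal.\<close>

lemma Reg_blk:
  assumes "t_module_log E N P" "t_module_log E' N' P'"
  shows "Reg (\<lambda>n. blk (E n) (E' n)) = Reg E * Reg E'"
proof -
  interpret A: t_module_log E N P by fact
  interpret B: t_module_log E' N' P' by fact
  interpret T: t_module_log "\<lambda>n. blk (E n) (E' n)" "blk N N'" "\<lambda>n. blk (P n) (P' n)"
    by (rule t_module_log_blk assms)+
  have 0: "(\<lambda>n. M n *v 0) sums 0" for M :: "nat \<Rightarrow> 'a fls ^ 'd ^ 'd" by simp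
  have L: "T.log_axis i = ext v c"
    if "axis i 1 = ext x y" "(\<lambda>n. P n *v x) sums v" "(\<lambda>n. P' n *v y) sums c" for i x y v c
    using T.log_axis_sums[of i] ext_sums[OF that(2,3)] unfolding that(1) blk_vector_mult
    by (rule sums_unique2)
  have c0: "K_coord M 0 = 0" for M :: "'a fls ^ 'd ^ 'd"
    by (simp add: K_coord_def vec_theta_deriv_def vec_eq_iff matrix_vector_mult_def)
  have "T.log_coord $ 1 = ext (A.log_coord $ 1) 0" "T.log_coord $ 2 = ext (A.log_coord $ 2) 0"
    "T.log_coord $ 3 = ext (A.log_coord $ 3) 0" "T.log_coord $ 4 = ext 0 (B.log_coord $ 1)"
    unfolding T.log_coord_def A.log_coord_def B.log_coord_def
    using L[OF axis_ext(1) A.log_axis_sums 0] L[OF axis_ext(2) A.log_axis_sums 0]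
      L[OF axis_ext(3) A.log_axis_sums 0] L[OF axis_ext(4) 0 B.log_axis_sums]
    by (simp_all add: K_coord_ext c0)
  then have "T.log_coord = blk A.log_coord B.log_coord"
    by (simp add: vec_eq_iff[of T.log_coord] forall_4) (simp add: blk_def ext_def vector_4)
  then show ?thesis
    by (simp add: T.Reg_eq A.Reg_eq B.Reg_eq det_blk det_1)
qed

context rank2_small
begin

text \<open>For \<open>p \<noteq> 2\<close> the tensor square splits into symmetric and alternating tensors: the second and third
  coordinates are replaced by their mean and their difference.\<close>

definition half :: "'a fls" where "half = fls_const (inverse 2)"
text \<open>This is kappa1 / (2 kappa2). The nilpotent part k1 x3 + k2 x4 is not symmetric in x2 and
  x3; adding kh (x3 - x2) to x4 rewrites it as k1 times the mean plus k2 times the new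
  coordinate.\<close>

definition kh :: "'a fls" where "kh = fls_const (inverse (2 * \<kappa>2)) * k1"

definition split :: "'a fls ^ 4 ^ 4" where
  "split = vector [
     vector [1, 0, 0, 0],
     vector [0, half, half, 0],
     vector [0, - kh, kh, 1],
     vector [0, -1, 1, 0]]"

definition split_inv :: "'a fls ^ 4 ^ 4" where
  "split_inv = vector [
     vector [1, 0, 0, 0],
     vector [0, 1, 0, - half],
     vector [0, 1, 0, half],
     vector [0, 0, 1, - kh]]"

lemma half_add: "half + half = 1"
proof -
  have "inverse 2 + inverse 2 = (1 :: 'a)" using two_neq_0 by (simp add: field_simps)
  then show ?thesis by (simp add: half_def fls_plus_const)
qed

lemma half_2: "half * 2 = 1"
  by (simp add: mult_2_right half_add)

lemma k2_kh: "k2 * kh = half * k1"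
proof -
  have "\<kappa>2 * inverse (2 * \<kappa>2) = inverse 2" using two_neq_0 by (simp add: field_simps)
  then show ?thesis by (simp add: half_def kh_def mult.assoc[symmetric])
qed

lemma frob_half [simp]: "frob n half = half"
  by (simp add: half_def)

lemma split_inverse: "split ** split_inv = mat 1" "split_inv ** split = mat 1"
  by (simp_all add: half_2 split_def split_inv_def vec_eq_iff forall_4 vector_4 matrix_matrix_mult_def sum_4
      mat_def half_add algebra_simps)

lemma split_A: "split $ i $ j \<in> range A_inf" "split_inv $ i $ j \<in> range A_inf"
proof -
  have "half \<in> range A_inf" "kh \<in> range A_inf"
    by (auto simp: half_def kh_def intro!: A_inf_range_closed simp del: image_iff)
  then have "\<forall>i j. split $ i $ j \<in> range A_inf \<and> split_inv $ i $ j \<in> range A_inf"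
    by (simp add: split_def split_inv_def forall_4 vector_4 A_inf_range_closed del: image_iff)
  then show "split $ i $ j \<in> range A_inf" "split_inv $ i $ j \<in> range A_inf" by blast+
qed

lemma half_mult: "half * x + half * x = x"
  using half_add by (metis distrib_right mult_1)

text \<open>Compared coefficient by coefficient in tau. On the difference x3 - x2 the terms with
  kappa1 cancel and theta - kappa2 tau remains, which is the alternating square.\<close>

lemma split_intertwines:
  "tws_mult (tws_const split) (phi_tensor2 \<kappa>1 \<kappa>2) =
     tws_mult (\<lambda>n. blk (Sym2 \<kappa>1 \<kappa>2 n) (Alt2 \<kappa>2 n)) (tws_const split)"
proof
  fix n :: nat
  have half2: "k1 * half + k1 * half = k1" "half * k1 + half * k1 = k1"
    using half_mult[of k1] by (simp_all add: mult.commute)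
  consider "n = 0" | "n = 1" | "n = 2" | "n > 2" by linarith
  then show "tws_mult (tws_const split) (phi_tensor2 \<kappa>1 \<kappa>2) n =
      tws_mult (\<lambda>n. blk (Sym2 \<kappa>1 \<kappa>2 n) (Alt2 \<kappa>2 n)) (tws_const split) n"
    unfolding tws_mult_const_left tws_mult_const_right
    by cases (simp_all add: phi_tensor2_def Sym2_def Alt2_eq mat_def Let_def split_def blk_def vec_eq_iff
        forall_4 vector_4 matrix_matrix_mult_def sum_4 frob_mat_def frob_minus k2_kh half2 half_2 half_mult
        mult.commute)
qed

lemma Reg_phi_tensor2: "Reg (phi_tensor2 \<kappa>1 \<kappa>2) = Reg (Sym2 \<kappa>1 \<kappa>2) * Reg (Alt2 \<kappa>2)"
proof -
  have "phi_tensor2 \<kappa>1 \<kappa>2 0 = mat fls_X_inv + vector [vector [0, 0, k1, k2], 0, 0, 0]"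
    by (simp add: phi_tensor2_def Let_def vec_eq_iff forall_4 vector_4 mat_def)
  then have "Reg (phi_tensor2 \<kappa>1 \<kappa>2) = Reg (\<lambda>n. blk (Sym2 \<kappa>1 \<kappa>2 n) (Alt2 \<kappa>2 n))"
    by (rule Reg_transport[OF t_module_log_blk[OF Sym.t_module_log_axioms Alt.t_module_log_axioms]])
      (rule split_inverse split_A split_intertwines)+
  also have "\<dots> = Reg (Sym2 \<kappa>1 \<kappa>2) * Reg (Alt2 \<kappa>2)"
    by (rule Reg_blk[OF Sym.t_module_log_axioms Alt.t_module_log_axioms])
  finally show ?thesis .
qed

end

theorem theorem5p3p7:
  fixes \<kappa>1 :: "'a::finite_field poly" and \<kappa>2 :: 'a
  assumes "CHAR('a) \<noteq> 2" and "\<kappa>2 \<noteq> 0"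
  shows
    "(real (degree \<kappa>1) \<le> (real CARD('a) + 1) / 2 \<longrightarrow>
        Reg (Alt2 \<kappa>2) = Log_Alt2 \<kappa>2 1 \<and>
        Log_Alt2 \<kappa>2 1 =
          1 + K_inf (const_K \<kappa>2 / (theta_K - theta_K ^ CARD('a))) *
              (\<Sum>n. let m = int n + 1 in
                 K_inf (beta \<kappa>1 \<kappa>2 m * beta_tilde \<kappa>1 \<kappa>2 (m - 2)
                        - beta \<kappa>1 \<kappa>2 (m - 1) * beta_tilde \<kappa>1 \<kappa>2 (m - 1))))
     \<and>
     (degree \<kappa>1 \<le> 1 \<longrightarrow>
        (\<exists>\<gamma>. \<gamma> \<noteq> 0 \<and> monic_inf (fls_const \<gamma> * det (M_mat \<kappa>1 \<kappa>2)) \<and>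
              Reg (Sym2 \<kappa>1 \<kappa>2) = fls_const \<gamma> * det (M_mat \<kappa>1 \<kappa>2)) \<and>
        Reg (phi_tensor2 \<kappa>1 \<kappa>2) = Reg (Sym2 \<kappa>1 \<kappa>2) * Reg (Alt2 \<kappa>2))"
proof (intro conjI impI)
  interpret rank2 \<kappa>1 \<kappa>2 by unfold_locales (rule assms)
  show "Reg (Alt2 \<kappa>2) = Log_Alt2 \<kappa>2 1" by (rule Reg_Alt2)
  show "Log_Alt2 \<kappa>2 1 = 1 + K_inf (const_K \<kappa>2 / (theta_K - theta_K ^ CARD('a))) *
      (\<Sum>n. let m = int n + 1 in
         K_inf (beta \<kappa>1 \<kappa>2 m * beta_tilde \<kappa>1 \<kappa>2 (m - 2)
                - beta \<kappa>1 \<kappa>2 (m - 1) * beta_tilde \<kappa>1 \<kappa>2 (m - 1)))"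
    by (rule Log_Alt2_eq)
next
  assume "degree \<kappa>1 \<le> 1"
  then interpret rank2_small \<kappa>1 \<kappa>2 using assms by unfold_locales auto
  show "\<exists>\<gamma>. \<gamma> \<noteq> 0 \<and> monic_inf (fls_const \<gamma> * det (M_mat \<kappa>1 \<kappa>2)) \<and>
      Reg (Sym2 \<kappa>1 \<kappa>2) = fls_const \<gamma> * det (M_mat \<kappa>1 \<kappa>2)"
    by (rule exI[of _ 1]) (simp add: monic_det_M_mat Reg_Sym2)
  show "Reg (phi_tensor2 \<kappa>1 \<kappa>2) = Reg (Sym2 \<kappa>1 \<kappa>2) * Reg (Alt2 \<kappa>2)"
    by (rule Reg_phi_tensor2)
qed

end
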